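(* Let $\Omega\subset\mathbb{R}^n$ be an open bounded domain, $1\le p<\infty$, $0<s<1$ and $\alpha\ge 0$. Then $$(L^p(\Omega, d^{\alpha p}), W^{1,p}(\Omega, d^{\alpha p}, d^{(\alpha+1)p}))_{s,p}= \widetilde W^{s,p}(\Omega, d^{\alpha p}, d^{(\alpha+s)p})= W^{s,p}(\Omega, d^{\alpha p}, \delta^{(\alpha+s)p})$$ with equivalence of norms.
   Context: For a bounded domain $\Omega\subset\mathbb{R}^n$, $d(x)=d(x,\partial\Omega)$ denotes the distance from $x\in\Omega$ to the boundary of $\Omega$, and $\delta(x,y)=\min\{d(x),d(y)\}$ for $x,y\in\Omega$. For exponents $a,b\ge 0$ and $1\le p<\infty$: - $\|f\|_{L^p(\Omega,d^{a})}=\|f\,d^{a/p}\|_{L^p(\Omega)}$, and $L^p(\Omega,d^a)$ is the space of measurable functions for which this is finite. - $W^{1,p}(\Omega,d^{a},d^{b})=\{f\in L^p(\Omega,d^{a}) : \|\nabla f\|_{L^p(\Omega,d^{b})}<\infty\}$ (weak gradient), with norm $\|f\|_{L^p(\Omega,d^a)}+\|\nabla f\|_{L^p(\Omega,d^b)}$. - $\widetilde W^{s,p}(\Omega,d^{a},d^{b})=\{f\in L^p(\Omega,d^{a}) : |f|_{\widetilde W^{s,p}(\Omega,d^{b})}<\infty\}$, where $$|f|_{\widetilde W^{s,p}(\Omega,d^b)}^p=\int_\Omega\int_{|x-y|<\frac{d(x)}{2}}\frac{|f(x)-f(y)|^p}{|x-y|^{n+sp}}\,dy\,d(x)^b\,dx,$$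 with norm $\|f\|_{L^p(\Omega,d^a)}+|f|_{\widetilde W^{s,p}(\Omega,d^b)}$. - $W^{s,p}(\Omega,d^{a},\delta^{b})=\{f\in L^p(\Omega,d^{a}) : |f|_{W^{s,p}(\Omega,\delta^{b})}<\infty\}$, where $$|f|_{W^{s,p}(\Omega,\delta^b)}^p=\int_\Omega\int_\Omega\frac{|f(x)-f(y)|^p}{|x-y|^{n+sp}}\,\delta(x,y)^b\,dy\,dx,$$ with norm $\|f\|_{L^p(\Omega,d^a)}+|f|_{W^{s,p}(\Omega,\delta^b)}$. The real interpolation space $(L^p(\Omega, d^{\alpha p}), W^{1,p}(\Omega, d^{\alpha p}, d^{(\alpha+1)p}))_{s,p}$ is the set of $f\in L^p(\Omega,d^{\alpha p})$ for which the norm $$\left(\int_0^\infty \lambda^{-sp}K(\lambda,f)^p\,\frac{d\lambda}{\lambda}\right)^{1/p}$$ is finite, where $$K(\lambda,f)=\inf\{\|g\|_{L^p(\Omega,d^{\alpha p})}+\lambda\|h\|_{W^{1,p}(\Omega,d^{\alpha p},d^{(\alpha+1)p})} : f=g+h\},$$ the infimum being over $g\in L^p(\Omega,d^{\alpha p})$ and $h\in W^{1,p}(\Omega,d^{\alpha p},d^{(\alpha+1)p})$. "Equality with equivalence of norms" means that the spaces coincide as sets and each of their norms is bounded by a constant (independent of $f$) times any other. *)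

theory Defs
  imports "HOL-Analysis.Analysis"
begin

text \<open>
  Functions on \<open>\<Omega>\<close> are represented by total functions whose values outside \<open>\<Omega>\<close> are never inspected,
  and elements of \<open>L\<^sup>p\<close> by their representatives: each space below is closed under
  almost-everywhere equality on \<open>\<Omega>\<close>.  A norm is real valued and is meaningful only on its own
  space, since \<^const>\<open>enn2real\<close> sends \<open>\<infinity>\<close> to \<open>0\<close>; finiteness is always imposed separately, on the
  \<^typ>\<open>ennreal\<close>-valued integral.
\<close>

definition bdist :: "(real ^ 'n) set \<Rightarrow> real ^ 'n \<Rightarrow> real" where
  "bdist \<Omega> x = infdist x (frontier \<Omega>)"

definition bdist2 :: "(real ^ 'n) set \<Rightarrow> real ^ 'n \<Rightarrow> real ^ 'n \<Rightarrow> real" where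
  "bdist2 \<Omega> x y = min (bdist \<Omega> x) (bdist \<Omega> y)"


subsection \<open>Weighted Lebesgue spaces\<close>

definition Lp_integral :: "real \<Rightarrow> (real ^ 'n) set \<Rightarrow> (real ^ 'n \<Rightarrow> 'b::real_normed_vector) \<Rightarrow> ennreal" where
  "Lp_integral p \<Omega> f = (\<integral>\<^sup>+ x. ennreal (norm (f x) powr p) \<partial>lebesgue_on \<Omega>)"

definition Lp_norm :: "real \<Rightarrow> (real ^ 'n) set \<Rightarrow> (real ^ 'n \<Rightarrow> 'b::real_normed_vector) \<Rightarrow> real" where
  "Lp_norm p \<Omega> f = enn2real (Lp_integral p \<Omega> f) powr (1 / p)"

definition weighted :: "real \<Rightarrow> (real ^ 'n) set \<Rightarrow> real \<Rightarrow> (real ^ 'n \<Rightarrow> 'b::real_normed_vector) \<Rightarrow> real ^ 'n \<Rightarrow> 'b" where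
  "weighted p \<Omega> a f = (\<lambda>x. (bdist \<Omega> x powr (a / p)) *\<^sub>R f x)"

text \<open>The spaces \<open>L\<^sup>p(\<Omega>, d\<^sup>a)\<close>; the vector-valued case is used for gradients.\<close>

definition wLp :: "real \<Rightarrow> (real ^ 'n) set \<Rightarrow> real \<Rightarrow> (real ^ 'n \<Rightarrow> 'b::real_normed_vector) set" where
  "wLp p \<Omega> a = {f. f \<in> borel_measurable (lebesgue_on \<Omega>) \<and> Lp_integral p \<Omega> (weighted p \<Omega> a f) < \<infinity>}"

definition wLp_norm :: "real \<Rightarrow> (real ^ 'n) set \<Rightarrow> real \<Rightarrow> (real ^ 'n \<Rightarrow> 'b::real_normed_vector) \<Rightarrow> real" where
  "wLp_norm p \<Omega> a f = Lp_norm p \<Omega> (weighted p \<Omega> a f)"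


subsection \<open>Weak gradients and weighted Sobolev spaces\<close>

primrec Ck :: "nat \<Rightarrow> (real ^ 'n \<Rightarrow> real) \<Rightarrow> bool" where
  "Ck 0 \<phi> \<longleftrightarrow> continuous_on UNIV \<phi>"
| "Ck (Suc k) \<phi> \<longleftrightarrow> (\<forall>x. \<phi> differentiable at x) \<and> (\<forall>v. Ck k (\<lambda>x. frechet_derivative \<phi> (at x) v))"

text \<open>The test functions \<open>C\<^sub>c\<^sup>\<infinity>(\<Omega>)\<close>, extended by zero to the whole space.\<close>

definition test_fun :: "(real ^ 'n) set \<Rightarrow> (real ^ 'n \<Rightarrow> real) \<Rightarrow> bool" where
  "test_fun \<Omega> \<phi> \<longleftrightarrow> (\<forall>k. Ck k \<phi>) \<and> compact (closure {x. \<phi> x \<noteq> 0}) \<and> closure {x. \<phi> x \<noteq> 0} \<subseteq> \<Omega>"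

definition loc_integrable :: "(real ^ 'n) set \<Rightarrow> (real ^ 'n \<Rightarrow> 'b::{banach, second_countable_topology}) \<Rightarrow> bool" where
  "loc_integrable \<Omega> f \<longleftrightarrow> (\<forall>K. compact K \<and> K \<subseteq> \<Omega> \<longrightarrow> integrable (lebesgue_on K) f)"

definition has_weak_gradient :: "(real ^ 'n) set \<Rightarrow> (real ^ 'n \<Rightarrow> real) \<Rightarrow> (real ^ 'n \<Rightarrow> real ^ 'n) \<Rightarrow> bool" where
  "has_weak_gradient \<Omega> f G \<longleftrightarrow> loc_integrable \<Omega> f \<and> loc_integrable \<Omega> G \<and>
     (\<forall>\<phi> i. test_fun \<Omega> \<phi> \<longrightarrow>
        (\<integral>x. f x * frechet_derivative \<phi> (at x) (axis i 1) \<partial>lebesgue_on \<Omega>)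
          = - (\<integral>x. G x $ i * \<phi> x \<partial>lebesgue_on \<Omega>))"

text \<open>For open \<open>\<Omega>\<close> the weak gradient is unique up to a null set, so that the choice is immaterial.\<close>

definition weak_gradient :: "(real ^ 'n) set \<Rightarrow> (real ^ 'n \<Rightarrow> real) \<Rightarrow> real ^ 'n \<Rightarrow> real ^ 'n" where
  "weak_gradient \<Omega> f = (SOME G. has_weak_gradient \<Omega> f G)"

text \<open>\<open>W\<^sup>1\<^sup>,\<^sup>p(\<Omega>, d\<^sup>a, d\<^sup>b)\<close>\<close>

definition W1p :: "real \<Rightarrow> (real ^ 'n) set \<Rightarrow> real \<Rightarrow> real \<Rightarrow> (real ^ 'n \<Rightarrow> real) set" where
  "W1p p \<Omega> a b = {f \<in> wLp p \<Omega> a. (\<exists>G. has_weak_gradient \<Omega> f G) \<and> weak_gradient \<Omega> f \<in> wLp p \<Omega> b}"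

definition W1p_norm :: "real \<Rightarrow> (real ^ 'n) set \<Rightarrow> real \<Rightarrow> real \<Rightarrow> (real ^ 'n \<Rightarrow> real) \<Rightarrow> real" where
  "W1p_norm p \<Omega> a b f = wLp_norm p \<Omega> a f + wLp_norm p \<Omega> b (weak_gradient \<Omega> f)"


subsection \<open>Weighted fractional Sobolev spaces\<close>

text \<open>The \<open>p\<close>-th power of the seminorm of \<open>W\<close>-tilde; the ball is contained in \<open>\<Omega>\<close> for \<open>x \<in> \<Omega>\<close>.\<close>

definition Wt_integral :: "real \<Rightarrow> real \<Rightarrow> (real ^ 'n) set \<Rightarrow> real \<Rightarrow> (real ^ 'n \<Rightarrow> real) \<Rightarrow> ennreal" where
  "Wt_integral s p \<Omega> b f =
     (\<integral>\<^sup>+ x. (\<integral>\<^sup>+ y. ennreal (\<bar>f x - f y\<bar> powr p / norm (x - y) powr (real CARD('n) + s * p))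
                  \<partial>lebesgue_on (ball x (bdist \<Omega> x / 2)))
             * ennreal (bdist \<Omega> x powr b) \<partial>lebesgue_on \<Omega>)"

definition Wt :: "real \<Rightarrow> real \<Rightarrow> (real ^ 'n) set \<Rightarrow> real \<Rightarrow> real \<Rightarrow> (real ^ 'n \<Rightarrow> real) set" where
  "Wt s p \<Omega> a b = {f \<in> wLp p \<Omega> a. Wt_integral s p \<Omega> b f < \<infinity>}"

definition Wt_norm :: "real \<Rightarrow> real \<Rightarrow> (real ^ 'n) set \<Rightarrow> real \<Rightarrow> real \<Rightarrow> (real ^ 'n \<Rightarrow> real) \<Rightarrow> real" where
  "Wt_norm s p \<Omega> a b f = wLp_norm p \<Omega> a f + enn2real (Wt_integral s p \<Omega> b f) powr (1 / p)"

text \<open>The spaces \<open>W\<^sup>s\<^sup>,\<^sup>p(\<Omega>, d\<^sup>a, \<delta>\<^sup>b)\<close>.\<close>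

definition Ws_integral :: "real \<Rightarrow> real \<Rightarrow> (real ^ 'n) set \<Rightarrow> real \<Rightarrow> (real ^ 'n \<Rightarrow> real) \<Rightarrow> ennreal" where
  "Ws_integral s p \<Omega> b f =
     (\<integral>\<^sup>+ x. (\<integral>\<^sup>+ y. ennreal (\<bar>f x - f y\<bar> powr p / norm (x - y) powr (real CARD('n) + s * p)
                               * bdist2 \<Omega> x y powr b)
                  \<partial>lebesgue_on \<Omega>) \<partial>lebesgue_on \<Omega>)"

definition Ws :: "real \<Rightarrow> real \<Rightarrow> (real ^ 'n) set \<Rightarrow> real \<Rightarrow> real \<Rightarrow> (real ^ 'n \<Rightarrow> real) set" where
  "Ws s p \<Omega> a b = {f \<in> wLp p \<Omega> a. Ws_integral s p \<Omega> b f < \<infinity>}"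

definition Ws_norm :: "real \<Rightarrow> real \<Rightarrow> (real ^ 'n) set \<Rightarrow> real \<Rightarrow> real \<Rightarrow> (real ^ 'n \<Rightarrow> real) \<Rightarrow> real" where
  "Ws_norm s p \<Omega> a b f = wLp_norm p \<Omega> a f + enn2real (Ws_integral s p \<Omega> b f) powr (1 / p)"


subsection \<open>Real interpolation between \<open>L\<^sup>p(\<Omega>, d\<^sup>a)\<close> and \<open>W\<^sup>1\<^sup>,\<^sup>p(\<Omega>, d\<^sup>a, d\<^sup>b)\<close>\<close>

text \<open>
  The infimum is over a set bounded below by \<open>0\<close>, which contains the decomposition \<open>f = f + 0\<close>
  when \<open>f \<in> L\<^sup>p(\<Omega>, d\<^sup>a)\<close>.
\<close>

definition K_functional :: "real \<Rightarrow> (real ^ 'n) set \<Rightarrow> real \<Rightarrow> real \<Rightarrow> real \<Rightarrow> (real ^ 'n \<Rightarrow> real) \<Rightarrow> real" where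
  "K_functional p \<Omega> a b t f =
     Inf {wLp_norm p \<Omega> a g + t * W1p_norm p \<Omega> a b h | g h.
            g \<in> wLp p \<Omega> a \<and> h \<in> W1p p \<Omega> a b \<and> (AE x in lebesgue_on \<Omega>. f x = g x + h x)}"

definition interp_integral :: "real \<Rightarrow> real \<Rightarrow> (real ^ 'n) set \<Rightarrow> real \<Rightarrow> real \<Rightarrow> (real ^ 'n \<Rightarrow> real) \<Rightarrow> ennreal" where
  "interp_integral s p \<Omega> a b f =
     (\<integral>\<^sup>+ t. ennreal (t powr (- s * p) * K_functional p \<Omega> a b t f powr p / t) \<partial>lebesgue_on {0<..})"

definition interp_space :: "real \<Rightarrow> real \<Rightarrow> (real ^ 'n) set \<Rightarrow> real \<Rightarrow> real \<Rightarrow> (real ^ 'n \<Rightarrow> real) set" where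
  "interp_space s p \<Omega> a b = {f \<in> wLp p \<Omega> a. interp_integral s p \<Omega> a b f < \<infinity>}"

definition interp_norm :: "real \<Rightarrow> real \<Rightarrow> (real ^ 'n) set \<Rightarrow> real \<Rightarrow> real \<Rightarrow> (real ^ 'n \<Rightarrow> real) \<Rightarrow> real" where
  "interp_norm s p \<Omega> a b f = enn2real (interp_integral s p \<Omega> a b f) powr (1 / p)"


definition eq_with_equivalent_norms :: "'f set \<Rightarrow> ('f \<Rightarrow> real) \<Rightarrow> 'f set \<Rightarrow> ('f \<Rightarrow> real) \<Rightarrow> bool" where
  "eq_with_equivalent_norms X N Y M \<longleftrightarrow>
     X = Y \<and> (\<exists>C>0. \<forall>f\<in>X. N f \<le> C * M f \<and> M f \<le> C * N f)"

end

theory Submission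
  imports Defs
begin

text \<open>
  Write \<open>d\<close> for the distance to the boundary and \<open>K(l)\<close> for the K-functional of \<open>f\<close>, with
  \<open>a = \<alpha> p\<close>. The quantity that links the three norms is the modulus of smoothness at relative
  scale \<open>l\<close>,
  \<open>\<omega>(l) = \<integral>\<^bsub>\<Omega>\<^esub> d(x)^a (l d(x))^(-n) \<integral>\<^bsub>|x-y| < min(l,1/2) d(x)\<^esub> |f(x) - f(y)|^p dy dx\<close>,
  an average of \<open>|f(x) - f(y)|^p\<close> over balls whose radius is a fixed proportion of \<open>d(x)\<close>. On such a
  ball \<open>d\<close> differs from \<open>d(x)\<close> by a factor of at most two, so weights can be moved from one point to another.

  The ball seminorm is an average of \<open>\<omega>\<close> over scales. Tonelli turns
  \<open>\<integral>\<^sub>0\<^sup>1 l^(-sp-1) \<omega>(l) dl\<close> into a double integral of \<open>|f(x) - f(y)|^p\<close> against the integral of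
  \<open>l^(-sp-n-1)\<close> over \<open>l > |x-y|/d(x)\<close>, and the latter is comparable to \<open>(|x-y|/d(x))^(-n-sp)\<close>
  (\<open>modulus_average_equiv_Wt\<close>). It remains to compare \<open>\<omega>\<close> and \<open>K\<close> scale by scale.

  \<^item> \<open>\<omega>(l) \<le> C K(l)^p\<close> (\<open>modulus_le_K\<close>). Split \<open>f = g + h\<close>. For \<open>g\<close> the two function values are
    estimated separately. For \<open>h\<close> one writes \<open>h(x+z) - h(x) = \<integral>\<^sub>0\<^sup>1 \<nabla>h(x+tz) \<bullet> z dt\<close> for
    almost every \<open>x\<close>, applies Jensen's inequality and integrates in \<open>x\<close> first; since \<open>|z| < l d(x)\<close>, this
    produces exactly the factor \<open>l^p\<close> and the additional weight \<open>d^p\<close> on the gradient.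

  \<^item> \<open>K(l)^p \<le> C (\<omega>(l) + l^p \<parallel>f\<parallel>^p)\<close> for \<open>l \<le> 1/2\<close> (\<open>K_le_modulus\<close>). Here \<open>h\<close> is a local average
    of \<open>f\<close> at scale \<open>\<tau> d\<close> with \<open>\<tau> = l/2\<close>, namely the quotient of
    \<open>\<integral> \<psi>((x-y)/(\<tau> d(y))) f(y) dy\<close> by the same integral with \<open>f\<close> replaced by \<open>1\<close>. The scale is taken at
    \<open>y\<close> and not at \<open>x\<close>: \<open>d\<close> is only Lipschitz, and with this choice it is never differentiated.
    The quotient reproduces constants, so subtracting \<open>f(x)\<close> from \<open>f\<close> changes neither the error
    \<open>f - h\<close> at \<open>x\<close> nor the gradient of \<open>h\<close>, and both are bounded by the mean oscillation of \<open>f\<close>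
    around \<open>x\<close> (\<open>smoothing_pointwise\<close>), hence after Jensen by \<open>\<omega>(l)\<close>.

  The term \<open>l^p \<parallel>f\<parallel>^p\<close> is harmless when integrated against \<open>l^(-sp-1)\<close> near \<open>0\<close> because \<open>s < 1\<close>. For large
  \<open>l\<close> the K-functional is comparable to \<open>\<parallel>f\<parallel>\<close>, and \<open>s > 0\<close> makes \<open>l^(-sp-1)\<close> integrable there. So the
  interpolation norm is equivalent to the norm built from the ball seminorm.

  For the seminorm over all pairs, pairs with \<open>|x-y| < d(x)/2\<close> or \<open>|x-y| < d(y)/2\<close> are the ones seen by
  the ball seminorm. For the others the difference of \<open>f\<close> is split into two values, and integrating
  \<open>|x-y|^(-n-sp)\<close> over \<open>|x-y| \<ge> d(x)/2\<close> gives \<open>d(x)^(-sp)\<close>, which turns the weight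
  \<open>d^((\<alpha>+s)p)\<close> into \<open>d^(\<alpha>p)\<close> (\<open>Wt_le_Ws\<close>, \<open>Ws_le_Wt\<close>).

  Two preparations make this rigorous. Functions on \<open>\<Omega>\<close> are only Lebesgue measurable there; they are
  replaced by Borel functions on the whole space, for which Tonelli and translations are directly
  available. And weak gradients have to be unique, so that the gradient in the Sobolev norm is the one computed
  for \<open>h\<close>, and have to integrate along segments; both rest on the fundamental lemma of the calculus of
  variations, which is proved with smooth bumps built from \<open>exp(-1/t)\<close>.
\<close>

section \<open>Integrals and elementary inequalities\<close>

lemma nn_integral_lborel_translate:
  fixes f :: "'a::euclidean_space \<Rightarrow> ennreal"
  assumes [measurable]: "f \<in> borel_measurable borel"
  shows "(\<integral>\<^sup>+x. f (c + x) \<partial>lborel) = (\<integral>\<^sup>+x. f x \<partial>lborel)"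
proof -
  have "(\<integral>\<^sup>+x. f x \<partial>lborel) = (\<integral>\<^sup>+x. f x \<partial>distr lborel borel ((+) c))"
    by (simp add: lborel_distr_plus)
  also have "\<dots> = (\<integral>\<^sup>+x. f (c + x) \<partial>lborel)"
    by (subst nn_integral_distr) auto
  finally show ?thesis by simp
qed

lemma integral_lborel_translate:
  fixes f :: "'a::euclidean_space \<Rightarrow> 'b::{banach, second_countable_topology}"
  assumes [measurable]: "f \<in> borel_measurable borel"
  shows "(\<integral>x. f (c + x) \<partial>lborel) = (\<integral>x. f x \<partial>lborel)"
proof -
  have "(\<integral>x. f x \<partial>lborel) = (\<integral>x. f x \<partial>distr lborel borel ((+) c))"
    by (simp add: lborel_distr_plus)
  also have "\<dots> = (\<integral>x. f (c + x) \<partial>lborel)"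
    by (subst integral_distr) auto
  finally show ?thesis by simp
qed

lemma integrable_lborel_translate:
  fixes f :: "'a::euclidean_space \<Rightarrow> 'b::{banach, second_countable_topology}"
  assumes "integrable lborel f"
  shows "integrable lborel (\<lambda>x. f (c + x))"
proof -
  have "integrable (distr lborel borel ((+) c)) f"
    using assms by (simp add: lborel_distr_plus)
  then show ?thesis
    by (subst (asm) integrable_distr_eq) (use assms in auto)
qed

lemma abs_diff_powr_le:
  fixes u v p :: real
  assumes "0 \<le> p"
  shows "\<bar>u - v\<bar> powr p \<le> 2 powr p * (\<bar>u\<bar> powr p + \<bar>v\<bar> powr p)"
proof -
  have "\<bar>u - v\<bar> \<le> 2 * max \<bar>u\<bar> \<bar>v\<bar>" by linarith
  then have "\<bar>u - v\<bar> powr p \<le> (2 * max \<bar>u\<bar> \<bar>v\<bar>) powr p"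
    using assms by (intro powr_mono2) auto
  also have "\<dots> = 2 powr p * (max \<bar>u\<bar> \<bar>v\<bar>) powr p"
    by (simp add: powr_mult)
  also have "(max \<bar>u\<bar> \<bar>v\<bar>) powr p \<le> \<bar>u\<bar> powr p + \<bar>v\<bar> powr p"
    by (simp add: max_def)
  finally show ?thesis by simp
qed

lemma add_powr_le:
  fixes u v p :: real
  assumes "0 \<le> p" "0 \<le> u" "0 \<le> v"
  shows "(u + v) powr p \<le> 2 powr p * (u powr p + v powr p)"
  using abs_diff_powr_le[OF assms(1), of u "-v"] assms by simp

text \<open>Convexity of the power function: its graph lies above the tangent at \<open>m\<close>.\<close>

lemma powr_ge_tangent:
  fixes u m p :: real
  assumes "1 \<le> p" "0 \<le> u" "0 < m"
  shows "m powr p + p * m powr (p - 1) * (u - m) \<le> u powr p"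
proof (cases "u = 0")
  case True
  have "m powr (p - 1) * m = m powr p" using assms by (simp add: powr_mult_base mult.commute)
  then show ?thesis using True assms by (simp add: algebra_simps) 
next
  case False
  then have u: "u > 0" using assms by simp
  have conv: "convex_on {0<..} (\<lambda>x::real. x powr p)"
    by (rule powr_convex[OF assms(1)])
  have der: "((\<lambda>x. x powr p) has_real_derivative (p * m powr (p - 1))) (at m within {0<..})"
    using assms by (auto intro!: derivative_eq_intros DERIV_powr simp: )
  have "u powr p - m powr p \<ge> (p * m powr (p - 1)) * (u - m)"
    by (rule convex_on_imp_above_tangent[OF conv _ _ _ der])
       (use assms u in \<open>auto simp: interior_open\<close>)
  then show ?thesis by simp
qed

text \<open>Integrate the tangent line of the power function at the mean value of \<open>u\<close> over \<open>B\<close>. If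
  \<open>u\<close> is not integrable over \<open>B\<close> then the left-hand side is \<open>0\<close>, the default value of the integral;
  this lets the lemma apply to the gradient along every segment.\<close>

lemma Jensen_powr:
  fixes u :: "'a \<Rightarrow> real"
  assumes p: "1 \<le> p" and u: "\<And>x. 0 \<le> u x" and [measurable]: "u \<in> borel_measurable M" "B \<in> sets M"
    and fin: "emeasure M B < \<infinity>" and pos: "0 < measure M B"
  shows "ennreal ((\<integral>x. indicator B x * u x \<partial>M) powr p)
      \<le> ennreal (measure M B powr (p - 1)) * (\<integral>\<^sup>+x. indicator B x * ennreal (u x powr p) \<partial>M)"
proof (cases "integrable M (\<lambda>x. indicator B x * u x) \<and> (\<integral>x. indicator B x * u x \<partial>M) > 0")
  case False
  moreover have "(\<integral>x. indicator B x * u x \<partial>M) \<ge> 0" using u by (intro integral_nonneg_AE) auto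
  ultimately have "(\<integral>x. indicator B x * u x \<partial>M) = 0"
    using not_integrable_integral_eq by force
  then show ?thesis using p by simp
next
  case True
  define \<mu> where "\<mu> = measure M B"
  define I where "I = (\<integral>x. indicator B x * u x \<partial>M)"
  define m where "m = I / \<mu>"
  have m: "m > 0" "\<mu> > 0" using True pos by (auto simp: m_def I_def \<mu>_def)
  \<comment> \<open>the tangent at the mean value \<open>m\<close>: its linear part integrates to \<open>0\<close> over \<open>B\<close>\<close>
  define L where "L = (\<lambda>x. indicator B x * (m powr p + p * m powr (p - 1) * (u x - m)))"
  have iB: "integrable M (indicator B :: 'a \<Rightarrow> real)" using fin by simp
  have L_eq: "L = (\<lambda>x. (m powr p - p * m powr (p - 1) * m) * indicator B x + (p * m powr (p - 1)) * (indicator B x * u x))"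
    by (auto simp: L_def algebra_simps)
  have iL: "integrable M L" unfolding L_eq using True iB by auto
  have "(\<integral>x. L x \<partial>M) = (m powr p - p * m powr (p - 1) * m) * \<mu> + (p * m powr (p - 1)) * I"
    unfolding L_eq using True iB by (simp add: \<mu>_def I_def)
  also have "I = m * \<mu>" using m by (simp add: m_def)
  also have "(m powr p - p * m powr (p - 1) * m) * \<mu> + p * m powr (p - 1) * (m * \<mu>) = m powr p * \<mu>"
    by (simp add: algebra_simps)
  finally have *: "(\<integral>x. L x \<partial>M) = m powr p * \<mu>" .
  have "ennreal (m powr p * \<mu>) \<le> (\<integral>\<^sup>+x. indicator B x * ennreal (u x powr p) \<partial>M)"
  proof -
    have "ennreal (\<integral>x. L x \<partial>M) \<le> ennreal (enn2real (\<integral>\<^sup>+x. ennreal (L x) \<partial>M))"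
      using real_lebesgue_integral_def[OF iL] by (intro ennreal_leI) simp
    also have "\<dots> = (\<integral>\<^sup>+x. ennreal (L x) \<partial>M)"
      using integrableD(2)[OF iL] by (intro ennreal_enn2real) (simp add: less_top)
    also have "\<dots> \<le> (\<integral>\<^sup>+x. indicator B x * ennreal (u x powr p) \<partial>M)"
    proof (rule nn_integral_mono)
      fix x
      show "ennreal (L x) \<le> indicator B x * ennreal (u x powr p)"
        using powr_ge_tangent[OF p u m(1), of x] by (auto simp: L_def indicator_def ennreal_leI)
    qed
    finally show ?thesis using * by simp
  qed
  then have "ennreal (\<mu> powr (p - 1)) * ennreal (m powr p * \<mu>) \<le> ennreal (\<mu> powr (p - 1)) * (\<integral>\<^sup>+x. indicator B x * ennreal (u x powr p) \<partial>M)"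
    by (rule mult_left_mono) simp
  moreover have "ennreal (\<mu> powr (p - 1)) * ennreal (m powr p * \<mu>) = ennreal (I powr p)"
  proof -
    have "\<mu> powr (p - 1) * (m powr p * \<mu>) = m powr p * \<mu> powr p"
      using m by (simp add: powr_diff)
    also have "\<dots> = I powr p" using m by (simp add: m_def powr_divide)
    finally show ?thesis by (simp add: ennreal_mult'[symmetric])
  qed
  ultimately show ?thesis by (simp add: I_def \<mu>_def)
qed

lemma nn_integral_powr_tail:
  fixes c r :: real
  assumes c: "0 < c" and r: "0 < r"
  shows "(\<integral>\<^sup>+l. ennreal (l powr (- c - 1)) * indicator {r..} l \<partial>lborel) = ennreal (r powr (- c) / c)"
proof -
  have "(\<integral>\<^sup>+l. ennreal (l powr (- c - 1)) * indicator {r..} l \<partial>lborel)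
      = ennreal (0 - (- (r powr (- c)) / c))"
  proof (rule nn_integral_FTC_atLeast)
    show "(\<lambda>l. l powr (- c - 1)) \<in> borel_measurable borel" by simp
    fix x assume "r \<le> x"
    then show "((\<lambda>l. - (l powr (- c)) / c) has_real_derivative x powr (- c - 1)) (at x)"
      using r c by (auto intro!: derivative_eq_intros DERIV_powr simp: field_simps)
    show "0 \<le> x powr (- c - 1)" by simp
  next
    have "((\<lambda>l. l powr (- c)) \<longlongrightarrow> 0) at_top"
      using c by (intro tendsto_neg_powr filterlim_ident) auto
    from tendsto_divide[OF tendsto_minus[OF this] tendsto_const[of c]] c
    show "((\<lambda>l. - (l powr (- c)) / c) \<longlongrightarrow> 0) at_top" by simp
  qed
  then show ?thesis by simp
qed

lemma nn_integral_powr_from_0: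
  fixes c r :: real
  assumes c: "0 < c" and r: "0 \<le> r"
  shows "(\<integral>\<^sup>+l. ennreal (l powr (c - 1)) * indicator {0..r} l \<partial>lborel) = ennreal (r powr c / c)"
proof -
  have "((\<lambda>x. x powr (c - 1)) has_integral (r powr (c - 1 + 1) / (c - 1 + 1))) {0..r}"
    using c r by (intro has_integral_powr_from_0) auto
  then have "((\<lambda>x. x powr (c - 1)) has_integral (r powr c / c)) {0..r}" by simp
  from nn_integral_has_integral_lebesgue[OF _ this]
  have "(\<integral>\<^sup>+x. ennreal (indicat_real {0..r} x * x powr (c - 1)) \<partial>lborel) = ennreal (r powr c / c)"
    by (simp add: nn_integral_completion)
  moreover have "(\<lambda>x. ennreal (indicat_real {0..r} x * x powr (c - 1)))
     = (\<lambda>l. ennreal (l powr (c - 1)) * indicator {0..r} l)"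
    by (auto simp: indicator_def)
  ultimately show ?thesis by simp
qed

lemma emeasure_ball_Rn:
  fixes x :: "real ^ 'n"
  assumes "0 \<le> r"
  shows "emeasure lborel (ball x r) = ennreal (unit_ball_vol (real CARD('n)) * r powr CARD('n))"
  using emeasure_ball[OF assms, of x] assms 
  by (cases "r = 0") (simp_all add: powr_realpow)

text \<open>Polar coordinates are replaced by a layer-cake argument:
  \<open>|z|^(-n-c) = (n+c) \<integral>\<^bsub>l \<ge> |z|\<^esub> l^(-n-c-1) dl\<close>, and integrating in \<open>z\<close> first yields the volume
  of a ball of radius \<open>l\<close>.\<close>

lemma nn_integral_norm_powr_tail:
  fixes x :: "real ^ 'n" and c r :: real
  assumes c: "0 < c" and r: "0 < r"
  shows "(\<integral>\<^sup>+y. ennreal (norm (x - y) powr (- (real CARD('n) + c))) * indicator {y. r \<le> norm (x - y)} y \<partial>lborel)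
    \<le> ennreal ((real CARD('n) + c) * unit_ball_vol (real CARD('n)) / c * r powr (- c))"
proof -
  define n where "n = real CARD('n)"
  define V where "V = unit_ball_vol n"
  have n: "n > 0" by (simp add: n_def)
  have V: "V \<ge> 0" using n by (simp add: V_def)
  have "(\<integral>\<^sup>+y. ennreal (norm (x - y) powr (- (n + c))) * indicator {y. r \<le> norm (x - y)} y \<partial>lborel)
     = (\<integral>\<^sup>+y. (\<integral>\<^sup>+l. ennreal (n + c) * (ennreal (l powr (- (n + c) - 1)) * indicator {norm (x - y)..} l) * indicator {y. r \<le> norm (x - y)} y \<partial>lborel) \<partial>lborel)"
  proof (intro nn_integral_cong)
    fix y :: "real ^ 'n"
    show "ennreal (norm (x - y) powr (- (n + c))) * indicator {y. r \<le> norm (x - y)} y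
      = (\<integral>\<^sup>+l. ennreal (n + c) * (ennreal (l powr (- (n + c) - 1)) * indicator {norm (x - y)..} l) * indicator {y. r \<le> norm (x - y)} y \<partial>lborel)"
    proof (cases "r \<le> norm (x - y)")
      case True
      then have "norm (x - y) > 0" using r by linarith
      have "(\<integral>\<^sup>+l. ennreal (n + c) * (ennreal (l powr (- (n + c) - 1)) * indicator {norm (x - y)..} l) \<partial>lborel)
        = ennreal (n + c) * ennreal (norm (x - y) powr (- (n + c)) / (n + c))"
        using nn_integral_powr_tail[of "n + c" "norm (x - y)"] \<open>norm (x - y) > 0\<close> n c
        by (subst nn_integral_cmult) auto
      also have "\<dots> = ennreal (norm (x - y) powr (- (n + c)))"
        using n c by (simp add: ennreal_mult'[symmetric] del: ennreal_plus)
      finally show ?thesis using True by simp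
    qed simp
  qed
  also have "\<dots> = (\<integral>\<^sup>+l. (\<integral>\<^sup>+y. ennreal (n + c) * (ennreal (l powr (- (n + c) - 1)) * indicator {norm (x - y)..} l) * indicator {y. r \<le> norm (x - y)} y \<partial>lborel) \<partial>lborel)"
    by (rule lborel_pair.Fubini') (simp add: indicator_def of_bool_def case_prod_unfold)
  also have "\<dots> \<le> (\<integral>\<^sup>+l. ennreal ((n + c) * V) * (ennreal (l powr (- c - 1)) * indicator {r..} l) \<partial>lborel)"
  proof (intro nn_integral_mono)
    fix l :: real
    show "(\<integral>\<^sup>+y. ennreal (n + c) * (ennreal (l powr (- (n + c) - 1)) * indicator {norm (x - y)..} l) * indicator {y. r \<le> norm (x - y)} y \<partial>lborel)
      \<le> ennreal ((n + c) * V) * (ennreal (l powr (- c - 1)) * indicator {r..} l)" (is "?L \<le> ?R")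
    proof (cases "r \<le> l")
      case True
      have "?L \<le> (\<integral>\<^sup>+y. ennreal (n + c) * ennreal (l powr (- (n + c) - 1)) * indicator (cball x l) y \<partial>lborel)"
        by (intro nn_integral_mono) (auto simp: indicator_def dist_norm)
      also have "\<dots> = ennreal (n + c) * ennreal (l powr (- (n + c) - 1)) * emeasure lborel (cball x l)"
        by (subst nn_integral_cmult_indicator) auto
      also have "emeasure lborel (cball x l) = ennreal (V * l powr n)"
        using emeasure_cball[of l x] True r by (simp add: V_def n_def powr_realpow)
      also have "ennreal (n + c) * ennreal (l powr (- (n + c) - 1)) * ennreal (V * l powr n)
        = ennreal ((n + c) * V) * ennreal (l powr (- (n + c) - 1) * l powr n)"
        using n c V by (simp add: ennreal_mult'[symmetric] mult_ac del: ennreal_plus)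
      also have "l powr (- (n + c) - 1) * l powr n = l powr (- c - 1)"
        by (simp add: powr_add[symmetric])
      finally show ?thesis using True by simp
    next
      case False
      then have "?L = (\<integral>\<^sup>+y. 0 \<partial>(lborel :: (real ^ 'n) measure))"
        by (intro nn_integral_cong) (auto simp: indicator_def)
      then show ?thesis by simp
    qed
  qed
  also have "\<dots> = ennreal ((n + c) * V) * ennreal (r powr (- c) / c)"
    by (subst nn_integral_cmult) (use nn_integral_powr_tail[OF c r] in auto)
  also have "\<dots> = ennreal ((n + c) * V / c * r powr (- c))"
    using n c V by (simp add: ennreal_mult'[symmetric] mult_ac del: ennreal_plus)
  finally show ?thesis by (simp add: n_def V_def)
qed

section \<open>The distance to the boundary\<close>

locale bounded_open =
  fixes \<Omega> :: "(real ^ 'n) set"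
  assumes open_\<Omega>: "open \<Omega>" and nonempty_\<Omega>: "\<Omega> \<noteq> {}" and bounded_\<Omega>: "bounded \<Omega>"
begin

abbreviation d where "d \<equiv> bdist \<Omega>"

text \<open>The distance to the empty set is \<open>0\<close> by convention, so that this is what makes \<open>d\<close> positive
  inside \<open>\<Omega>\<close>.\<close>

lemma frontier_nonempty: "frontier \<Omega> \<noteq> {}"
  using nonempty_\<Omega> bounded_\<Omega> frontier_eq_empty[of \<Omega>] not_bounded_UNIV by blast

lemma continuous_on_d: "continuous_on A d"
  unfolding bdist_def[abs_def] by (intro continuous_intros)

lemma d_measurable [measurable]: "d \<in> borel_measurable borel"
  by (intro borel_measurable_continuous_onI continuous_on_d)

lemma \<Omega>_measurable [measurable]: "\<Omega> \<in> sets borel"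
  using open_\<Omega> by simp

lemma d_nonneg: "0 \<le> d x"
  by (simp add: bdist_def infdist_nonneg)

lemma d_pos: "x \<in> \<Omega> \<Longrightarrow> 0 < d x"
  unfolding bdist_def using infdist_pos_not_in_closed[OF frontier_closed frontier_nonempty, of x]
    frontier_disjoint_eq[of \<Omega>] open_\<Omega> by auto

lemma d_lipschitz: "\<bar>d x - d y\<bar> \<le> norm (x - y)"
  using infdist_triangle_abs[of x "frontier \<Omega>" y] by (simp add: bdist_def dist_norm)

text \<open>A ball is connected, so one that meets \<open>\<Omega>\<close> and its complement contains a frontier point, which
  is then closer to \<open>x\<close> than \<open>d x\<close>.\<close>

lemma ball_subset: 
  assumes "x \<in> \<Omega>" shows "ball x (d x) \<subseteq> \<Omega>"
proof (rule ccontr)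
  assume "\<not> ?thesis"
  then have "ball x (d x) - \<Omega> \<noteq> {}" by blast
  moreover have "ball x (d x) \<inter> \<Omega> \<noteq> {}" using assms d_pos by force
  ultimately obtain z where z: "z \<in> ball x (d x)" "z \<in> frontier \<Omega>"
    using connected_Int_frontier[of "ball x (d x)" \<Omega>] by auto
  then have "d x \<le> dist x z" unfolding bdist_def by (intro infdist_le)
  then show False using z by simp
qed

lemma mem_\<Omega>: "x \<in> \<Omega> \<Longrightarrow> norm (x - y) < d x \<Longrightarrow> y \<in> \<Omega>"
  using ball_subset[of x] by (auto simp: dist_norm)

end

section \<open>Flat functions, smooth bumps and the fundamental lemma\<close>

lemma frechet_derivative_eqI:
  "(f has_derivative D) (at x) \<Longrightarrow> frechet_derivative f (at x) = D"
  by (metis frechet_derivative_at)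

text \<open>The powers of \<open>1/t\<close> are included because the family is then closed under differentiation, so
  that one induction shows that all its members are smooth.\<close>

definition expflat :: "nat \<Rightarrow> real \<Rightarrow> real" where
  "expflat m t = (if t > 0 then inverse t ^ m * exp (- inverse t) else 0)"

text \<open>The exponential beats every power; with \<open>u = 1/t\<close> this is the decay of \<open>u^m exp(-u)\<close>.\<close>

lemma expflat_tendsto_0: "(expflat m \<longlongrightarrow> 0) (at 0)"
proof (rule filterlim_split_at_real[of _ _ 0])
  have "((\<lambda>t. (inverse t) ^ m / exp (inverse t :: real)) \<longlongrightarrow> 0) (at_right 0)"
    by (rule filterlim_compose[OF tendsto_power_div_exp_0 filterlim_inverse_at_top_right])
  moreover have "\<forall>\<^sub>F t in at_right 0. (inverse t) ^ m / exp (inverse t :: real) = expflat m t"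
    by (simp add: eventually_at_right_less[of 0, THEN eventually_mono] expflat_def exp_minus divide_inverse)
  ultimately show "(expflat m \<longlongrightarrow> 0) (at_right 0)"
    by (simp add: tendsto_cong)
  have "\<forall>\<^sub>F t in at_left 0. expflat m t = 0"
    using eventually_at_left_field[of "\<lambda>t. expflat m t = 0" 0] by (auto simp: expflat_def intro!: exI[of _ "-1"])
  then show "(expflat m \<longlongrightarrow> 0) (at_left 0)"
    by (rule tendsto_eventually)
qed

lemma expflat_deriv:
  "(expflat m has_real_derivative (- real m * expflat (Suc m) t + expflat (m + 2) t)) (at t)"
proof -
  consider "t > 0" | "t < 0" | "t = 0" by linarith
  then show ?thesis
  proof cases
    case 1
    have pow: "real m * inverse t ^ (m - Suc 0) * inverse t = real m * inverse t ^ m" for t :: real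
      by (cases m) auto
    have "((\<lambda>t. inverse t ^ m * exp (- inverse t)) has_real_derivative
      (- real m * expflat (Suc m) t + expflat (m + 2) t)) (at t)"
      using 1 pow[of t]
      by (auto intro!: derivative_eq_intros simp: expflat_def field_simps power2_eq_square)
    then show ?thesis
      by (rule has_field_derivative_transform_within_open[where S="{0<..}"]) (use 1 in \<open>auto simp: expflat_def\<close>)
  next
    case 2
    have "((\<lambda>t. 0) has_real_derivative (- real m * expflat (Suc m) t + expflat (m + 2) t)) (at t)"
      using 2 by (simp add: expflat_def)
    then show ?thesis
      by (rule has_field_derivative_transform_within_open[where S="{..<0}"]) (use 2 in \<open>auto simp: expflat_def\<close>)
  next
    case 3
    have "((\<lambda>h. (expflat m (0 + h) - expflat m 0) / h) \<longlongrightarrow> 0) (at 0)"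
    proof (rule Lim_transform_eventually[OF expflat_tendsto_0[of "Suc m"]])
      show "\<forall>\<^sub>F h in at 0. expflat (Suc m) h = (expflat m (0 + h) - expflat m 0) / h"
        by (auto simp: expflat_def eventually_at_filter field_simps)
    qed
    then show ?thesis using 3 by (simp add: DERIV_def expflat_def)
  qed
qed

text \<open>The algebra generated by flat functions of affine functions of one coordinate. It is closed under
  directional derivatives, which turns infinite differentiability into a property of the whole
  algebra that can be proved by induction on the order.\<close>

inductive bump_algebra :: "(real ^ 'n \<Rightarrow> real) \<Rightarrow> bool" where
  const: "bump_algebra (\<lambda>x. c)"
| flat: "bump_algebra (\<lambda>x. expflat m (c * x $ i + e))"
| add: "bump_algebra f \<Longrightarrow> bump_algebra g \<Longrightarrow> bump_algebra (\<lambda>x. f x + g x)"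
| mult: "bump_algebra f \<Longrightarrow> bump_algebra g \<Longrightarrow> bump_algebra (\<lambda>x. f x * g x)"

lemma bump_algebra_derivative:
  assumes "bump_algebra f"
  shows "\<exists>D. (\<forall>x. (f has_derivative D x) (at x)) \<and> (\<forall>v. bump_algebra (\<lambda>x. D x v))"
  using assms
proof (induction rule: bump_algebra.induct)
  case (const c)
  have "bump_algebra (\<lambda>x::real^'n. 0)" by (rule bump_algebra.const)
  then show ?case by (intro exI[of _ "\<lambda>x v. 0"]) auto
next
  case (flat m c i e)
  let ?D = "\<lambda>(x::real^'a) v::real^'a. (- real m * expflat (Suc m) (c * x $ i + e) + expflat (m + 2) (c * x $ i + e)) * (c * v $ i)"
  have "((\<lambda>x::real^'a. expflat m (c * x $ i + e)) has_derivative ?D x) (at x)" for x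
    by (rule has_derivative_compose[where g="expflat m", OF _ expflat_deriv[unfolded has_field_derivative_def]])
       (auto intro!: derivative_eq_intros bounded_linear_imp_has_derivative bounded_linear_vec_nth)
  moreover have "bump_algebra (\<lambda>x. ?D x v)" for v
    by (intro bump_algebra.intros)
  ultimately show ?case by (intro exI[of _ ?D]) blast
next
  case (add f g)
  then obtain D E where "\<And>x. (f has_derivative D x) (at x)" "\<And>v. bump_algebra (\<lambda>x. D x v)"
    "\<And>x. (g has_derivative E x) (at x)" "\<And>v. bump_algebra (\<lambda>x. E x v)" by metis
  then show ?case
    by (intro exI[of _ "\<lambda>x v. D x v + E x v"]) (auto intro!: derivative_eq_intros bump_algebra.add)
next
  case (mult f g)
  then obtain D E where "\<And>x. (f has_derivative D x) (at x)" "\<And>v. bump_algebra (\<lambda>x. D x v)"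
    "\<And>x. (g has_derivative E x) (at x)" "\<And>v. bump_algebra (\<lambda>x. E x v)" by metis
  then show ?case using mult.hyps
    by (intro exI[of _ "\<lambda>x v. f x * E x v + D x v * g x"] conjI allI has_derivative_mult
        bump_algebra.add bump_algebra.mult) auto
qed

lemma bump_algebra_Ck: "bump_algebra f \<Longrightarrow> Ck k f"
proof (induction k arbitrary: f)
  case 0
  then obtain D where "\<And>x. (f has_derivative D x) (at x)" using bump_algebra_derivative by metis
  then show ?case by (auto intro!: continuous_at_imp_continuous_on has_derivative_continuous)
next
  case (Suc k)
  then obtain D where D: "\<And>x. (f has_derivative D x) (at x)" "\<And>v. bump_algebra (\<lambda>x. D x v)" 
    using bump_algebra_derivative by metis
  then have "frechet_derivative f (at x) = D x" for x by (intro frechet_derivative_eqI)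
  then show ?case using D Suc.IH by (auto simp: differentiable_def)
qed

text \<open>Positive exactly inside the box; as \<open>k\<close> grows, every factor tends to \<open>1\<close> on the positive side
  of its face.\<close>

definition box_bump :: "real ^ 'n \<Rightarrow> real ^ 'n \<Rightarrow> real \<Rightarrow> real ^ 'n \<Rightarrow> real" where
  "box_bump a b k x = (\<Prod>i\<in>UNIV. expflat 0 (k * (x $ i - a $ i)) * expflat 0 (k * (b $ i - x $ i)))"

lemma bump_algebra_box_bump: "bump_algebra (box_bump a b k)"
proof -
  have "bump_algebra (\<lambda>x. expflat 0 (k * (x $ i - a $ i)) * expflat 0 (k * (b $ i - x $ i)))" for i
  proof -
    have "bump_algebra (\<lambda>x. expflat 0 (k * x $ i + (- (k * a $ i))) * expflat 0 ((- k) * x $ i + k * b $ i))"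
      by (intro bump_algebra.intros)
    then show ?thesis by (simp add: algebra_simps)
  qed
  then have "bump_algebra (\<lambda>x. \<Prod>i\<in>S. expflat 0 (k * (x $ i - a $ i)) * expflat 0 (k * (b $ i - x $ i)))" for S :: "'a set"
    by (induction S rule: infinite_finite_induct) (auto intro: bump_algebra.intros)
  then show ?thesis unfolding box_bump_def .
qed

lemma expflat_0_bounds: "0 \<le> expflat 0 t" "expflat 0 t \<le> 1"
  by (auto simp: expflat_def)

lemma box_bump_bounds: "0 \<le> box_bump a b k x" "box_bump a b k x \<le> 1"
  unfolding box_bump_def
  by (auto intro!: prod_nonneg prod_le_1 mult_le_one simp: expflat_0_bounds)

lemma box_bump_support:
  assumes "k > 0" shows "{x. box_bump a b k x \<noteq> 0} \<subseteq> box a b"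
proof
  fix x assume x: "x \<in> {x. box_bump a b k x \<noteq> 0}"
  have "0 < k * (x $ i - a $ i) \<and> 0 < k * (b $ i - x $ i)" for i
    using x unfolding box_bump_def by (auto simp: expflat_def split: if_splits)
  then show "x \<in> box a b" using assms by (simp add: mem_box_cart zero_less_mult_iff)
qed

lemma test_fun_box_bump:
  assumes "k > 0" "cbox a b \<subseteq> U" shows "test_fun U (box_bump a b k)"
proof -
  have "closure {x. box_bump a b k x \<noteq> 0} \<subseteq> cbox a b"
    using box_bump_support[OF assms(1), of a b] box_subset_cbox[of a b] by (intro closure_minimal) auto
  moreover from this have "compact (closure {x. box_bump a b k x \<noteq> 0})"
    by (metis bounded_cbox bounded_subset closed_closure compact_eq_bounded_closed)
  ultimately show ?thesis using assms bump_algebra_Ck[OF bump_algebra_box_bump]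
    by (auto simp: test_fun_def)
qed

text \<open>For \<open>t > 0\<close> the value is \<open>exp(-1/(k t))\<close>, which tends to \<open>1\<close>.\<close>

lemma expflat_0_limit: "(\<lambda>k. expflat 0 (real (Suc k) * t)) \<longlonglongrightarrow> of_bool (t > 0)"
proof (cases "t > 0")
  case True
  have "(\<lambda>k. inverse (real (Suc k)) * inverse t) \<longlonglongrightarrow> 0 * inverse t"
    by (rule tendsto_mult[OF LIMSEQ_inverse_real_of_nat tendsto_const])
  then have "(\<lambda>k. exp (- (inverse (real (Suc k)) * inverse t))) \<longlonglongrightarrow> exp (- (0 * inverse t))"
    by (intro tendsto_exp tendsto_minus)
  moreover have "expflat 0 (real (Suc k) * t) = exp (- (inverse (real (Suc k)) * inverse t))" for k
    using True by (simp add: expflat_def del: of_nat_Suc)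
  ultimately show ?thesis using True by simp
next
  case False
  then have "expflat 0 (real (Suc k) * t) = 0" for k
    by (simp add: expflat_def zero_less_mult_iff)
  then show ?thesis using False by simp
qed

lemma box_bump_limit: "(\<lambda>k. box_bump a b (real (Suc k)) x) \<longlonglongrightarrow> indicator (box a b) x"
proof -
  have "(\<lambda>k. box_bump a b (real (Suc k)) x) \<longlonglongrightarrow> (\<Prod>i\<in>UNIV. of_bool (x $ i - a $ i > 0) * of_bool (b $ i - x $ i > 0))"
    unfolding box_bump_def by (intro tendsto_prod tendsto_mult expflat_0_limit)
  also have "(\<Prod>i\<in>UNIV. of_bool (x $ i - a $ i > 0) * of_bool (b $ i - x $ i > 0)) = (indicator (box a b) x :: real)"
  proof (cases "x \<in> box a b")
    case False
    then obtain i where "\<not> (a $ i < x $ i \<and> x $ i < b $ i)" by (auto simp: mem_box_cart)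
    then show ?thesis using False by (auto intro!: prod_zero bexI[of _ i])
  qed (simp add: mem_box_cart)
  finally show ?thesis .
qed

text \<open>The positive and the negative part of \<open>v\<close> define two measures that agree on boxes, an
  intersection-stable generator of the Borel sets; hence they are equal, and so are their densities.\<close>

lemma AE_zero_if_box_integrals_zero:
  fixes v :: "'a::euclidean_space \<Rightarrow> real"
  assumes int: "integrable lborel v"
    and zero: "\<And>a b. (\<integral>x. indicator (box a b) x * v x \<partial>lborel) = 0"
  shows "AE x in lborel. v x = 0"
proof -
  have [measurable]: "v \<in> borel_measurable borel" using int by auto
  have iB: "integrable lborel (\<lambda>x. indicator (box a b) x * v x)" for a b :: 'a
    using integrable_mult_indicator[OF _ int, of "box a b"] by simp
  have eq: "emeasure (density lborel (\<lambda>x. ennreal (v x))) (box a b) = emeasure (density lborel (\<lambda>x. ennreal (- v x))) (box a b)" for a b :: 'a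
  proof -
    have "enn2real (\<integral>\<^sup>+x. ennreal (indicator (box a b) x * v x) \<partial>lborel)
        = enn2real (\<integral>\<^sup>+x. ennreal (- (indicator (box a b) x * v x)) \<partial>lborel)"
      using real_lebesgue_integral_def[OF iB[of a b]] zero[of a b] by simp
    then have "(\<integral>\<^sup>+x. ennreal (indicator (box a b) x * v x) \<partial>lborel)
        = (\<integral>\<^sup>+x. ennreal (- (indicator (box a b) x * v x)) \<partial>lborel)"
      using integrableD(2,3)[OF iB[of a b]]
      by (auto dest!: arg_cong[where f=ennreal] simp: ennreal_enn2real_if)
    moreover have "(\<lambda>x. ennreal (indicator (box a b) x * v x)) = (\<lambda>x. ennreal (v x) * indicator (box a b) x)"
      "(\<lambda>x. ennreal (- (indicator (box a b) x * v x))) = (\<lambda>x. ennreal (- v x) * indicator (box a b) x)"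
      by (auto simp: indicator_def fun_eq_iff)
    ultimately show ?thesis by (simp add: emeasure_density)
  qed
  have "density lborel (\<lambda>x. ennreal (v x)) = density lborel (\<lambda>x. ennreal (- v x))"
  proof (rule measure_eqI_generator_eq)
    let ?E = "range (\<lambda>(a, b). box a b::'a set)"
    show "Int_stable ?E"
      by (auto simp: Int_stable_def box_Int_box)
    show "?E \<subseteq> Pow UNIV" "sets (density lborel (\<lambda>x. ennreal (v x))) = sigma_sets UNIV ?E" 
      "sets (density lborel (\<lambda>x. ennreal (- v x))) = sigma_sets UNIV ?E"
      by (simp_all add: borel_eq_box)
    let ?A = "\<lambda>n::nat. box (- (real n *\<^sub>R One)) (real n *\<^sub>R One) :: 'a set"
    show "range ?A \<subseteq> ?E" "(\<Union>i. ?A i) = UNIV"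
      unfolding UN_box_eq_UNIV by auto
    show "emeasure (density lborel (\<lambda>x. ennreal (v x))) (?A i) \<noteq> \<infinity>" for i
    proof -
      have "emeasure (density lborel (\<lambda>x. ennreal (v x))) (?A i) \<le> (\<integral>\<^sup>+x. ennreal (v x) \<partial>lborel)"
        by (subst emeasure_density) (auto intro!: nn_integral_mono simp: indicator_def)
      then show ?thesis using integrableD(2)[OF int] by (auto simp: top_unique)
    qed
    show "emeasure (density lborel (\<lambda>x. ennreal (v x))) X = emeasure (density lborel (\<lambda>x. ennreal (- v x))) X" if "X \<in> ?E" for X
      using that eq by auto
  qed
  then have "AE x in lborel. ennreal (v x) = ennreal (- v x)"
    by (intro sigma_finite_measure.density_unique[OF lborel.sigma_finite_measure_axioms]) auto
  then show ?thesis
    by eventually_elim (metis add.inverse_neutral ennreal_eq_0_iff ennreal_neq_top le_cases neg_le_0_iff_le order_antisym)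
qed

text \<open>Test functions approximate indicators of boxes, so the integral of \<open>u\<close> over every box with closure
  in \<open>U\<close> vanishes by dominated convergence.\<close>

lemma fundamental_lemma:
  fixes u :: "real ^ 'n \<Rightarrow> real"
  assumes U: "open U" and int: "\<And>K. compact K \<Longrightarrow> K \<subseteq> U \<Longrightarrow> integrable lborel (\<lambda>x. indicator K x * u x)"
    and zero: "\<And>\<phi>. test_fun U \<phi> \<Longrightarrow> (\<integral>x. u x * \<phi> x \<partial>lborel) = 0"
  shows "AE x in lborel. x \<in> U \<longrightarrow> u x = 0"
proof -
  have box0: "(\<integral>x. indicator (box a b) x * u x \<partial>lborel) = 0" if ab: "cbox a b \<subseteq> U" for a b
  proof (rule LIMSEQ_unique)
    have test: "test_fun U (box_bump a b (real (Suc k)))" for k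
      by (rule test_fun_box_bump[OF _ ab]) simp
    let ?u = "\<lambda>x. indicator (cbox a b) x * u x"
    have iu: "integrable lborel ?u" using ab by (intro int) auto
    have eq: "u x * box_bump a b (real (Suc k)) x = ?u x * box_bump a b (real (Suc k)) x" for x k
      using box_bump_support[of "real (Suc k)" a b] box_subset_cbox[of a b] by (cases "x \<in> cbox a b") auto
    have eq': "indicator (box a b) x * u x = ?u x * indicator (box a b) x" for x
      using box_subset_cbox[of a b] by (auto simp: indicator_def)
    have [measurable]: "?u \<in> borel_measurable borel" using iu by auto
    have [measurable]: "box_bump a b k \<in> borel_measurable borel" for k
      using bump_algebra_Ck[OF bump_algebra_box_bump, of 0 a b k] by (simp add: borel_measurable_continuous_onI)
    show "(\<lambda>k. \<integral>x. u x * box_bump a b (real (Suc k)) x \<partial>lborel) \<longlonglongrightarrow> (\<integral>x. indicator (box a b) x * u x \<partial>lborel)"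
      unfolding eq eq'
    proof (rule integral_dominated_convergence[where w="\<lambda>x. \<bar>?u x\<bar>"])
      show "integrable lborel (\<lambda>x. \<bar>?u x\<bar>)" using iu by simp
      show "AE x in lborel. (\<lambda>k. ?u x * box_bump a b (real (Suc k)) x) \<longlonglongrightarrow> ?u x * indicator (box a b) x"
        by (intro AE_I2 tendsto_mult tendsto_const box_bump_limit)
      show "AE x in lborel. norm (?u x * box_bump a b (real (Suc k)) x) \<le> \<bar>?u x\<bar>" for k
        using box_bump_bounds[of a b "real (Suc k)"]
        by (intro AE_I2) (auto simp: abs_mult intro!: mult_left_le)
      show "(\<lambda>x. ?u x * box_bump a b (real (Suc k)) x) \<in> borel_measurable lborel" for k
        by simp
      show "(\<lambda>x. ?u x * indicator (box a b) x) \<in> borel_measurable lborel" by simp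
    qed
    show "(\<lambda>k. \<integral>x. u x * box_bump a b (real (Suc k)) x \<partial>lborel) \<longlonglongrightarrow> 0"
      using zero[OF test] by simp
  qed
  \<comment> \<open>\<open>u\<close> is only locally integrable, so it is cut off to closed boxes; their boundaries are null sets\<close>
  have cbox: "AE x in lborel. x \<in> cbox A B \<longrightarrow> u x = 0" if AB: "cbox A B \<subseteq> U" for A B
  proof -
    define v where "v = (\<lambda>x. indicator (cbox A B) x * u x)"
    have iv: "integrable lborel v" unfolding v_def using AB by (intro int) auto
    have "cbox A B - box A B \<in> null_sets lborel"
      using negligible_frontier_interval[of A B] by (simp add: negligible_iff_null_sets null_sets_completion_iff)
    then have nb: "AE x in lborel. x \<notin> cbox A B - box A B" by (rule AE_not_in)
    have "AE x in lborel. v x = 0"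
    proof (rule AE_zero_if_box_integrals_zero[OF iv])
      fix a b :: "real ^ 'n"
      obtain a' b' where ab': "box a b \<inter> box A B = box a' b'" using that[OF box_Int_box[of a b A B]] .
      have mem: "x \<in> box a' b' \<longleftrightarrow> x \<in> box a b \<and> x \<in> box A B" for x using ab' by blast
      have sub: "x \<in> box A B \<Longrightarrow> x \<in> cbox A B" for x using box_subset_cbox[of A B] by blast
      have "(\<integral>x. indicator (box a b) x * v x \<partial>lborel) = (\<integral>x. indicator (box a' b') x * u x \<partial>lborel)"
      proof (rule integral_cong_AE)
        have [measurable]: "v \<in> borel_measurable borel" using iv by auto
        show "(\<lambda>x. indicator (box a b) x * v x) \<in> borel_measurable lborel" by simp
        have "(\<lambda>x. indicator (box a' b') x * u x) = (\<lambda>x. indicator (box a' b') x * v x)"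
          using sub by (intro ext) (simp add: v_def indicator_def mem)
        then show "(\<lambda>x. indicator (box a' b') x * u x) \<in> borel_measurable lborel" by (simp only:) simp
        show "AE x in lborel. indicator (box a b) x * v x = indicator (box a' b') x * u x"
          using nb by eventually_elim (use sub in \<open>auto simp: v_def indicator_def mem\<close>)
      qed
      also have "\<dots> = 0"
      proof (cases "box a' b' = {}")
        case False
        then have "cbox a' b' = closure (box a' b')" by (simp add: closure_box)
        also have "\<dots> \<subseteq> cbox A B" using ab' box_subset_cbox[of A B] by (intro closure_minimal) auto
        finally show ?thesis using AB by (intro box0) auto
      qed simp
      finally show "(\<integral>x. indicator (box a b) x * v x \<partial>lborel) = 0" .
    qed
    then show ?thesis by eventually_elim (auto simp: v_def indicator_def)
  qed
  obtain D where D: "countable D" "D \<subseteq> Pow U" "\<And>X. X \<in> D \<Longrightarrow> \<exists>a b. X = cbox a b" "\<Union>D = U"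
    using open_countable_Union_open_cbox[OF U] by metis
  have "AE x in lborel. \<forall>X\<in>D. x \<in> X \<longrightarrow> u x = 0"
    using D(2,3) cbox by (subst AE_ball_countable[OF D(1)]) blast
  then show ?thesis using D(4) by (auto elim!: eventually_mono)
qed

section \<open>Weak gradients of Borel functions\<close>

lemma test_fun_has_derivative:
  assumes "test_fun U \<phi>"
  shows "(\<phi> has_derivative frechet_derivative \<phi> (at x)) (at x)"
proof -
  have "Ck (Suc 0) \<phi>" using assms unfolding test_fun_def by blast
  then show ?thesis by (simp add: frechet_derivative_works)
qed

lemma test_fun_derivative_scaleR:
  "test_fun U \<phi> \<Longrightarrow> frechet_derivative \<phi> (at x) (s *\<^sub>R v) = s * frechet_derivative \<phi> (at x) v"
  using linear_cmul[OF has_derivative_linear[OF test_fun_has_derivative]] by simp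

lemma test_fun_continuous:
  assumes "test_fun U \<phi>"
  shows "continuous_on A \<phi>" "continuous_on A (\<lambda>x. frechet_derivative \<phi> (at x) v)"
proof -
  have "Ck (Suc 0) \<phi>" "Ck 0 \<phi>" using assms unfolding test_fun_def by blast+
  then show "continuous_on A \<phi>" "continuous_on A (\<lambda>x. frechet_derivative \<phi> (at x) v)"
    by (auto intro: continuous_on_subset)
qed

lemma test_fun_support:
  assumes "test_fun U \<phi>"
  obtains K where "compact K" "K \<subseteq> U" "\<And>x. x \<notin> K \<Longrightarrow> \<phi> x = 0"
    "\<And>x v. x \<notin> K \<Longrightarrow> frechet_derivative \<phi> (at x) v = 0"
proof -
  define K where "K = closure {x. \<phi> x \<noteq> 0}"
  have K: "compact K" "K \<subseteq> U" using assms by (auto simp: test_fun_def K_def)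
  have z: "\<phi> x = 0" if "x \<notin> K" for x
    using that closure_subset[of "{x. \<phi> x \<noteq> 0}"] unfolding K_def by blast
  have "frechet_derivative \<phi> (at x) v = 0" if "x \<notin> K" for x v
  proof -
    have "((\<lambda>x. 0) has_derivative (\<lambda>v. 0)) (at x)" by simp
    then have "(\<phi> has_derivative (\<lambda>v. 0)) (at x)"
    proof (rule has_derivative_transform_within_open)
      show "open (- K)" using K by (simp add: compact_imp_closed open_Compl)
      show "x \<in> - K" using that by simp
      show "0 = \<phi> y" if "y \<in> - K" for y using z that by simp
    qed
    then show ?thesis by (simp add: frechet_derivative_eqI)
  qed
  then show ?thesis using that K z by blast
qed

text \<open>Test functions and their derivatives occur as bounded multipliers.\<close>

lemma continuous_compact_support_bounded:
  fixes \<phi> :: "'a::metric_space \<Rightarrow> real"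
  assumes "continuous_on UNIV \<phi>" "compact K" "\<And>x. x \<notin> K \<Longrightarrow> \<phi> x = 0"
  obtains B where "B \<ge> 0" "\<And>x. \<bar>\<phi> x\<bar> \<le> B"
proof -
  have "bounded (\<phi> ` K)"
    using assms by (intro compact_imp_bounded compact_continuous_image) (auto intro: continuous_on_subset)
  then obtain B where "\<And>x. x \<in> K \<Longrightarrow> \<bar>\<phi> x\<bar> \<le> B" by (auto simp: bounded_iff)
  then have "\<bar>\<phi> x\<bar> \<le> max B 0" for x using assms(3)[of x] by (cases "x \<in> K") (force simp: le_max_iff_disj)+
  then show ?thesis by (intro that[of "max B 0"]) auto
qed

lemma Ck_translate: "Ck k \<phi> \<Longrightarrow> Ck k (\<lambda>x. \<phi> (x - z))"
proof (induction k arbitrary: \<phi>)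
  case 0
  have "continuous_on UNIV (\<phi> \<circ> (\<lambda>x. x - z))"
    by (rule continuous_on_compose) (use 0 in \<open>auto intro: continuous_intros continuous_on_subset\<close>)
  then show ?case by (simp add: o_def)
next
  case (Suc k)
  have "((\<lambda>x. \<phi> (x - z)) has_derivative frechet_derivative \<phi> (at (x - z))) (at x)" for x
  proof -
    have "(\<phi> has_derivative frechet_derivative \<phi> (at (x - z))) (at (x - z))"
      using Suc.prems by (simp add: frechet_derivative_works)
    moreover have "((\<lambda>x. x - z) has_derivative (\<lambda>v. v)) (at x)" by (auto intro!: derivative_eq_intros)
    ultimately show ?thesis using has_derivative_compose by blast
  qed
  note D = this
  then have "frechet_derivative (\<lambda>x. \<phi> (x - z)) (at x) v = frechet_derivative \<phi> (at (x - z)) v" for x v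
    by (simp add: frechet_derivative_eqI[OF D])
  then have eq: "(\<lambda>x. frechet_derivative (\<lambda>x. \<phi> (x - z)) (at x) v) = (\<lambda>x. frechet_derivative \<phi> (at (x - z)) v)" for v
    by blast
  have "Ck k (\<lambda>x. frechet_derivative \<phi> (at (x - z)) v)" for v
    using Suc.prems by (intro Suc.IH) simp
  then show ?case using D unfolding Ck.simps eq differentiable_def by blast
qed

lemma test_fun_translate:
  assumes "test_fun U \<phi>" "\<And>x. x \<in> U \<Longrightarrow> x + z \<in> \<Omega>"
  shows "test_fun \<Omega> (\<lambda>x. \<phi> (x - z))"
    and "frechet_derivative (\<lambda>x. \<phi> (x - z)) (at x) v = frechet_derivative \<phi> (at (x - z)) v"
proof -
  have "{x. \<phi> (x - z) \<noteq> 0} = (+) z ` {x. \<phi> x \<noteq> 0}"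
    by (force simp: image_iff)
  then have eq: "closure {x. \<phi> (x - z) \<noteq> 0} = (+) z ` closure {x. \<phi> x \<noteq> 0}"
    by (simp add: closure_translation)
  show "test_fun \<Omega> (\<lambda>x. \<phi> (x - z))"
    using assms compact_translation[of "closure {x. \<phi> x \<noteq> 0}" z] unfolding test_fun_def eq
    by (auto simp: Ck_translate add.commute[of z])
  have "((\<lambda>x. x - z) has_derivative (\<lambda>v. v)) (at x)" by (auto intro!: derivative_eq_intros)
  from has_derivative_compose[OF this test_fun_has_derivative[OF assms(1)]]
  show "frechet_derivative (\<lambda>x. \<phi> (x - z)) (at x) v = frechet_derivative \<phi> (at (x - z)) v"
    by (simp add: frechet_derivative_eqI)
qed

text \<open>The notion of weak gradient that the proofs use. The functions are Borel measurable on the whole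
  space, so that they can be translated and integrated over products. The formula is required in every direction \<open>v\<close>, because it is applied along segments.\<close>

definition borel_weak_gradient :: "(real ^ 'n) set \<Rightarrow> (real ^ 'n \<Rightarrow> real) \<Rightarrow> (real ^ 'n \<Rightarrow> real ^ 'n) \<Rightarrow> bool" where
  "borel_weak_gradient \<Omega> h G \<longleftrightarrow> h \<in> borel_measurable borel \<and> G \<in> borel_measurable borel \<and>
     (\<forall>K. compact K \<and> K \<subseteq> \<Omega> \<longrightarrow> integrable lborel (\<lambda>x. indicator K x *\<^sub>R h x) \<and> integrable lborel (\<lambda>x. indicator K x *\<^sub>R G x)) \<and>
     (\<forall>\<phi> v. test_fun \<Omega> \<phi> \<longrightarrow>
        (\<integral>x. h x * frechet_derivative \<phi> (at x) v \<partial>lborel) = - (\<integral>x. (G x \<bullet> v) * \<phi> x \<partial>lborel))"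

lemma integrable_mult_compact_support:
  fixes h \<psi> :: "real ^ 'n \<Rightarrow> real"
  assumes "integrable lborel (\<lambda>x. indicator K x * h x)" "continuous_on UNIV \<psi>" "compact K" 
    "\<And>x. x \<notin> K \<Longrightarrow> \<psi> x = 0"
  shows "integrable lborel (\<lambda>x. h x * \<psi> x)"
proof -
  obtain B where B: "B \<ge> 0" "\<And>x. \<bar>\<psi> x\<bar> \<le> B"
    using continuous_compact_support_bounded[OF assms(2-4)] by auto
  have [measurable]: "\<psi> \<in> borel_measurable borel" using assms(2) by (rule borel_measurable_continuous_onI)
  have "integrable lborel (\<lambda>x. (indicator K x * h x) * \<psi> x)"
  proof (rule Bochner_Integration.integrable_bound)
    show "integrable lborel (\<lambda>x. B * (indicator K x * h x))" using assms(1) by simp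
    show "(\<lambda>x. indicator K x * h x * \<psi> x) \<in> borel_measurable lborel"
      using borel_measurable_integrable[OF assms(1)] by simp
    show "AE x in lborel. norm (indicator K x * h x * \<psi> x) \<le> norm (B * (indicator K x * h x))"
      using B by (intro AE_I2) (simp add: abs_mult mult.commute mult_right_mono)
  qed
  also have "(\<lambda>x. (indicator K x * h x) * \<psi> x) = (\<lambda>x. h x * \<psi> x)"
    using assms(4) by (auto simp: indicator_def fun_eq_iff)
  finally show ?thesis .
qed

lemma borel_weak_gradientD:
  assumes "borel_weak_gradient \<Omega> h G"
  shows "h \<in> borel_measurable borel" "G \<in> borel_measurable borel"
    and "compact K \<Longrightarrow> K \<subseteq> \<Omega> \<Longrightarrow> integrable lborel (\<lambda>x. indicator K x * h x)"
    and "compact K \<Longrightarrow> K \<subseteq> \<Omega> \<Longrightarrow> integrable lborel (\<lambda>x. indicator K x * (G x \<bullet> v))"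
    and "test_fun \<Omega> \<phi> \<Longrightarrow> (\<integral>x. h x * frechet_derivative \<phi> (at x) v \<partial>lborel) = - (\<integral>x. (G x \<bullet> v) * \<phi> x \<partial>lborel)"
proof -
  show "integrable lborel (\<lambda>x. indicator K x * (G x \<bullet> v))" if "compact K" "K \<subseteq> \<Omega>"
    using assms that integrable_inner_left[of v lborel "\<lambda>x. indicator K x *\<^sub>R G x"] 
    unfolding borel_weak_gradient_def by simp
qed (use assms in \<open>auto simp: borel_weak_gradient_def\<close>)

text \<open>Each component of the difference integrates to \<open>0\<close> against every test function.\<close>

lemma borel_weak_gradient_unique:
  fixes \<Omega> :: "(real ^ 'n) set"
  assumes "open \<Omega>" and G: "borel_weak_gradient \<Omega> h G" and G': "borel_weak_gradient \<Omega> h' G'"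
    and ae: "AE x in lborel. x \<in> \<Omega> \<longrightarrow> h x = h' x"
  shows "AE x in lborel. x \<in> \<Omega> \<longrightarrow> G x = G' x"
proof -
  note [measurable] = borel_weak_gradientD(1,2)[OF G] borel_weak_gradientD(1,2)[OF G']
  have "AE x in lborel. x \<in> \<Omega> \<longrightarrow> G x \<bullet> b - G' x \<bullet> b = 0" for b
  proof (rule fundamental_lemma[OF \<open>open \<Omega>\<close>])
    fix K :: "(real ^ 'n) set" assume "compact K" "K \<subseteq> \<Omega>"
    then show "integrable lborel (\<lambda>x. indicator K x * (G x \<bullet> b - G' x \<bullet> b))"
      using Bochner_Integration.integrable_diff[OF borel_weak_gradientD(4)[OF G, of K b] borel_weak_gradientD(4)[OF G', of K b]]
      by (simp add: right_diff_distrib)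
  next
    fix \<phi> assume \<phi>: "test_fun \<Omega> \<phi>"
    obtain K where K: "compact K" "K \<subseteq> \<Omega>" "\<And>x. x \<notin> K \<Longrightarrow> \<phi> x = 0"
      "\<And>x v. x \<notin> K \<Longrightarrow> frechet_derivative \<phi> (at x) v = 0"
      using test_fun_support[OF \<phi>] by metis
    have [measurable]: "\<phi> \<in> borel_measurable borel" "(\<lambda>x. frechet_derivative \<phi> (at x) b) \<in> borel_measurable borel"
      using test_fun_continuous[OF \<phi>] by (auto intro: borel_measurable_continuous_onI)
    have i: "integrable lborel (\<lambda>x. (G x \<bullet> b) * \<phi> x)" "integrable lborel (\<lambda>x. (G' x \<bullet> b) * \<phi> x)"
      using K by (auto intro!: integrable_mult_compact_support[where K=K] borel_weak_gradientD(4)[OF G] borel_weak_gradientD(4)[OF G']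
        test_fun_continuous[OF \<phi>])
    have "(\<integral>x. h x * frechet_derivative \<phi> (at x) b \<partial>lborel) = (\<integral>x. h' x * frechet_derivative \<phi> (at x) b \<partial>lborel)"
    proof (rule integral_cong_AE)
      show "AE x in lborel. h x * frechet_derivative \<phi> (at x) b = h' x * frechet_derivative \<phi> (at x) b"
        using ae by eventually_elim (use K in auto)
    qed auto
    then show "(\<integral>x. (G x \<bullet> b - G' x \<bullet> b) * \<phi> x \<partial>lborel) = 0"
      using borel_weak_gradientD(5)[OF G \<phi>, of b] borel_weak_gradientD(5)[OF G' \<phi>, of b] i
      by (simp add: left_diff_distrib)
  qed
  then have "AE x in lborel. \<forall>b\<in>Basis. x \<in> \<Omega> \<longrightarrow> G x \<bullet> b - G' x \<bullet> b = 0"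
    by (subst AE_finite_all) auto
  then show ?thesis by eventually_elim (auto intro: euclidean_eqI)
qed

text \<open>For a test function \<open>\<phi>\<close> let \<open>w\<close> be the derivative of \<open>u = h \<phi>\<close> in direction \<open>v\<close>. Integration by
  parts says that \<open>w\<close> has integral \<open>0\<close>. It is the limit of the difference quotients of \<open>u\<close>, whose integrals
  vanish by translation invariance. Local boundedness of \<open>G\<close> makes \<open>u\<close> Lipschitz in direction \<open>v\<close>, so
  the convergence is dominated.\<close>

lemma borel_weak_gradient_classical:
  fixes \<Omega> :: "(real ^ 'n) set"
  assumes "open \<Omega>" and [measurable]: "h \<in> borel_measurable borel" "G \<in> borel_measurable borel"
    and der: "\<And>x. x \<in> \<Omega> \<Longrightarrow> (h has_derivative (\<lambda>v. G x \<bullet> v)) (at x)"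
    and bnd: "\<And>K. compact K \<Longrightarrow> K \<subseteq> \<Omega> \<Longrightarrow> \<exists>B. \<forall>x\<in>K. norm (G x) \<le> B"
  shows "borel_weak_gradient \<Omega> h G"
proof -
  have cont: "continuous_on K h" if "K \<subseteq> \<Omega>" for K
    using der that by (intro continuous_at_imp_continuous_on) (auto intro!: has_derivative_continuous)
  have ih: "integrable lborel (\<lambda>x. indicator K x *\<^sub>R h x)" if "compact K" "K \<subseteq> \<Omega>" for K
    using that cont by (intro borel_integrable_compact) auto
  have iG: "integrable lborel (\<lambda>x. indicator K x *\<^sub>R G x)" if K: "compact K" "K \<subseteq> \<Omega>" for K
  proof -
    obtain B where "\<forall>x\<in>K. norm (G x) \<le> B" using bnd[OF K] by auto
    then show ?thesis
      using K emeasure_bounded_finite[of K] by (intro integrableI_bounded_set_indicator[where B=B]) (auto simp: compact_imp_bounded compact_imp_closed)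
  qed
  have parts: "(\<integral>x. h x * frechet_derivative \<phi> (at x) v \<partial>lborel) = - (\<integral>x. (G x \<bullet> v) * \<phi> x \<partial>lborel)"
    if \<phi>: "test_fun \<Omega> \<phi>" for \<phi> v
  proof -
    obtain K where K: "compact K" "K \<subseteq> \<Omega>" "\<And>x. x \<notin> K \<Longrightarrow> \<phi> x = 0"
      "\<And>x v. x \<notin> K \<Longrightarrow> frechet_derivative \<phi> (at x) v = 0"
      using test_fun_support[OF \<phi>] by metis
    define D where "D = (\<lambda>x. frechet_derivative \<phi> (at x) v)"
    have contD: "continuous_on UNIV D" unfolding D_def by (rule test_fun_continuous[OF \<phi>])
    have cont\<phi>: "continuous_on UNIV \<phi>" by (rule test_fun_continuous[OF \<phi>])
    have [measurable]: "\<phi> \<in> borel_measurable borel" "D \<in> borel_measurable borel"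
      using contD cont\<phi> by (auto intro: borel_measurable_continuous_onI)
    define u where "u = (\<lambda>x. h x * \<phi> x)"
    define w where "w = (\<lambda>x. h x * D x + (G x \<bullet> v) * \<phi> x)"
    have [measurable]: "u \<in> borel_measurable borel" "w \<in> borel_measurable borel" unfolding u_def w_def by auto
    have du: "((\<lambda>t. u (x + t *\<^sub>R v)) has_real_derivative w (x + t *\<^sub>R v)) (at t)" for x t
    proof (cases "x + t *\<^sub>R v \<in> \<Omega>")
      case True
      have D: "(u has_derivative (\<lambda>v'. h (x + t *\<^sub>R v) * frechet_derivative \<phi> (at (x + t *\<^sub>R v)) v' + (G (x + t *\<^sub>R v) \<bullet> v') * \<phi> (x + t *\<^sub>R v))) (at (x + t *\<^sub>R v))"
        unfolding u_def by (intro has_derivative_mult der True test_fun_has_derivative[OF \<phi>])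
      have lin: "frechet_derivative \<phi> (at y) (s *\<^sub>R v) = s * D y" for s y
        unfolding D_def by (rule test_fun_derivative_scaleR[OF \<phi>])
      have "((\<lambda>t. u (x + t *\<^sub>R v)) has_derivative (\<lambda>s. h (x + t *\<^sub>R v) * frechet_derivative \<phi> (at (x + t *\<^sub>R v)) (s *\<^sub>R v) + (G (x + t *\<^sub>R v) \<bullet> (s *\<^sub>R v)) * \<phi> (x + t *\<^sub>R v))) (at t)"
        by (rule has_derivative_compose[where g=u and f="\<lambda>t. x + t *\<^sub>R v", OF _ D]) (auto intro!: derivative_eq_intros)
      then show ?thesis
        unfolding has_field_derivative_def by (rule has_derivative_eq_rhs) (auto simp: w_def lin algebra_simps)
    next
      case False
      let ?S = "(\<lambda>t. x + t *\<^sub>R v) -` (- K)"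
      have op: "open ?S" using K(1) by (intro open_vimage) (auto intro!: continuous_intros simp: compact_imp_closed)
      have mem: "t \<in> ?S" using False K(2) by auto
      have der0: "((\<lambda>t. 0) has_real_derivative w (x + t *\<^sub>R v)) (at t)"
        using False K by (auto simp: w_def D_def subset_eq)
      show ?thesis
        by (rule has_field_derivative_transform_within_open[OF der0 op mem]) (auto simp: u_def K)
    qed
    obtain B where B: "B \<ge> 0" "\<And>x. \<bar>w x\<bar> \<le> B"
    proof -
      obtain BG where BG: "\<forall>x\<in>K. norm (G x) \<le> BG" using bnd[OF K(1,2)] by auto
      have "bounded (h ` K)" using cont K by (intro compact_imp_bounded compact_continuous_image) auto
      then obtain Bh where Bh: "\<forall>x\<in>K. \<bar>h x\<bar> \<le> Bh" by (auto simp: bounded_iff)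
      obtain B1 where B1: "B1 \<ge> 0" "\<And>x. \<bar>\<phi> x\<bar> \<le> B1"
        using continuous_compact_support_bounded[OF cont\<phi> K(1,3)] by auto
      obtain B2 where B2: "B2 \<ge> 0" "\<And>x. \<bar>D x\<bar> \<le> B2"
        using continuous_compact_support_bounded[OF contD K(1)] K(4) by (auto simp: D_def)
      have "\<bar>w x\<bar> \<le> \<bar>Bh\<bar> * B2 + \<bar>BG\<bar> * norm v * B1" for x
      proof (cases "x \<in> K")
        case True
        have "\<bar>w x\<bar> \<le> \<bar>h x\<bar> * \<bar>D x\<bar> + \<bar>G x \<bullet> v\<bar> * \<bar>\<phi> x\<bar>"
          unfolding w_def by (metis abs_mult abs_triangle_ineq)
        also have "\<dots> \<le> \<bar>Bh\<bar> * B2 + (norm (G x) * norm v) * B1"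
          using True Bh B1 B2 by (intro add_mono mult_mono Cauchy_Schwarz_ineq2) auto
        also have "\<dots> \<le> \<bar>Bh\<bar> * B2 + (\<bar>BG\<bar> * norm v) * B1"
          using True BG B1 B2 by (intro add_mono mult_right_mono) auto
        finally show ?thesis .
      next
        case False then show ?thesis using K B1 B2 by (simp add: w_def D_def)
      qed
      moreover have "\<bar>Bh\<bar> * B2 + \<bar>BG\<bar> * norm v * B1 \<ge> 0" using B1 B2 by simp
      ultimately show ?thesis using that by blast
    qed
    have lip: "\<bar>u (x + t *\<^sub>R v) - u x\<bar> \<le> B * \<bar>t\<bar>" for x t
    proof -
      have "norm (u (x + t *\<^sub>R v) - u (x + 0 *\<^sub>R v)) \<le> B * norm (t - 0)"
        by (rule field_differentiable_bound[of UNIV "\<lambda>t. u (x + t *\<^sub>R v)" "\<lambda>t. w (x + t *\<^sub>R v)"])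
           (use du B in auto)
      then show ?thesis by simp
    qed
    define \<epsilon> where "\<epsilon> = (\<lambda>k. inverse (real (Suc k)))"
    have eps: "0 < \<epsilon> k" "\<epsilon> k \<le> 1" "\<epsilon> k \<noteq> 0" for k 
      unfolding \<epsilon>_def by (auto simp: field_simps)
    have eps0: "\<epsilon> \<longlonglongrightarrow> 0" unfolding \<epsilon>_def by (rule LIMSEQ_inverse_real_of_nat)
    \<comment> \<open>a compact set outside of which all difference quotients with step at most 1 vanish\<close>
    define K1 where "K1 = (\<lambda>(t, x). x - t *\<^sub>R v) ` ({0..1} \<times> K)"
    have K1: "compact K1" unfolding K1_def
      using K(1) by (intro compact_continuous_image compact_Times) (auto simp: case_prod_unfold intro!: continuous_intros)
    have u0: "u x = 0" if "x \<notin> K1" for x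
    proof -
      have "x \<in> K \<Longrightarrow> x \<in> K1" unfolding K1_def by (rule image_eqI[of _ _ "(0, x)"]) auto
      then show ?thesis using that K(3) by (auto simp: u_def)
    qed
    have u1: "u (x + \<epsilon> k *\<^sub>R v) = 0" if "x \<notin> K1" for x k
    proof -
      have "x + \<epsilon> k *\<^sub>R v \<in> K \<Longrightarrow> x \<in> K1" 
        unfolding K1_def using eps[of k] by (intro image_eqI[of _ _ "(\<epsilon> k, x + \<epsilon> k *\<^sub>R v)"]) auto
      then show ?thesis using that K(3) by (auto simp: u_def)
    qed
    have iu: "integrable lborel u"
      unfolding u_def by (rule integrable_mult_compact_support[OF _ cont\<phi> K(1,3)]) (use ih[OF K(1,2)] in simp_all)
    have lim: "(\<lambda>k. \<integral>x. (u (x + \<epsilon> k *\<^sub>R v) - u x) / \<epsilon> k \<partial>lborel) \<longlonglongrightarrow> (\<integral>x. w x \<partial>lborel)"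
    proof (rule integral_dominated_convergence[where w="\<lambda>x. B * indicator K1 x"])
      have "emeasure lborel K1 < \<infinity>" using K1 by (intro emeasure_bounded_finite) (simp add: compact_imp_bounded)
      then show "integrable lborel (\<lambda>x. B * indicator K1 x)"
        using K1 by (intro integrable_mult_right) (auto simp: compact_imp_closed)
      show "AE x in lborel. (\<lambda>k. (u (x + \<epsilon> k *\<^sub>R v) - u x) / \<epsilon> k) \<longlonglongrightarrow> w x"
      proof (rule AE_I2)
        fix x
        have "((\<lambda>t. (u (x + (0 + t) *\<^sub>R v) - u (x + 0 *\<^sub>R v)) / t) \<longlongrightarrow> w (x + 0 *\<^sub>R v)) (at 0)"
          using du[of x 0] by (simp add: DERIV_def)
        then show "(\<lambda>k. (u (x + \<epsilon> k *\<^sub>R v) - u x) / \<epsilon> k) \<longlonglongrightarrow> w x"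
          using eps eps0 by (auto simp: tendsto_at_iff_sequentially o_def)
      qed
      show "AE x in lborel. norm ((u (x + \<epsilon> k *\<^sub>R v) - u x) / \<epsilon> k) \<le> B * indicator K1 x" for k
      proof (rule AE_I2)
        fix x show "norm ((u (x + \<epsilon> k *\<^sub>R v) - u x) / \<epsilon> k) \<le> B * indicator K1 x"
          using lip[of x "\<epsilon> k"] eps[of k] u0[of x] u1[of x k]
          by (cases "x \<in> K1") (auto simp: field_simps)
      qed
    qed auto
    have quot0: "(\<lambda>k. \<integral>x. (u (x + \<epsilon> k *\<^sub>R v) - u x) / \<epsilon> k \<partial>lborel) = (\<lambda>k. 0)"
    proof
      fix k show "(\<integral>x. (u (x + \<epsilon> k *\<^sub>R v) - u x) / \<epsilon> k \<partial>lborel) = 0"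
        using integral_lborel_translate[of u "\<epsilon> k *\<^sub>R v"] integrable_lborel_translate[OF iu, of "\<epsilon> k *\<^sub>R v"] iu
        by (simp add: add.commute)
    qed
    have "(\<integral>x. w x \<partial>lborel) = 0" using lim unfolding quot0 by (simp add: LIMSEQ_const_iff)
    moreover have "integrable lborel (\<lambda>x. h x * D x)"
      by (rule integrable_mult_compact_support[OF _ contD K(1)]) (use ih[OF K(1,2)] K(4) in \<open>simp_all add: D_def\<close>)
    moreover have "integrable lborel (\<lambda>x. (G x \<bullet> v) * \<phi> x)"
      by (rule integrable_mult_compact_support[OF _ cont\<phi> K(1,3)]) (use integrable_inner_left[OF iG[OF K(1,2)], of v] in simp_all)
    ultimately show ?thesis by (simp add: w_def D_def)
  qed
  show ?thesis unfolding borel_weak_gradient_def using ih iG parts by auto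
qed

section \<open>Weak differentiability along lines\<close>

text \<open>Both sides are locally integrable functions of \<open>x\<close>, so by the fundamental lemma they may be
  compared after integration against a test function \<open>\<phi>\<close>. On the right the translation by \<open>t z\<close> is moved
  onto \<open>\<phi>\<close>, where the weak gradient becomes a derivative of \<open>\<phi>\<close>; integrating that derivative over
  \<open>t\<close> gives \<open>\<phi>(y - z) - \<phi>(y)\<close>, which is the left-hand side.\<close>

lemma weak_gradient_line_formula:
  fixes \<Omega> U :: "(real ^ 'n) set" and z :: "real ^ 'n"
  assumes wg: "borel_weak_gradient \<Omega> h G" and U: "open U"
    and seg: "\<And>x t. x \<in> U \<Longrightarrow> 0 \<le> t \<Longrightarrow> t \<le> 1 \<Longrightarrow> x + t *\<^sub>R z \<in> \<Omega>"
  shows "AE x in lborel. x \<in> U \<longrightarrow>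
    h (x + z) - h x = (\<integral>t. indicator {0..1} t * (G (x + t *\<^sub>R z) \<bullet> z) \<partial>lborel)"
proof -
  note [measurable] = borel_weak_gradientD(1,2)[OF wg]
  define P where "P = (\<lambda>x. \<integral>t. indicator {0..1} t * (G (x + t *\<^sub>R z) \<bullet> z) \<partial>lborel)"
  define I :: "real \<Rightarrow> real" where "I = indicator {0..1}"
  have I_meas [measurable]: "I \<in> borel_measurable borel" by (simp add: I_def)
  have I01: "\<And>t. \<bar>I t\<bar> \<le> 1" "\<And>t. t < 0 \<or> 1 < t \<Longrightarrow> I t = 0" "\<And>t. 0 \<le> t \<Longrightarrow> t \<le> 1 \<Longrightarrow> I t = 1" 
    by (auto simp: I_def)
  have iI: "integrable lborel I" by (simp add: I_def)
  have nnI: "(\<integral>\<^sup>+t. ennreal \<bar>I t\<bar> \<partial>lborel) = 1"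
  proof -
    have "(\<integral>\<^sup>+t. ennreal \<bar>I t\<bar> \<partial>lborel) = (\<integral>\<^sup>+t. indicator {0..1} t \<partial>(lborel :: real measure))"
      by (intro nn_integral_cong) (auto simp: I_def indicator_def)
    then show ?thesis by simp
  qed
  have "AE x in lborel. x \<in> U \<longrightarrow> h (x + z) - h x - P x = 0"
  proof (rule fundamental_lemma[OF U])
    have P_eq: "P = (\<lambda>x. \<integral>t. I t * (G (x + t *\<^sub>R z) \<bullet> z) \<partial>lborel)" by (simp add: P_def I_def)
    \<comment> \<open>everything is localised to the compact set swept out by the segments starting in \<open>K\<close>\<close>
    have swept: "\<exists>K'. compact K' \<and> K' \<subseteq> \<Omega> \<and> (\<forall>x\<in>K. \<forall>t. 0 \<le> t \<longrightarrow> t \<le> 1 \<longrightarrow> x + t *\<^sub>R z \<in> K')" if "compact K" "K \<subseteq> U" for K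
    proof (intro exI conjI)
      let ?K = "(\<lambda>(t, x). x + t *\<^sub>R z) ` ({0..1} \<times> K)"
      show "compact ?K" using that
        by (intro compact_continuous_image compact_Times) (auto simp: case_prod_unfold intro!: continuous_intros)
      show "?K \<subseteq> \<Omega>" using seg that by auto
      show "\<forall>x\<in>K. \<forall>t. 0 \<le> t \<longrightarrow> t \<le> 1 \<longrightarrow> x + t *\<^sub>R z \<in> ?K"
      proof (intro ballI allI impI)
        fix x t assume "x \<in> K" "0 \<le> t" "t \<le> (1::real)"
        then show "x + t *\<^sub>R z \<in> ?K" by (intro image_eqI[of _ _ "(t, x)"]) auto
      qed
    qed
    have swept_integrable: "integrable (lborel \<Otimes>\<^sub>M lborel) (\<lambda>(t, x). I t * (g (x + t *\<^sub>R z) * \<psi> x))"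
      if g: "integrable lborel g" and \<psi>: "\<psi> \<in> borel_measurable borel" "\<And>x. \<bar>\<psi> x\<bar> \<le> B" for g \<psi> :: "real ^ 'n \<Rightarrow> real" and B
    proof (rule integrableI_bounded)
      have [measurable]: "g \<in> borel_measurable borel" "\<psi> \<in> borel_measurable borel" using g \<psi> by auto
      show "(\<lambda>(t, x). I t * (g (x + t *\<^sub>R z) * \<psi> x)) \<in> borel_measurable (lborel \<Otimes>\<^sub>M lborel)"
        by measurable
      have "(\<integral>\<^sup>+tx. ennreal (norm (case tx of (t, x) \<Rightarrow> I t * (g (x + t *\<^sub>R z) * \<psi> x))) \<partial>(lborel \<Otimes>\<^sub>M lborel))
        = (\<integral>\<^sup>+t. (\<integral>\<^sup>+x. ennreal (norm (I t * (g (x + t *\<^sub>R z) * \<psi> x))) \<partial>lborel) \<partial>lborel)"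
        by (subst lborel.nn_integral_fst[symmetric]) auto
      also have "\<dots> \<le> (\<integral>\<^sup>+t. ennreal \<bar>I t\<bar> * (ennreal B * (\<integral>\<^sup>+x. ennreal \<bar>g x\<bar> \<partial>lborel)) \<partial>lborel)"
      proof (rule nn_integral_mono)
        fix t
        have "B \<ge> 0" using \<psi>(2)[of 0] by linarith
        have "(\<integral>\<^sup>+x. ennreal (norm (I t * (g (x + t *\<^sub>R z) * \<psi> x))) \<partial>lborel)
          \<le> (\<integral>\<^sup>+x. ennreal \<bar>I t\<bar> * (ennreal B * ennreal \<bar>g (t *\<^sub>R z + x)\<bar>) \<partial>lborel)"
        proof (rule nn_integral_mono)
          fix x
          have "norm (I t * (g (x + t *\<^sub>R z) * \<psi> x)) \<le> \<bar>I t\<bar> * (B * \<bar>g (t *\<^sub>R z + x)\<bar>)"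
            using \<psi>(2)[of x] by (simp add: abs_mult add.commute mult.commute mult_left_mono mult_right_mono)
          then show "ennreal (norm (I t * (g (x + t *\<^sub>R z) * \<psi> x))) \<le> ennreal \<bar>I t\<bar> * (ennreal B * ennreal \<bar>g (t *\<^sub>R z + x)\<bar>)"
            using \<open>B \<ge> 0\<close> by (simp add: ennreal_mult[symmetric] ennreal_leI)
        qed
        also have "\<dots> = ennreal \<bar>I t\<bar> * (ennreal B * (\<integral>\<^sup>+x. ennreal \<bar>g (t *\<^sub>R z + x)\<bar> \<partial>lborel))"
          by (simp add: nn_integral_cmult)
        also have "(\<integral>\<^sup>+x. ennreal \<bar>g (t *\<^sub>R z + x)\<bar> \<partial>lborel) = (\<integral>\<^sup>+x. ennreal \<bar>g x\<bar> \<partial>lborel)"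
          by (rule nn_integral_lborel_translate) simp
        finally show "(\<integral>\<^sup>+x. ennreal (norm (I t * (g (x + t *\<^sub>R z) * \<psi> x))) \<partial>lborel) \<le> ennreal \<bar>I t\<bar> * (ennreal B * (\<integral>\<^sup>+x. ennreal \<bar>g x\<bar> \<partial>lborel))" .
      qed
      also have "\<dots> = ennreal B * (\<integral>\<^sup>+x. ennreal \<bar>g x\<bar> \<partial>lborel)"
        by (simp add: nn_integral_multc nnI)
      also have "\<dots> < \<infinity>"
        using g by (simp add: integrable_iff_bounded ennreal_mult_less_top)
      finally show "(\<integral>\<^sup>+tx. ennreal (norm (case tx of (t, x) \<Rightarrow> I t * (g (x + t *\<^sub>R z) * \<psi> x))) \<partial>(lborel \<Otimes>\<^sub>M lborel)) < \<infinity>" .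
    qed
    have int: "integrable lborel (\<lambda>x. indicator K x * h (x + z))" "integrable lborel (\<lambda>x. indicator K x * h x)"
      "integrable lborel (\<lambda>x. indicator K x * P x)" if K: "compact K" "K \<subseteq> U" for K
    proof -
      have [measurable]: "K \<in> sets borel" using K by (simp add: compact_imp_closed)
      obtain K' where K': "compact K'" "K' \<subseteq> \<Omega>" "\<And>x t. x \<in> K \<Longrightarrow> 0 \<le> t \<Longrightarrow> t \<le> 1 \<Longrightarrow> x + t *\<^sub>R z \<in> K'"
        using swept[OF K] by blast
      have [measurable]: "K' \<in> sets borel" using K' by (simp add: compact_imp_closed)
      have "integrable lborel (\<lambda>x. indicator K x *\<^sub>R (indicator K' (z + x) * h (z + x)))"
        by (intro integrable_mult_indicator integrable_lborel_translate[OF borel_weak_gradientD(3)[OF wg K'(1,2)]]) auto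
      also have "(\<lambda>x. indicator K x *\<^sub>R (indicator K' (z + x) * h (z + x))) = (\<lambda>x. indicator K x * h (x + z))"
        using K'(3)[of _ 1] by (intro ext) (auto simp: indicator_def add.commute)
      finally show "integrable lborel (\<lambda>x. indicator K x * h (x + z))" .
      have "K \<subseteq> \<Omega>" using seg[of _ 0] K by auto
      then show "integrable lborel (\<lambda>x. indicator K x * h x)" using K by (intro borel_weak_gradientD(3)[OF wg])
      have "integrable (lborel \<Otimes>\<^sub>M lborel) (\<lambda>(t, x). I t * ((indicator K' (x + t *\<^sub>R z) * (G (x + t *\<^sub>R z) \<bullet> z)) * indicator K x))"
        by (rule swept_integrable[OF borel_weak_gradientD(4)[OF wg K'(1,2)], of "indicator K" 1 z]) (auto simp: indicator_def)
      from lborel_pair.integrable_snd[OF this]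
      have "integrable lborel (\<lambda>x. \<integral>t. I t * ((indicator K' (x + t *\<^sub>R z) * (G (x + t *\<^sub>R z) \<bullet> z)) * indicator K x) \<partial>lborel)" .
      also have "(\<lambda>x. \<integral>t. I t * ((indicator K' (x + t *\<^sub>R z) * (G (x + t *\<^sub>R z) \<bullet> z)) * indicator K x) \<partial>lborel) = (\<lambda>x. indicator K x * P x)"
      proof (rule ext)
        fix x
        have "(\<integral>t. I t * ((indicator K' (x + t *\<^sub>R z) * (G (x + t *\<^sub>R z) \<bullet> z)) * indicator K x) \<partial>lborel)
          = (\<integral>t. indicator K x * (I t * (G (x + t *\<^sub>R z) \<bullet> z)) \<partial>lborel)"
          using K'(3) by (intro Bochner_Integration.integral_cong) (auto simp: I_def indicator_def)
        also have "\<dots> = indicator K x * P x" unfolding P_eq by simp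
        finally show "(\<integral>t. I t * ((indicator K' (x + t *\<^sub>R z) * (G (x + t *\<^sub>R z) \<bullet> z)) * indicator K x) \<partial>lborel) = indicator K x * P x" .
      qed
      finally show "integrable lborel (\<lambda>x. indicator K x * P x)" .
    qed
    show "integrable lborel (\<lambda>x. indicator K x * (h (x + z) - h x - P x))" if "compact K" "K \<subseteq> U" for K
      using Bochner_Integration.integrable_diff[OF Bochner_Integration.integrable_diff[OF int(1,2)[OF that]] int(3)[OF that]]
      by (simp add: right_diff_distrib)
    fix \<phi> assume \<phi>: "test_fun U \<phi>"
    obtain K where K: "compact K" "K \<subseteq> U" "\<And>x. x \<notin> K \<Longrightarrow> \<phi> x = 0"
      "\<And>x v. x \<notin> K \<Longrightarrow> frechet_derivative \<phi> (at x) v = 0"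
      using test_fun_support[OF \<phi>] by metis
    obtain K' where K': "compact K'" "K' \<subseteq> \<Omega>" "\<And>x t. x \<in> K \<Longrightarrow> 0 \<le> t \<Longrightarrow> t \<le> 1 \<Longrightarrow> x + t *\<^sub>R z \<in> K'"
      using swept[OF K(1,2)] by blast
    have [measurable]: "K' \<in> sets borel" using K' by (simp add: compact_imp_closed)
    define D where "D = (\<lambda>x. frechet_derivative \<phi> (at x) z)"
    have contD: "continuous_on A D" and cont\<phi>: "continuous_on A \<phi>" for A
      unfolding D_def by (rule test_fun_continuous[OF \<phi>])+
    have [measurable]: "\<phi> \<in> borel_measurable borel" "D \<in> borel_measurable borel"
      using contD cont\<phi> by (auto intro: borel_measurable_continuous_onI)
    obtain B\<phi> where B\<phi>: "\<And>x. \<bar>\<phi> x\<bar> \<le> B\<phi>"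
      using continuous_compact_support_bounded[OF cont\<phi> K(1,3)] by auto
    obtain BD where BD: "\<And>x. \<bar>D x\<bar> \<le> BD"
    proof -
      have "D x = 0" if "x \<notin> K" for x using K(4)[OF that] by (simp add: D_def)
      from continuous_compact_support_bounded[OF contD K(1) this] that show thesis by metis
    qed
    \<comment> \<open>cut off to \<open>K'\<close>, both functions are integrable and can be translated as functions on the whole space\<close>
    define g where "g = (\<lambda>x. indicator K' x * (G x \<bullet> z))"
    define H where "H = (\<lambda>x. indicator K' x * h x)"
    have ig: "integrable lborel g" unfolding g_def by (rule borel_weak_gradientD(4)[OF wg K'(1,2)])
    have iH: "integrable lborel H" unfolding H_def by (rule borel_weak_gradientD(3)[OF wg K'(1,2)])
    have [measurable]: "g \<in> borel_measurable borel" "H \<in> borel_measurable borel" using ig iH by auto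
    have iH\<phi>: "integrable lborel (\<lambda>y. H y * \<psi> y)" if "\<psi> \<in> borel_measurable borel" "\<And>y. \<bar>\<psi> y\<bar> \<le> B" for \<psi> B
    proof (rule Bochner_Integration.integrable_bound)
      have "B \<ge> 0" using that(2)[of 0] by linarith
      show "integrable lborel (\<lambda>y. B * H y)" using iH by simp
      show "(\<lambda>y. H y * \<psi> y) \<in> borel_measurable lborel" using that by simp
      show "AE y in lborel. norm (H y * \<psi> y) \<le> norm (B * H y)"
        using that(2) \<open>B \<ge> 0\<close> by (intro AE_I2) (simp add: abs_mult mult.commute[of B] mult_left_mono)
    qed
    have h1: "(\<integral>x. h (x + z) * \<phi> x \<partial>lborel) = (\<integral>y. H y * \<phi> (y - z) \<partial>lborel)"
    proof -
      have "(\<integral>x. h (x + z) * \<phi> x \<partial>lborel) = (\<integral>x. H (z + x) * \<phi> (z + x - z) \<partial>lborel)"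
        using K(3) K'(3)[of _ 1] by (intro Bochner_Integration.integral_cong) (auto simp: H_def indicator_def add.commute)
      then show ?thesis using integral_lborel_translate[of "\<lambda>y. H y * \<phi> (y - z)" z] by simp
    qed
    have h2: "(\<integral>x. h x * \<phi> x \<partial>lborel) = (\<integral>y. H y * \<phi> y \<partial>lborel)"
      using K(3) K'(3)[of _ 0] by (intro Bochner_Integration.integral_cong) (auto simp: H_def indicator_def)
    \<comment> \<open>for fixed \<open>t\<close>, the translate of \<open>\<phi>\<close> is again a test function in \<open>\<Omega>\<close>\<close>
    have inner: "(\<integral>x. g (x + t *\<^sub>R z) * \<phi> x \<partial>lborel) = - (\<integral>y. H y * D (y - t *\<^sub>R z) \<partial>lborel)" if t: "0 \<le> t" "t \<le> 1" for t
    proof -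
      have in_K': "y \<in> K'" if "y - t *\<^sub>R z \<in> K" for y using K'(3)[OF that t] by simp
      have "(\<integral>x. g (x + t *\<^sub>R z) * \<phi> x \<partial>lborel) = (\<integral>x. g (t *\<^sub>R z + x) * \<phi> (t *\<^sub>R z + x - t *\<^sub>R z) \<partial>lborel)"
        by (simp add: add.commute)
      also have "\<dots> = (\<integral>y. g y * \<phi> (y - t *\<^sub>R z) \<partial>lborel)"
        using integral_lborel_translate[of "\<lambda>y. g y * \<phi> (y - t *\<^sub>R z)" "t *\<^sub>R z"] by simp
      also have "\<dots> = (\<integral>y. (G y \<bullet> z) * \<phi> (y - t *\<^sub>R z) \<partial>lborel)"
        using in_K' K(3) by (intro Bochner_Integration.integral_cong) (auto simp: g_def indicator_def)
      also have "\<dots> = - (\<integral>y. h y * D (y - t *\<^sub>R z) \<partial>lborel)"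
        using borel_weak_gradientD(5)[OF wg test_fun_translate(1)[OF \<phi>, of "t *\<^sub>R z" \<Omega>], of z] seg t
          test_fun_translate(2)[OF \<phi>, of "t *\<^sub>R z" \<Omega>] by (simp add: D_def)
      also have "(\<integral>y. h y * D (y - t *\<^sub>R z) \<partial>lborel) = (\<integral>y. H y * D (y - t *\<^sub>R z) \<partial>lborel)"
        using in_K' K(4) by (intro Bochner_Integration.integral_cong) (auto simp: H_def D_def indicator_def)
      finally show ?thesis .
    qed
    have "(\<integral>x. P x * \<phi> x \<partial>lborel) = (\<integral>x. \<integral>t. I t * (g (x + t *\<^sub>R z) * \<phi> x) \<partial>lborel \<partial>lborel)"
    proof (rule Bochner_Integration.integral_cong)
      fix x
      have "P x * \<phi> x = (\<integral>t. I t * (G (x + t *\<^sub>R z) \<bullet> z) * \<phi> x \<partial>lborel)" unfolding P_eq by simp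
      also have "\<dots> = (\<integral>t. I t * (g (x + t *\<^sub>R z) * \<phi> x) \<partial>lborel)"
        using K(3) K'(3) by (intro Bochner_Integration.integral_cong) (auto simp: I_def g_def indicator_def)
      finally show "P x * \<phi> x = (\<integral>t. I t * (g (x + t *\<^sub>R z) * \<phi> x) \<partial>lborel)" .
    qed simp
    also have "\<dots> = (\<integral>t. \<integral>x. I t * (g (x + t *\<^sub>R z) * \<phi> x) \<partial>lborel \<partial>lborel)"
      by (rule lborel_pair.Fubini_integral[OF swept_integrable[OF ig, of \<phi> B\<phi>]]) (use B\<phi> in auto)
    also have "\<dots> = (\<integral>t. \<integral>y. - (I t * (H y * D (y - t *\<^sub>R z))) \<partial>lborel \<partial>lborel)"
    proof (rule Bochner_Integration.integral_cong)
      fix t show "(\<integral>x. I t * (g (x + t *\<^sub>R z) * \<phi> x) \<partial>lborel) = (\<integral>y. - (I t * (H y * D (y - t *\<^sub>R z))) \<partial>lborel)"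
        using inner[of t] I01(2)[of t] by (cases "0 \<le> t \<and> t \<le> 1") auto
    qed simp
    also have "\<dots> = (\<integral>y. \<integral>t. - (I t * (H y * D (y - t *\<^sub>R z))) \<partial>lborel \<partial>lborel)"
    proof (rule lborel_pair.Fubini_integral)
      show "integrable (lborel \<Otimes>\<^sub>M lborel) (\<lambda>(y, t). - (I t * (H y * D (y - t *\<^sub>R z))))"
      proof (rule Bochner_Integration.integrable_bound)
        have "integrable (lborel \<Otimes>\<^sub>M lborel) (\<lambda>(y, t). H y * (BD * I t))"
        proof (rule lborel_pair.Fubini_integrable)
          show "(\<lambda>(y, t). H y * (BD * I t)) \<in> borel_measurable (lborel \<Otimes>\<^sub>M lborel)" by measurable
          show "integrable lborel (\<lambda>y. \<integral>t. norm (case (y, t) of (y, t) \<Rightarrow> H y * (BD * I t)) \<partial>lborel)"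
            using iH by (simp add: abs_mult)
          show "AE y in lborel. integrable lborel (\<lambda>t. case (y, t) of (y, t) \<Rightarrow> H y * (BD * I t))"
            using iI by simp
        qed
        then show "integrable (lborel \<Otimes>\<^sub>M lborel) (\<lambda>(y, t). H y * (BD * I t))" .
        show "(\<lambda>(y, t). - (I t * (H y * D (y - t *\<^sub>R z)))) \<in> borel_measurable (lborel \<Otimes>\<^sub>M lborel)" by measurable
        have "BD \<ge> 0" using BD[of 0] by linarith
        show "AE yt in lborel \<Otimes>\<^sub>M lborel. norm (case yt of (y, t) \<Rightarrow> - (I t * (H y * D (y - t *\<^sub>R z)))) \<le> norm (case yt of (y, t) \<Rightarrow> H y * (BD * I t))"
        proof (rule AE_I2)
          fix yt :: "(real ^ 'n) \<times> real"
          obtain y t where yt: "yt = (y, t)" by (cases yt)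
          have "\<bar>H y\<bar> * \<bar>I t\<bar> * \<bar>D (y - t *\<^sub>R z)\<bar> \<le> \<bar>H y\<bar> * \<bar>I t\<bar> * BD"
            using BD by (intro mult_left_mono) auto
          then show "norm (case yt of (y, t) \<Rightarrow> - (I t * (H y * D (y - t *\<^sub>R z)))) \<le> norm (case yt of (y, t) \<Rightarrow> H y * (BD * I t))"
            using \<open>BD \<ge> 0\<close> by (simp add: yt abs_mult mult_ac)
        qed
      qed
    qed
    also have "\<dots> = (\<integral>y. H y * \<phi> (y - z) - H y * \<phi> y \<partial>lborel)"
    proof (rule Bochner_Integration.integral_cong)
      fix y
      have "(\<integral>t. - D (y - t *\<^sub>R z) * indicator {0..1} t \<partial>lborel) = \<phi> (y - 1 *\<^sub>R z) - \<phi> (y - 0 *\<^sub>R z)"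
      proof (rule integral_FTC_Icc_real)
        show "((\<lambda>t. \<phi> (y - t *\<^sub>R z)) has_real_derivative - D (y - t *\<^sub>R z)) (at t)" for t
        proof -
          have lin: "frechet_derivative \<phi> (at x) (s *\<^sub>R z) = s * D x" for s x
            unfolding D_def by (rule test_fun_derivative_scaleR[OF \<phi>])
          have "((\<lambda>t. \<phi> (y - t *\<^sub>R z)) has_derivative (\<lambda>s. frechet_derivative \<phi> (at (y - t *\<^sub>R z)) ((- s) *\<^sub>R z))) (at t)"
            by (rule has_derivative_compose[where g=\<phi> and f="\<lambda>t. y - t *\<^sub>R z", OF _ test_fun_has_derivative[OF \<phi>]])
               (auto intro!: derivative_eq_intros)
          then show ?thesis unfolding has_field_derivative_def
            by (rule has_derivative_eq_rhs) (auto simp: lin fun_eq_iff simp del: scaleR_minus_left)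
        qed
        show "isCont (\<lambda>t. - D (y - t *\<^sub>R z)) t" for t
        proof -
          have "isCont D (y - t *\<^sub>R z)" using contD[of UNIV] by (simp add: continuous_on_eq_continuous_at)
          then show ?thesis by (intro continuous_intros isCont_o2[where g=D and f="\<lambda>t. y - t *\<^sub>R z"]) auto
        qed
      qed auto
      then have *: "(\<integral>t. D (y - t *\<^sub>R z) * I t \<partial>lborel) = \<phi> y - \<phi> (y - z)" by (simp add: I_def)
      have "(\<integral>t. - (I t * (H y * D (y - t *\<^sub>R z))) \<partial>lborel) = (\<integral>t. - H y * (D (y - t *\<^sub>R z) * I t) \<partial>lborel)"
        by (simp add: mult_ac)
      also have "\<dots> = - H y * (\<phi> y - \<phi> (y - z))" using * by simp
      finally show "(\<integral>t. - (I t * (H y * D (y - t *\<^sub>R z))) \<partial>lborel) = H y * \<phi> (y - z) - H y * \<phi> y"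
        by (simp add: algebra_simps)
    qed simp
    also have "\<dots> = (\<integral>y. H y * \<phi> (y - z) \<partial>lborel) - (\<integral>y. H y * \<phi> y \<partial>lborel)"
      by (intro Bochner_Integration.integral_diff iH\<phi>[where B=B\<phi>]) (use B\<phi> in auto)
    finally have h3: "(\<integral>x. P x * \<phi> x \<partial>lborel) = (\<integral>y. H y * \<phi> (y - z) \<partial>lborel) - (\<integral>y. H y * \<phi> y \<partial>lborel)" .
    have "integrable lborel (\<lambda>x. h (x + z) * \<phi> x)"
      by (rule integrable_mult_compact_support[OF int(1)[OF K(1,2)] cont\<phi> K(1,3)])
    moreover have "integrable lborel (\<lambda>x. h x * \<phi> x)"
      by (rule integrable_mult_compact_support[OF int(2)[OF K(1,2)] cont\<phi> K(1,3)])
    moreover have "integrable lborel (\<lambda>x. P x * \<phi> x)"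
      by (rule integrable_mult_compact_support[OF int(3)[OF K(1,2)] cont\<phi> K(1,3)])
    ultimately show "(\<integral>x. (h (x + z) - h x - P x) * \<phi> x \<partial>lborel) = 0"
      using h1 h2 h3 by (simp add: left_diff_distrib)
  qed
  then show ?thesis by (simp add: P_def)
qed

section \<open>Borel representatives\<close>

lemma AE_lebesgue_on_iff:
  assumes [measurable]: "\<Omega> \<in> sets borel"
  shows "(AE x in lebesgue_on \<Omega>. P x) \<longleftrightarrow> (AE x in lborel. x \<in> \<Omega> \<longrightarrow> P x)"
  by (subst AE_restrict_space_iff) (auto simp: AE_completion_iff)

text \<open>Integrals over \<open>\<Omega>\<close> with respect to the completed measure become integrals of Borel functions over
  the whole space, where Tonelli's theorem and translation invariance apply directly.\<close>

lemma nn_integral_lebesgue_on_Borel: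
  fixes f :: "'a::euclidean_space \<Rightarrow> ennreal"
  assumes [measurable]: "\<Omega> \<in> sets borel" "f0 \<in> borel_measurable borel" 
    and ae: "AE x in lborel. x \<in> \<Omega> \<longrightarrow> f x = f0 x"
  shows "(\<integral>\<^sup>+x. f x \<partial>lebesgue_on \<Omega>) = (\<integral>\<^sup>+x. indicator \<Omega> x * f0 x \<partial>lborel)"
proof -
  have "(\<integral>\<^sup>+x. f x \<partial>lebesgue_on \<Omega>) = (\<integral>\<^sup>+x. f0 x \<partial>lebesgue_on \<Omega>)"
    by (intro nn_integral_cong_AE) (use ae in \<open>simp add: AE_lebesgue_on_iff\<close>)
  also have "\<dots> = (\<integral>\<^sup>+x. f0 x * indicator \<Omega> x \<partial>lebesgue)"
    by (subst nn_integral_restrict_space) auto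
  also have "\<dots> = (\<integral>\<^sup>+x. indicator \<Omega> x * f0 x \<partial>lborel)"
    by (subst nn_integral_completion) (simp add: mult.commute)
  finally show ?thesis .
qed

lemma borel_representative:
  fixes f :: "'a::euclidean_space \<Rightarrow> real"
  assumes [measurable]: "\<Omega> \<in> sets borel" and f: "f \<in> borel_measurable (lebesgue_on \<Omega>)"
  obtains f0 where "f0 \<in> borel_measurable borel" "AE x in lborel. x \<in> \<Omega> \<longrightarrow> f x = f0 x"
proof -
  have "(\<lambda>x. indicator \<Omega> x *\<^sub>R f x) \<in> borel_measurable lebesgue"
    using f by (subst (asm) borel_measurable_restrict_space_iff) (auto simp: mult.commute)
  then obtain f0 where "f0 \<in> borel_measurable lborel" "AE x in lborel. indicator \<Omega> x *\<^sub>R f x = f0 x"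
    using completion_ex_borel_measurable_real by blast
  then show thesis by (intro that[of f0]) (auto elim!: eventually_mono)
qed

lemma borel_representative_vec:
  fixes f :: "'a::euclidean_space \<Rightarrow> 'b::euclidean_space"
  assumes [measurable]: "\<Omega> \<in> sets borel" and f: "f \<in> borel_measurable (lebesgue_on \<Omega>)"
  obtains f0 where "f0 \<in> borel_measurable borel" "AE x in lborel. x \<in> \<Omega> \<longrightarrow> f x = f0 x"
proof -
  have "\<exists>g. g \<in> borel_measurable borel \<and> (AE x in lborel. x \<in> \<Omega> \<longrightarrow> f x \<bullet> b = g x)" for b
    by (rule borel_representative[OF assms(1), of "\<lambda>x. f x \<bullet> b"]) (use f in auto)
  then obtain g where g: "\<And>b. g b \<in> borel_measurable borel" "\<And>b. AE x in lborel. x \<in> \<Omega> \<longrightarrow> f x \<bullet> b = g b x"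
    by metis
  show thesis
  proof (rule that[of "\<lambda>x. \<Sum>b\<in>Basis. g b x *\<^sub>R b"])
    show "(\<lambda>x. \<Sum>b\<in>Basis. g b x *\<^sub>R b) \<in> borel_measurable borel" using g(1) by auto
    have "AE x in lborel. \<forall>b\<in>Basis. x \<in> \<Omega> \<longrightarrow> f x \<bullet> b = g b x" using g(2) by (subst AE_finite_all) auto
    then show "AE x in lborel. x \<in> \<Omega> \<longrightarrow> f x = (\<Sum>b\<in>Basis. g b x *\<^sub>R b)"
    proof eventually_elim
      case (elim x)
      then show ?case using euclidean_representation[of "f x"] by (auto intro: sum.cong)
    qed
  qed
qed

lemma lebesgue_on_measurable_AE:
  fixes f :: "'a::euclidean_space \<Rightarrow> 'b::euclidean_space"
  assumes [measurable]: "\<Omega> \<in> sets borel" "f0 \<in> borel_measurable borel" 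
    and ae: "AE x in lborel. x \<in> \<Omega> \<longrightarrow> f x = f0 x"
  shows "f \<in> borel_measurable (lebesgue_on \<Omega>)"
proof (subst borel_measurable_restrict_space_iff)
  have "(\<lambda>x. indicator \<Omega> x *\<^sub>R f0 x) \<in> borel_measurable lebesgue" 
    by (intro measurable_completion) auto
  moreover have "AE x in lebesgue. indicator \<Omega> x *\<^sub>R f0 x = indicator \<Omega> x *\<^sub>R f x"
    using ae by (intro AE_completion) (auto elim!: eventually_mono simp: indicator_def)
  ultimately show "(\<lambda>x. indicator \<Omega> x *\<^sub>R f x) \<in> borel_measurable lebesgue"
    by (rule borel_measurable_AE)
qed auto

text \<open>An open set is a countable union of compact boxes, on each of which \<open>f\<close> is integrable.\<close>

lemma loc_integrable_measurable:
  fixes f :: "real ^ 'n \<Rightarrow> 'b::{banach, second_countable_topology}"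
  assumes "open \<Omega>" "loc_integrable \<Omega> f"
  shows "f \<in> borel_measurable (lebesgue_on \<Omega>)"
proof -
  obtain D where D: "countable D" "D \<subseteq> Pow \<Omega>" "\<And>X. X \<in> D \<Longrightarrow> \<exists>a b. X = cbox a b" "\<Union>D = \<Omega>"
    using open_countable_Union_open_cbox[OF assms(1)] by metis
  show ?thesis
  proof (rule measurable_piecewise_restrict[OF D(1)])
    have open_sets: "\<Omega> \<in> sets lebesgue" using assms(1) by simp
    show "space (lebesgue_on \<Omega>) \<subseteq> \<Union>D" using D(4) by simp
    fix X assume X: "X \<in> D"
    then obtain a b where ab: "X = cbox a b" "X \<subseteq> \<Omega>" using D(2,3) by blast
    then show "X \<inter> space (lebesgue_on \<Omega>) \<in> sets (lebesgue_on \<Omega>)"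
      using open_sets by (auto simp: sets_restrict_space_iff Int_absorb2)
    have "restrict_space (lebesgue_on \<Omega>) X = lebesgue_on X"
      using open_sets ab by (subst restrict_restrict_space) (auto simp: Int_absorb1)
    then show "f \<in> borel_measurable (restrict_space (lebesgue_on \<Omega>) X)"
      using assms(2) ab by (auto simp: loc_integrable_def intro: borel_measurable_integrable)
  qed
qed

lemma integral_lebesgue_on_Borel:
  fixes f :: "'a::euclidean_space \<Rightarrow> 'b::euclidean_space"
  assumes [measurable]: "\<Omega> \<in> sets borel" "f0 \<in> borel_measurable borel" 
    and ae: "AE x in lborel. x \<in> \<Omega> \<longrightarrow> f x = f0 x"
  shows "(\<integral>x. f x \<partial>lebesgue_on \<Omega>) = (\<integral>x. indicator \<Omega> x *\<^sub>R f0 x \<partial>lborel)"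
    and "integrable (lebesgue_on \<Omega>) f \<longleftrightarrow> integrable lborel (\<lambda>x. indicator \<Omega> x *\<^sub>R f0 x)"
proof -
  have [measurable]: "f \<in> borel_measurable (lebesgue_on \<Omega>)" by (rule lebesgue_on_measurable_AE[OF assms])
  have [measurable]: "f0 \<in> borel_measurable (lebesgue_on \<Omega>)" by (rule lebesgue_on_measurable_AE[OF assms(1,2)]) simp
  have ae': "AE x in lebesgue_on \<Omega>. f x = f0 x" using ae by (simp add: AE_lebesgue_on_iff)
  show "(\<integral>x. f x \<partial>lebesgue_on \<Omega>) = (\<integral>x. indicator \<Omega> x *\<^sub>R f0 x \<partial>lborel)"
    by (subst integral_cong_AE[OF _ _ ae']) (auto simp: integral_restrict_space integral_completion)
  show "integrable (lebesgue_on \<Omega>) f \<longleftrightarrow> integrable lborel (\<lambda>x. indicator \<Omega> x *\<^sub>R f0 x)"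
    by (subst integrable_cong_AE[OF _ _ ae']) (auto simp: integrable_restrict_space integrable_completion)
qed

text \<open>The partial derivatives add up to the derivative in an arbitrary direction \<open>v\<close>.\<close>

lemma has_weak_gradient_imp_borel:
  fixes \<Omega> :: "(real ^ 'n) set"
  assumes "open \<Omega>" and wg: "has_weak_gradient \<Omega> h G"
    and [measurable]: "h0 \<in> borel_measurable borel" "G0 \<in> borel_measurable borel"
    and ae: "AE x in lborel. x \<in> \<Omega> \<longrightarrow> h x = h0 x" "AE x in lborel. x \<in> \<Omega> \<longrightarrow> G x = G0 x"
  shows "borel_weak_gradient \<Omega> h0 G0"
proof -
  have [measurable]: "\<Omega> \<in> sets borel" using assms(1) by simp
  have int: "integrable lborel (\<lambda>x. indicator K x *\<^sub>R h0 x)" "integrable lborel (\<lambda>x. indicator K x *\<^sub>R G0 x)" 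
    if K: "compact K" "K \<subseteq> \<Omega>" for K
  proof -
    have [measurable]: "K \<in> sets borel" using K by (simp add: compact_imp_closed)
    have "AE x in lborel. x \<in> K \<longrightarrow> h x = h0 x" "AE x in lborel. x \<in> K \<longrightarrow> G x = G0 x"
      using ae K(2) by (auto elim!: eventually_mono[OF ae(1)] eventually_mono[OF ae(2)])
    then show "integrable lborel (\<lambda>x. indicator K x *\<^sub>R h0 x)" "integrable lborel (\<lambda>x. indicator K x *\<^sub>R G0 x)"
      using wg K integral_lebesgue_on_Borel(2)[of K h0 h] integral_lebesgue_on_Borel(2)[of K G0 G]
      unfolding has_weak_gradient_def loc_integrable_def by auto
  qed
  have parts: "(\<integral>x. h0 x * frechet_derivative \<phi> (at x) v \<partial>lborel) = - (\<integral>x. (G0 x \<bullet> v) * \<phi> x \<partial>lborel)"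
    if \<phi>: "test_fun \<Omega> \<phi>" for \<phi> v
  proof -
    obtain K where K: "compact K" "K \<subseteq> \<Omega>" "\<And>x. x \<notin> K \<Longrightarrow> \<phi> x = 0"
      "\<And>x v. x \<notin> K \<Longrightarrow> frechet_derivative \<phi> (at x) v = 0"
      using test_fun_support[OF \<phi>] by metis
    have [measurable]: "\<phi> \<in> borel_measurable borel" "(\<lambda>x. frechet_derivative \<phi> (at x) w) \<in> borel_measurable borel" for w
      using test_fun_continuous[OF \<phi>] by (auto intro: borel_measurable_continuous_onI)
    have axis: "(\<integral>x. h0 x * frechet_derivative \<phi> (at x) (axis i 1) \<partial>lborel) = - (\<integral>x. (G0 x $ i) * \<phi> x \<partial>lborel)" for i
    proof -
      have "(\<integral>x. h x * frechet_derivative \<phi> (at x) (axis i 1) \<partial>lebesgue_on \<Omega>)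
        = (\<integral>x. indicator \<Omega> x *\<^sub>R (h0 x * frechet_derivative \<phi> (at x) (axis i 1)) \<partial>lborel)"
        using ae(1) by (intro integral_lebesgue_on_Borel(1)) (auto elim!: eventually_mono)
      also have "\<dots> = (\<integral>x. h0 x * frechet_derivative \<phi> (at x) (axis i 1) \<partial>lborel)"
        using K by (intro Bochner_Integration.integral_cong) (auto simp: indicator_def)
      finally have 1: "(\<integral>x. h x * frechet_derivative \<phi> (at x) (axis i 1) \<partial>lebesgue_on \<Omega>) = \<dots>" .
      have [measurable]: "(\<lambda>x. G0 x $ i) \<in> borel_measurable borel"
      proof -
        have "(\<lambda>x. G0 x \<bullet> axis i 1) \<in> borel_measurable borel" by simp
        then show ?thesis by (simp add: inner_axis)
      qed
      have "(\<integral>x. G x $ i * \<phi> x \<partial>lebesgue_on \<Omega>) = (\<integral>x. indicator \<Omega> x *\<^sub>R (G0 x $ i * \<phi> x) \<partial>lborel)"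
        using ae(2) by (intro integral_lebesgue_on_Borel(1)) (auto elim!: eventually_mono)
      also have "\<dots> = (\<integral>x. G0 x $ i * \<phi> x \<partial>lborel)"
        using K by (intro Bochner_Integration.integral_cong) (auto simp: indicator_def)
      finally show ?thesis using 1 wg \<phi> unfolding has_weak_gradient_def by simp
    qed
    have D_v: "frechet_derivative \<phi> (at x) v = (\<Sum>i\<in>UNIV. v $ i * frechet_derivative \<phi> (at x) (axis i 1))" for x
    proof -
      have lin: "linear (frechet_derivative \<phi> (at x))" using has_derivative_linear[OF test_fun_has_derivative[OF \<phi>]] .
      have "frechet_derivative \<phi> (at x) v = frechet_derivative \<phi> (at x) (\<Sum>i\<in>UNIV. v $ i *\<^sub>R axis i 1)"
        using basis_expansion[of v] by (simp add: scalar_mult_eq_scaleR)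
      then show ?thesis using lin by (simp add: linear_sum linear_cmul o_def)
    qed
    have iD: "integrable lborel (\<lambda>x. h0 x * frechet_derivative \<phi> (at x) w)" for w
      by (rule integrable_mult_compact_support[OF _ test_fun_continuous(2)[OF \<phi>] K(1)]) (use int(1)[OF K(1,2)] K(4) in simp_all)
    have iG: "integrable lborel (\<lambda>x. G0 x $ i * \<phi> x)" for i
      by (rule integrable_mult_compact_support[OF _ test_fun_continuous(1)[OF \<phi>] K(1,3)])
         (use integrable_inner_left[OF int(2)[OF K(1,2)], of "axis i 1"] in \<open>simp_all add: inner_axis\<close>)
    have "(\<integral>x. h0 x * frechet_derivative \<phi> (at x) v \<partial>lborel) = (\<integral>x. (\<Sum>i\<in>UNIV. v $ i * (h0 x * frechet_derivative \<phi> (at x) (axis i 1))) \<partial>lborel)"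
      by (simp add: D_v sum_distrib_left mult_ac)
    also have "\<dots> = (\<Sum>i\<in>UNIV. v $ i * (\<integral>x. h0 x * frechet_derivative \<phi> (at x) (axis i 1) \<partial>lborel))"
      using iD by (subst Bochner_Integration.integral_sum) auto
    also have "\<dots> = - (\<Sum>i\<in>UNIV. v $ i * (\<integral>x. G0 x $ i * \<phi> x \<partial>lborel))"
      by (simp add: axis sum_negf)
    also have "(\<Sum>i\<in>UNIV. v $ i * (\<integral>x. G0 x $ i * \<phi> x \<partial>lborel)) = (\<integral>x. (\<Sum>i\<in>UNIV. v $ i * (G0 x $ i * \<phi> x)) \<partial>lborel)"
      using iG by (subst Bochner_Integration.integral_sum) auto
    also have "\<dots> = (\<integral>x. (G0 x \<bullet> v) * \<phi> x \<partial>lborel)"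
      by (simp add: inner_vec_def sum_distrib_left mult_ac)
    finally show ?thesis .
  qed
  show ?thesis unfolding borel_weak_gradient_def using int parts by auto
qed

lemma borel_imp_has_weak_gradient:
  fixes \<Omega> :: "(real ^ 'n) set"
  assumes "open \<Omega>" and wg: "borel_weak_gradient \<Omega> h G"
  shows "has_weak_gradient \<Omega> h G"
proof -
  have [measurable]: "\<Omega> \<in> sets borel" using assms(1) by simp
  note [measurable] = borel_weak_gradientD(1,2)[OF wg]
  have "loc_integrable \<Omega> h" "loc_integrable \<Omega> G"
    unfolding loc_integrable_def using wg
    by (auto simp: integral_lebesgue_on_Borel(2)[of _ h h] integral_lebesgue_on_Borel(2)[of _ G G] compact_imp_closed
      borel_weak_gradient_def)
  moreover have "(\<integral>x. h x * frechet_derivative \<phi> (at x) (axis i 1) \<partial>lebesgue_on \<Omega>) = - (\<integral>x. G x $ i * \<phi> x \<partial>lebesgue_on \<Omega>)"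
    if \<phi>: "test_fun \<Omega> \<phi>" for \<phi> i
  proof -
    obtain K where K: "compact K" "K \<subseteq> \<Omega>" "\<And>x. x \<notin> K \<Longrightarrow> \<phi> x = 0"
      "\<And>x v. x \<notin> K \<Longrightarrow> frechet_derivative \<phi> (at x) v = 0"
      using test_fun_support[OF \<phi>] by metis
    have [measurable]: "\<phi> \<in> borel_measurable borel" "(\<lambda>x. frechet_derivative \<phi> (at x) w) \<in> borel_measurable borel" for w
      using test_fun_continuous[OF \<phi>] by (auto intro: borel_measurable_continuous_onI)
    have "(\<integral>x. h x * frechet_derivative \<phi> (at x) (axis i 1) \<partial>lebesgue_on \<Omega>)
        = (\<integral>x. indicator \<Omega> x *\<^sub>R (h x * frechet_derivative \<phi> (at x) (axis i 1)) \<partial>lborel)"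
      by (intro integral_lebesgue_on_Borel(1)) auto
    also have "\<dots> = (\<integral>x. h x * frechet_derivative \<phi> (at x) (axis i 1) \<partial>lborel)"
      using K by (intro Bochner_Integration.integral_cong) (auto simp: indicator_def)
    also have "\<dots> = - (\<integral>x. (G x \<bullet> axis i 1) * \<phi> x \<partial>lborel)" by (rule borel_weak_gradientD(5)[OF wg \<phi>])
    also have "(\<integral>x. (G x \<bullet> axis i 1) * \<phi> x \<partial>lborel) = (\<integral>x. indicator \<Omega> x *\<^sub>R ((G x \<bullet> axis i 1) * \<phi> x) \<partial>lborel)"
      using K by (intro Bochner_Integration.integral_cong) (auto simp: indicator_def)
    also have "\<dots> = (\<integral>x. (G x \<bullet> axis i 1) * \<phi> x \<partial>lebesgue_on \<Omega>)"
      by (rule integral_lebesgue_on_Borel(1)[symmetric]) auto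
    finally show ?thesis by (simp add: inner_axis)
  qed
  ultimately show ?thesis by (auto simp: has_weak_gradient_def)
qed

text \<open>The function \<open>weak_gradient\<close> is an arbitrary choice among weak gradients; uniqueness identifies
  it with any one that is at hand.\<close>

lemma weak_gradient_AE:
  fixes \<Omega> :: "(real ^ 'n) set"
  assumes "open \<Omega>" and wg: "borel_weak_gradient \<Omega> h G"
  shows "AE x in lborel. x \<in> \<Omega> \<longrightarrow> weak_gradient \<Omega> h x = G x"
proof -
  have "\<exists>G. has_weak_gradient \<Omega> h G" using borel_imp_has_weak_gradient[OF assms] by blast
  then have W: "has_weak_gradient \<Omega> h (weak_gradient \<Omega> h)" unfolding weak_gradient_def by (rule someI_ex)
  have [measurable]: "\<Omega> \<in> sets borel" using assms(1) by simp
  have "weak_gradient \<Omega> h \<in> borel_measurable (lebesgue_on \<Omega>)"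
    using W by (intro loc_integrable_measurable assms) (simp add: has_weak_gradient_def)
  then obtain G0 where G0: "G0 \<in> borel_measurable borel" "AE x in lborel. x \<in> \<Omega> \<longrightarrow> weak_gradient \<Omega> h x = G0 x"
    by (rule borel_representative_vec[OF \<open>\<Omega> \<in> sets borel\<close>])
  have "borel_weak_gradient \<Omega> h G0"
    using borel_weak_gradientD(1)[OF wg] by (intro has_weak_gradient_imp_borel[OF assms(1) W _ G0(1) _ G0(2)]) auto
  then have "AE x in lborel. x \<in> \<Omega> \<longrightarrow> G0 x = G x"
    by (rule borel_weak_gradient_unique[OF assms(1) _ wg]) simp
  with G0(2) show ?thesis by eventually_elim simp
qed

text \<open>The \<open>p\<close>-th power of the weighted norm of a Borel representative as an
  extended real; estimates between such integrals carry finiteness along.\<close>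

definition wLp_integral :: "real \<Rightarrow> (real ^ 'n) set \<Rightarrow> real \<Rightarrow> (real ^ 'n \<Rightarrow> 'b::real_normed_vector) \<Rightarrow> ennreal" where
  "wLp_integral p \<Omega> a f = (\<integral>\<^sup>+x. indicator \<Omega> x * ennreal (norm (f x) powr p * bdist \<Omega> x powr a) \<partial>lborel)"

context bounded_open
begin

lemma Lp_integral_weighted:
  fixes f f0 :: "real ^ 'n \<Rightarrow> 'b::euclidean_space"
  assumes p: "1 \<le> p" and [measurable]: "f0 \<in> borel_measurable borel"
    and ae: "AE x in lborel. x \<in> \<Omega> \<longrightarrow> f x = f0 x"
  shows "Lp_integral p \<Omega> (weighted p \<Omega> a f) = wLp_integral p \<Omega> a f0"
proof -
  have "norm (weighted p \<Omega> a g x) powr p = norm (g x) powr p * d x powr a" for g :: "real ^ 'n \<Rightarrow> 'b" and x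
    using p by (simp add: weighted_def powr_mult powr_powr mult.commute)
  then have "AE x in lborel. x \<in> \<Omega> \<longrightarrow>
      ennreal (norm (weighted p \<Omega> a f x) powr p) = ennreal (norm (f0 x) powr p * d x powr a)"
    using ae by (auto elim!: eventually_mono)
  then show ?thesis unfolding Lp_integral_def wLp_integral_def
    by (intro nn_integral_lebesgue_on_Borel) auto
qed

lemma wLp_iff:
  fixes f f0 :: "real ^ 'n \<Rightarrow> 'b::euclidean_space"
  assumes p: "1 \<le> p" and f0: "f0 \<in> borel_measurable borel"
    and ae: "AE x in lborel. x \<in> \<Omega> \<longrightarrow> f x = f0 x"
  shows "f \<in> wLp p \<Omega> a \<longleftrightarrow> wLp_integral p \<Omega> a f0 < \<infinity>"
    and "wLp_norm p \<Omega> a f = enn2real (wLp_integral p \<Omega> a f0) powr (1 / p)"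
  using lebesgue_on_measurable_AE[OF \<Omega>_measurable f0 ae] Lp_integral_weighted[OF assms, of a]
  by (auto simp: wLp_def wLp_norm_def Lp_norm_def)

lemma W1p_intro:
  assumes p: "1 \<le> p" and wg: "borel_weak_gradient \<Omega> h G" 
    and fin: "wLp_integral p \<Omega> a h < \<infinity>" "wLp_integral p \<Omega> b G < \<infinity>"
  shows "h \<in> W1p p \<Omega> a b"
    and "W1p_norm p \<Omega> a b h = enn2real (wLp_integral p \<Omega> a h) powr (1 / p) + enn2real (wLp_integral p \<Omega> b G) powr (1 / p)"
proof -
  note m = borel_weak_gradientD(1,2)[OF wg]
  note ae = weak_gradient_AE[OF open_\<Omega> wg]
  show "h \<in> W1p p \<Omega> a b"
    using fin wLp_iff(1)[OF p m(1), of h a] wLp_iff(1)[OF p m(2) ae, of b] borel_imp_has_weak_gradient[OF open_\<Omega> wg]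
    by (auto simp: W1p_def)
  show "W1p_norm p \<Omega> a b h = enn2real (wLp_integral p \<Omega> a h) powr (1 / p) + enn2real (wLp_integral p \<Omega> b G) powr (1 / p)"
    using wLp_iff(2)[OF p m(1), of h a] wLp_iff(2)[OF p m(2) ae, of b] by (simp add: W1p_norm_def)
qed

text \<open>Functions of the Sobolev space are traded for Borel representatives of the function and of its
  gradient, with the same norm.\<close>

lemma W1p_elim:
  assumes p: "1 \<le> p" and h: "h \<in> W1p p \<Omega> a b"
  obtains h0 G0 where "borel_weak_gradient \<Omega> h0 G0" "AE x in lborel. x \<in> \<Omega> \<longrightarrow> h x = h0 x"
    "wLp_integral p \<Omega> a h0 < \<infinity>" "wLp_integral p \<Omega> b G0 < \<infinity>"
    "W1p_norm p \<Omega> a b h = enn2real (wLp_integral p \<Omega> a h0) powr (1 / p) + enn2real (wLp_integral p \<Omega> b G0) powr (1 / p)"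
proof -
  have W: "has_weak_gradient \<Omega> h (weak_gradient \<Omega> h)"
  proof -
    have "\<exists>G. has_weak_gradient \<Omega> h G" using h by (simp add: W1p_def)
    then show ?thesis unfolding weak_gradient_def by (rule someI_ex)
  qed
  have meas: "h \<in> borel_measurable (lebesgue_on \<Omega>)" "weak_gradient \<Omega> h \<in> borel_measurable (lebesgue_on \<Omega>)"
    using h by (auto simp: W1p_def wLp_def)
  obtain h0 where h0: "h0 \<in> borel_measurable borel" "AE x in lborel. x \<in> \<Omega> \<longrightarrow> h x = h0 x"
    by (rule borel_representative_vec[OF \<Omega>_measurable meas(1)])
  obtain G0 where G0: "G0 \<in> borel_measurable borel" "AE x in lborel. x \<in> \<Omega> \<longrightarrow> weak_gradient \<Omega> h x = G0 x"
    by (rule borel_representative_vec[OF \<Omega>_measurable meas(2)])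
  note m = h0 G0
  have "borel_weak_gradient \<Omega> h0 G0"
    by (rule has_weak_gradient_imp_borel[OF open_\<Omega> W m(1,3,2,4)])
  moreover have "wLp_integral p \<Omega> a h0 < \<infinity>" "wLp_integral p \<Omega> b G0 < \<infinity>"
    using h wLp_iff(1)[OF p m(1,2), of a] wLp_iff(1)[OF p m(3,4), of b] by (auto simp: W1p_def)
  moreover have "W1p_norm p \<Omega> a b h = enn2real (wLp_integral p \<Omega> a h0) powr (1 / p) + enn2real (wLp_integral p \<Omega> b G0) powr (1 / p)"
    using wLp_iff(2)[OF p m(1,2), of a] wLp_iff(2)[OF p m(3,4), of b] by (simp add: W1p_norm_def)
  ultimately show thesis using that m(2) by blast
qed

end

section \<open>The modulus of smoothness and the seminorm on balls\<close>

lemma nn_integral_rotate: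
  fixes F :: "real \<Rightarrow> 'a::euclidean_space \<Rightarrow> 'a \<Rightarrow> ennreal"
  assumes [measurable]: "(\<lambda>(l, x, y). F l x y) \<in> borel_measurable (borel \<Otimes>\<^sub>M (borel \<Otimes>\<^sub>M borel))"
  shows "(\<integral>\<^sup>+l. (\<integral>\<^sup>+x. (\<integral>\<^sup>+y. F l x y \<partial>lborel) \<partial>lborel) \<partial>lborel)
    = (\<integral>\<^sup>+x. (\<integral>\<^sup>+y. (\<integral>\<^sup>+l. F l x y \<partial>lborel) \<partial>lborel) \<partial>lborel)"
proof -
  have [measurable]: "(\<lambda>z. F (snd (fst z)) (fst (fst z)) (snd z)) \<in> borel_measurable ((borel \<Otimes>\<^sub>M borel) \<Otimes>\<^sub>M borel)"
    using measurable_compose[OF _ assms, of "\<lambda>z. (snd (fst z), fst (fst z), snd z)"] by simp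
  have [measurable]: "(\<lambda>z. F (snd z) x (fst z)) \<in> borel_measurable (borel \<Otimes>\<^sub>M borel)" for x
    using measurable_compose[OF _ assms, of "\<lambda>z. (snd z, x, fst z)"] by simp
  have "(\<integral>\<^sup>+l. (\<integral>\<^sup>+x. (\<integral>\<^sup>+y. F l x y \<partial>lborel) \<partial>lborel) \<partial>lborel)
      = (\<integral>\<^sup>+x. (\<integral>\<^sup>+l. (\<integral>\<^sup>+y. F l x y \<partial>lborel) \<partial>lborel) \<partial>lborel)"
    by (rule lborel_pair.Fubini') measurable
  also have "\<dots> = (\<integral>\<^sup>+x. (\<integral>\<^sup>+y. (\<integral>\<^sup>+l. F l x y \<partial>lborel) \<partial>lborel) \<partial>lborel)"
    by (intro nn_integral_cong lborel_pair.Fubini') measurable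
  finally show ?thesis .
qed

lemma nn_integral_cmult2:
  fixes G :: "'a::euclidean_space \<Rightarrow> 'b::euclidean_space \<Rightarrow> ennreal"
  assumes [measurable]: "(\<lambda>(x, y). G x y) \<in> borel_measurable (borel \<Otimes>\<^sub>M borel)"
  shows "(\<integral>\<^sup>+x. (\<integral>\<^sup>+y. c * G x y \<partial>lborel) \<partial>lborel) = c * (\<integral>\<^sup>+x. (\<integral>\<^sup>+y. G x y \<partial>lborel) \<partial>lborel)"
proof -
  have "(\<integral>\<^sup>+y. c * G x y \<partial>lborel) = c * (\<integral>\<^sup>+y. G x y \<partial>lborel)" for x
    by (rule nn_integral_cmult) measurable
  then show ?thesis by (simp add: nn_integral_cmult)
qed

context bounded_open
begin

text \<open>The factor \<open>(l d(x))^(-n)\<close> is up to a constant the inverse volume of the ball of radius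
  \<open>l d(x)\<close>. The cap \<open>1/2\<close> on the radius keeps the ball inside \<open>\<Omega>\<close> and \<open>d\<close> comparable on it.\<close>

definition modulus_kernel :: "real \<Rightarrow> real \<Rightarrow> (real ^ 'n \<Rightarrow> real) \<Rightarrow> real \<Rightarrow> real ^ 'n \<Rightarrow> real ^ 'n \<Rightarrow> ennreal" where
  "modulus_kernel p a f l x y = (if x \<in> \<Omega> \<and> norm (x - y) < min l (1/2) * d x
     then ennreal (d x powr a * (l * d x) powr (- real CARD('n)) * \<bar>f x - f y\<bar> powr p) else 0)"

definition Wt_kernel :: "real \<Rightarrow> real \<Rightarrow> real \<Rightarrow> (real ^ 'n \<Rightarrow> real) \<Rightarrow> real ^ 'n \<Rightarrow> real ^ 'n \<Rightarrow> ennreal" where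
  "Wt_kernel s p b f x y = (if x \<in> \<Omega> \<and> norm (x - y) < d x / 2
     then ennreal (\<bar>f x - f y\<bar> powr p / norm (x - y) powr (real CARD('n) + s * p) * d x powr b) else 0)"

definition Ws_kernel :: "real \<Rightarrow> real \<Rightarrow> real \<Rightarrow> (real ^ 'n \<Rightarrow> real) \<Rightarrow> real ^ 'n \<Rightarrow> real ^ 'n \<Rightarrow> ennreal" where
  "Ws_kernel s p b f x y = (if x \<in> \<Omega> \<and> y \<in> \<Omega>
     then ennreal (\<bar>f x - f y\<bar> powr p / norm (x - y) powr (real CARD('n) + s * p) * bdist2 \<Omega> x y powr b) else 0)"

text \<open>The kernel of the modulus times \<open>l^(-sp-1)\<close>, with all powers of \<open>l\<close> collected.\<close>

definition scale_kernel :: "real \<Rightarrow> real \<Rightarrow> real \<Rightarrow> (real ^ 'n \<Rightarrow> real) \<Rightarrow> real \<Rightarrow> real ^ 'n \<Rightarrow> real ^ 'n \<Rightarrow> ennreal" where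
  "scale_kernel s p a f l x y = (if x \<in> \<Omega> \<and> norm (x - y) < d x / 2 \<and> 0 < l \<and> l \<le> 1 \<and> norm (x - y) < l * d x
     then ennreal (d x powr (a - real CARD('n)) * \<bar>f x - f y\<bar> powr p * l powr (- (s * p + real CARD('n)) - 1)) else 0)"

lemma bdist2_measurable [measurable]:
  "(\<lambda>(x, y). bdist2 \<Omega> x y) \<in> borel_measurable (borel \<Otimes>\<^sub>M borel)"
  "bdist2 \<Omega> x \<in> borel_measurable borel"
  unfolding bdist2_def[abs_def] by measurable

lemma kernel_measurable:
  assumes [measurable]: "f \<in> borel_measurable borel"
  shows "(\<lambda>(x, y). modulus_kernel p a f l x y) \<in> borel_measurable (borel \<Otimes>\<^sub>M borel)"
    and "(\<lambda>(x, y). Wt_kernel s p b f x y) \<in> borel_measurable (borel \<Otimes>\<^sub>M borel)"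
    and "(\<lambda>(x, y). Ws_kernel s p b f x y) \<in> borel_measurable (borel \<Otimes>\<^sub>M borel)"
    and "(\<lambda>(l, x, y). scale_kernel s p a f l x y) \<in> borel_measurable (borel \<Otimes>\<^sub>M (borel \<Otimes>\<^sub>M borel))"
    and "(\<lambda>(x, y). \<integral>\<^sup>+l. scale_kernel s p a f l x y \<partial>lborel) \<in> borel_measurable (borel \<Otimes>\<^sub>M borel)"
  unfolding modulus_kernel_def Wt_kernel_def Ws_kernel_def scale_kernel_def by measurable

definition modulus :: "real \<Rightarrow> real \<Rightarrow> (real ^ 'n \<Rightarrow> real) \<Rightarrow> real \<Rightarrow> ennreal" where
  "modulus p a f l = (\<integral>\<^sup>+x. (\<integral>\<^sup>+y. modulus_kernel p a f l x y \<partial>lborel) \<partial>lborel)"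

definition Wt_lborel :: "real \<Rightarrow> real \<Rightarrow> real \<Rightarrow> (real ^ 'n \<Rightarrow> real) \<Rightarrow> ennreal" where
  "Wt_lborel s p b f = (\<integral>\<^sup>+x. (\<integral>\<^sup>+y. Wt_kernel s p b f x y \<partial>lborel) \<partial>lborel)"

definition Ws_lborel :: "real \<Rightarrow> real \<Rightarrow> real \<Rightarrow> (real ^ 'n \<Rightarrow> real) \<Rightarrow> ennreal" where
  "Ws_lborel s p b f = (\<integral>\<^sup>+x. (\<integral>\<^sup>+y. Ws_kernel s p b f x y \<partial>lborel) \<partial>lborel)"

lemma card_ge_1: "1 \<le> real CARD('n)"
  by (simp add: Suc_leI)

lemma Wt_integral_lborel:
  assumes [measurable]: "f0 \<in> borel_measurable borel"
    and ae: "AE x in lborel. x \<in> \<Omega> \<longrightarrow> f x = f0 x"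
  shows "Wt_integral s p \<Omega> b f = Wt_lborel s p b f0"
proof -
  have inner: "(\<integral>\<^sup>+y. ennreal (\<bar>f x - f y\<bar> powr p / norm (x - y) powr (real CARD('n) + s * p)) \<partial>lebesgue_on (ball x (d x / 2))) * ennreal (d x powr b)
      = (\<integral>\<^sup>+y. Wt_kernel s p b f0 x y \<partial>lborel)"
    if x: "x \<in> \<Omega>" "f x = f0 x" for x
  proof -
    have "ball x (d x / 2) \<subseteq> \<Omega>" using ball_subset[OF x(1)] d_pos[OF x(1)] by (auto simp: dist_norm)
    then have "(\<integral>\<^sup>+y. ennreal (\<bar>f x - f y\<bar> powr p / norm (x - y) powr (real CARD('n) + s * p)) \<partial>lebesgue_on (ball x (d x / 2)))
      = (\<integral>\<^sup>+y. indicator (ball x (d x / 2)) y * ennreal (\<bar>f0 x - f0 y\<bar> powr p / norm (x - y) powr (real CARD('n) + s * p)) \<partial>lborel)"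
      using ae x(2) by (intro nn_integral_lebesgue_on_Borel) (auto elim!: eventually_mono)
    moreover have "(\<lambda>y. indicator (ball x (d x / 2)) y * ennreal (\<bar>f0 x - f0 y\<bar> powr p / norm (x - y) powr (real CARD('n) + s * p))) \<in> borel_measurable lborel"
      by (intro borel_measurable_times_ennreal borel_measurable_indicator) auto
    ultimately have "(\<integral>\<^sup>+y. ennreal (\<bar>f x - f y\<bar> powr p / norm (x - y) powr (real CARD('n) + s * p)) \<partial>lebesgue_on (ball x (d x / 2))) * ennreal (d x powr b)
      = (\<integral>\<^sup>+y. indicator (ball x (d x / 2)) y * ennreal (\<bar>f0 x - f0 y\<bar> powr p / norm (x - y) powr (real CARD('n) + s * p)) * ennreal (d x powr b) \<partial>lborel)"
      by (simp only: nn_integral_multc)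
    also have "\<dots> = (\<integral>\<^sup>+y. Wt_kernel s p b f0 x y \<partial>lborel)"
      using x(1) by (intro nn_integral_cong) (simp add: Wt_kernel_def indicator_def dist_norm ennreal_mult'[symmetric])
    finally show ?thesis .
  qed
  have "Wt_integral s p \<Omega> b f = (\<integral>\<^sup>+x. indicator \<Omega> x * (\<integral>\<^sup>+y. Wt_kernel s p b f0 x y \<partial>lborel) \<partial>lborel)"
    unfolding Wt_integral_def
    by (rule nn_integral_lebesgue_on_Borel)
       (use ae inner kernel_measurable(2)[OF assms(1)] in \<open>auto elim!: eventually_mono intro: lborel.borel_measurable_nn_integral\<close>)
  also have "\<dots> = Wt_lborel s p b f0"
    unfolding Wt_lborel_def Wt_kernel_def by (intro nn_integral_cong) (auto simp: indicator_def)
  finally show ?thesis .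
qed

lemma Ws_integral_lborel:
  assumes [measurable]: "f0 \<in> borel_measurable borel"
    and ae: "AE x in lborel. x \<in> \<Omega> \<longrightarrow> f x = f0 x"
  shows "Ws_integral s p \<Omega> b f = Ws_lborel s p b f0"
proof -
  have inner: "(\<integral>\<^sup>+y. ennreal (\<bar>f x - f y\<bar> powr p / norm (x - y) powr (real CARD('n) + s * p) * bdist2 \<Omega> x y powr b) \<partial>lebesgue_on \<Omega>)
      = (\<integral>\<^sup>+y. indicator \<Omega> y * ennreal (\<bar>f0 x - f0 y\<bar> powr p / norm (x - y) powr (real CARD('n) + s * p) * bdist2 \<Omega> x y powr b) \<partial>lborel)"
    if x: "f x = f0 x" for x
    using ae x by (intro nn_integral_lebesgue_on_Borel) (auto elim!: eventually_mono)
  have "Ws_integral s p \<Omega> b f = (\<integral>\<^sup>+x. indicator \<Omega> x * (\<integral>\<^sup>+y. indicator \<Omega> y * ennreal (\<bar>f0 x - f0 y\<bar> powr p / norm (x - y) powr (real CARD('n) + s * p) * bdist2 \<Omega> x y powr b) \<partial>lborel) \<partial>lborel)"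
    unfolding Ws_integral_def
    by (rule nn_integral_lebesgue_on_Borel) (use ae inner in \<open>auto elim!: eventually_mono\<close>)
  also have "\<dots> = Ws_lborel s p b f0"
    unfolding Ws_lborel_def Ws_kernel_def by (intro nn_integral_cong) (auto simp: indicator_def intro!: nn_integral_cong)
  finally show ?thesis .
qed

definition modulus_average :: "real \<Rightarrow> real \<Rightarrow> real \<Rightarrow> (real ^ 'n \<Rightarrow> real) \<Rightarrow> ennreal" where
  "modulus_average s p a f = (\<integral>\<^sup>+l. (if 0 < l \<and> l \<le> 1 then ennreal (l powr (- s * p - 1)) * modulus p a f l else 0) \<partial>lborel)"

lemma modulus_average_rotated:
  assumes [measurable]: "f \<in> borel_measurable borel"
  shows "modulus_average s p a f = (\<integral>\<^sup>+x. (\<integral>\<^sup>+y. (\<integral>\<^sup>+l.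
     scale_kernel s p a f l x y \<partial>lborel) \<partial>lborel) \<partial>lborel)"
proof -
  have "modulus_average s p a f = (\<integral>\<^sup>+l. (\<integral>\<^sup>+x. (\<integral>\<^sup>+y. 
     scale_kernel s p a f l x y \<partial>lborel) \<partial>lborel) \<partial>lborel)"
    unfolding modulus_average_def
  proof (rule nn_integral_cong)
    fix l :: real
    show "(if 0 < l \<and> l \<le> 1 then ennreal (l powr (- s * p - 1)) * modulus p a f l else 0) = (\<integral>\<^sup>+x. (\<integral>\<^sup>+y. 
     scale_kernel s p a f l x y \<partial>lborel) \<partial>lborel)"
    proof (cases "0 < l \<and> l \<le> 1")
      case True
      have "ennreal (l powr (- s * p - 1)) * modulus p a f l = (\<integral>\<^sup>+x. (\<integral>\<^sup>+y. ennreal (l powr (- s * p - 1)) * modulus_kernel p a f l x y \<partial>lborel) \<partial>lborel)"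
        unfolding modulus_def by (rule nn_integral_cmult2[symmetric, OF kernel_measurable(1)[OF assms]])
      also have "\<dots> = (\<integral>\<^sup>+x. (\<integral>\<^sup>+y. scale_kernel s p a f l x y \<partial>lborel) \<partial>lborel)"
      proof (intro nn_integral_cong)
        fix x y :: "real ^ 'n"
        show "ennreal (l powr (- s * p - 1)) * modulus_kernel p a f l x y
          = scale_kernel s p a f l x y"
        proof (cases "x \<in> \<Omega>")
          case x: True
          have "l powr (- s * p - 1) * (d x powr a * (l * d x) powr (- real CARD('n)) * \<bar>f x - f y\<bar> powr p)
            = d x powr (a - real CARD('n)) * \<bar>f x - f y\<bar> powr p * (l powr (- s * p - 1) * l powr (- real CARD('n)))"
            using True d_pos[OF x] by (simp add: powr_mult powr_diff powr_minus field_simps)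
          also have "l powr (- s * p - 1) * l powr (- real CARD('n)) = l powr (- (s * p + real CARD('n)) - 1)"
            by (simp add: powr_add[symmetric] algebra_simps)
          finally have eq: "l powr (- s * p - 1) * (d x powr a * (l * d x) powr (- real CARD('n)) * \<bar>f x - f y\<bar> powr p)
            = d x powr (a - real CARD('n)) * \<bar>f x - f y\<bar> powr p * l powr (- (s * p + real CARD('n)) - 1)" .
          have "min l (1/2) * d x = min (l * d x) (d x / 2)"
            using d_pos[OF x] by (simp add: min_def)
          then show ?thesis using x True eq by (auto simp: modulus_kernel_def scale_kernel_def ennreal_mult'[symmetric] min_def)
        qed (simp add: modulus_kernel_def scale_kernel_def)
      qed
      finally show ?thesis using True by simp
    next
      case False
      then consider "l \<le> 0" | "1 < l" by linarith
      then show ?thesis by cases (auto simp: scale_kernel_def)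
    qed
  qed
  also have "\<dots> = (\<integral>\<^sup>+x. (\<integral>\<^sup>+y. (\<integral>\<^sup>+l.
     scale_kernel s p a f l x y \<partial>lborel) \<partial>lborel) \<partial>lborel)"
    by (rule nn_integral_rotate[OF kernel_measurable(4)[OF assms]])
  finally show ?thesis .
qed

text \<open>With \<open>r = |x-y|/d(x)\<close> and \<open>q = n + sp\<close> both sides are double integrals of \<open>|f(x) - f(y)|^p\<close>, one
  against \<open>r^(-q)\<close>, the other against the integral of \<open>l^(-q-1)\<close> over \<open>r < l \<le> 1\<close>. The latter is at most
  \<open>r^(-q)/q \<le> r^(-q)\<close>.\<close>

lemma modulus_average_equiv_Wt:
  assumes p: "1 \<le> p" and s: "0 < s" and [measurable]: "f \<in> borel_measurable borel" and b: "b = a + s * p"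
  shows "modulus_average s p a f \<le> Wt_lborel s p b f"
    and "Wt_lborel s p b f \<le> ennreal (2 powr (s * p + real CARD('n) + 1)) * modulus_average s p a f"
proof -
  define q where "q = s * p + real CARD('n)"
  have q: "q \<ge> 1" using s p card_ge_1 by (simp add: q_def add_increasing)
  have scale: "d x powr (a - real CARD('n)) * X * (norm (x - y) / d x) powr (- q) = X / norm (x - y) powr (real CARD('n) + s * p) * d x powr b"
    if "x \<in> \<Omega>" "x \<noteq> y" for x y :: "real ^ 'n" and X
  proof -
    have "(norm (x - y) / d x) powr (- q) = d x powr q / norm (x - y) powr q"
      using d_pos[OF that(1)] by (simp add: powr_divide powr_minus field_simps)
    moreover have "d x powr (a - real CARD('n)) * d x powr q = d x powr b"
      by (simp add: powr_add[symmetric] q_def b)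
    ultimately show ?thesis by (simp add: q_def add.commute mult_ac)
  qed
  have upper: "(\<integral>\<^sup>+l. scale_kernel s p a f l x y \<partial>lborel)
    \<le> Wt_kernel s p b f x y" (is "?L \<le> ?R") for x y
  proof (cases "x \<in> \<Omega> \<and> norm (x - y) < d x / 2 \<and> x \<noteq> y")
    case True
    define r where "r = norm (x - y) / d x"
    define c where "c = d x powr (a - real CARD('n)) * \<bar>f x - f y\<bar> powr p"
    have r: "r > 0" using True d_pos by (simp add: r_def)
    have c: "c \<ge> 0" by (simp add: c_def)
    have "?L \<le> (\<integral>\<^sup>+l. ennreal c * (ennreal (l powr (- q - 1)) * indicator {r..} l) \<partial>lborel)"
    proof (rule nn_integral_mono)
      fix l
      have "norm (x - y) < l * d x \<Longrightarrow> r \<le> l" using True d_pos[of x] by (simp add: r_def field_simps)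
      then show "scale_kernel s p a f l x y
        \<le> ennreal c * (ennreal (l powr (- q - 1)) * indicator {r..} l)"
        using c by (auto simp: scale_kernel_def c_def[symmetric] q_def[symmetric] ennreal_mult)
    qed
    also have "\<dots> = ennreal c * ennreal (r powr (- q) / q)"
      using nn_integral_powr_tail[of q r] q r by (subst nn_integral_cmult) auto
    also have "\<dots> = ennreal (c * r powr (- q) / q)" using c by (simp add: ennreal_mult'[symmetric])
    also have "\<dots> \<le> ennreal (c * r powr (- q))"
    proof (rule ennreal_leI)
      have "c * r powr (- q) * 1 \<le> c * r powr (- q) * q" using q c by (intro mult_left_mono) auto
      then show "c * r powr (- q) / q \<le> c * r powr (- q)" using q by (simp add: field_simps)
    qed
    also have "c * r powr (- q) = \<bar>f x - f y\<bar> powr p / norm (x - y) powr (real CARD('n) + s * p) * d x powr b"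
      unfolding c_def r_def using True by (intro scale) auto
    finally show ?thesis using True by (simp add: Wt_kernel_def)
  next
    case False
    then have "?L = (\<integral>\<^sup>+l. 0 \<partial>(lborel :: real measure))"
      using p by (intro nn_integral_cong) (auto simp: scale_kernel_def)
    then show ?thesis by simp
  qed
  have lower: "Wt_kernel s p b f x y
    \<le> ennreal (2 powr (q + 1)) * (\<integral>\<^sup>+l. scale_kernel s p a f l x y \<partial>lborel)" 
    (is "?L \<le> _ * ?R") for x y
  proof (cases "x \<in> \<Omega> \<and> norm (x - y) < d x / 2 \<and> x \<noteq> y")
    case True
    define r where "r = norm (x - y) / d x"
    define c where "c = d x powr (a - real CARD('n)) * \<bar>f x - f y\<bar> powr p"
    have r: "r > 0" "r < 1/2" using True d_pos[of x] by (simp_all add: r_def field_simps)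
    have c: "c \<ge> 0" by (simp add: c_def)
    \<comment> \<open>the scales between \<open>r\<close> and \<open>2 r\<close> suffice; they are admissible since \<open>r < 1/2\<close>\<close>
    have "ennreal (c * (2 * r) powr (- q - 1)) * ennreal r = (\<integral>\<^sup>+l. ennreal (c * (2 * r) powr (- q - 1)) * indicator {r<..<2 * r} l \<partial>lborel)"
      using r by (subst nn_integral_cmult_indicator) auto
    also have "\<dots> \<le> ?R"
    proof (rule nn_integral_mono)
      fix l
      show "ennreal (c * (2 * r) powr (- q - 1)) * indicator {r<..<2 * r} l \<le> scale_kernel s p a f l x y"
      proof (cases "l \<in> {r<..<2 * r}")
        case l: True
        then have "norm (x - y) < l * d x" using d_pos[of x] True by (simp add: r_def field_simps)
        moreover have "(2 * r) powr (- q - 1) \<le> l powr (- q - 1)"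
          using l r q by (intro powr_mono2') auto
        then have "c * (2 * r) powr (- q - 1) \<le> c * l powr (- q - 1)" using c by (rule mult_left_mono)
        ultimately show ?thesis using True l r by (auto simp: scale_kernel_def c_def[symmetric] q_def[symmetric] intro: ennreal_leI)
      qed simp
    qed
    finally have "ennreal (2 powr (q + 1)) * (ennreal (c * (2 * r) powr (- q - 1)) * ennreal r) \<le> ennreal (2 powr (q + 1)) * ?R"
      by (rule mult_left_mono) simp
    moreover have "ennreal (2 powr (q + 1)) * (ennreal (c * (2 * r) powr (- q - 1)) * ennreal r) = ennreal (c * r powr (- q))"
    proof -
      have "2 powr (q + 1) * (c * (2 * r) powr (- q - 1) * r) = c * (2 powr (q + 1) * 2 powr (- (q + 1))) * (r powr (- q - 1) * r powr 1)"
        using r by (simp add: powr_mult mult_ac) 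
      also have "r powr (- q - 1) * r powr 1 = r powr (- q)" by (simp only: powr_add[symmetric]) simp
      also have "2 powr (q + 1) * 2 powr (- (q + 1)) = (1::real)" by (simp flip: powr_add)
      finally show ?thesis using r c by (simp add: ennreal_mult'[symmetric])
    qed
    moreover have "c * r powr (- q) = \<bar>f x - f y\<bar> powr p / norm (x - y) powr (real CARD('n) + s * p) * d x powr b"
      unfolding c_def r_def using True by (intro scale) auto
    ultimately show ?thesis using True by (simp add: Wt_kernel_def)
  next
    case False
    then show ?thesis using p by (auto simp: Wt_kernel_def)
  qed
  show "modulus_average s p a f \<le> Wt_lborel s p b f"
    unfolding modulus_average_rotated[OF assms(3)] Wt_lborel_def by (intro nn_integral_mono upper)
  have "Wt_lborel s p b f \<le> (\<integral>\<^sup>+x. (\<integral>\<^sup>+y. ennreal (2 powr (q + 1)) * (\<integral>\<^sup>+l. scale_kernel s p a f l x y \<partial>lborel) \<partial>lborel) \<partial>lborel)"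
    unfolding Wt_lborel_def by (intro nn_integral_mono lower)
  also have "\<dots> = ennreal (2 powr (q + 1)) * modulus_average s p a f"
    unfolding modulus_average_rotated[OF assms(3)]
    by (rule nn_integral_cmult2[OF kernel_measurable(5)[OF assms(3)]])
  finally show "Wt_lborel s p b f \<le> ennreal (2 powr (s * p + real CARD('n) + 1)) * modulus_average s p a f"
    by (simp add: q_def)
qed

end

section \<open>The two fractional seminorms\<close>

context bounded_open
begin

lemma d_comparable:
  assumes "norm (x - y) < d x / 2"
  shows "d x \<le> 2 * d y" "d y \<le> 2 * d x"
  using assms d_lipschitz[of x y] by linarith+

text \<open>Near pairs are a subset of all pairs, and for them \<open>d(x)\<close> is at most twice the smaller of the two
  distances.\<close>

lemma Wt_le_Ws:
  assumes [measurable]: "f \<in> borel_measurable borel" and b: "0 \<le> b"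
  shows "Wt_lborel s p b f \<le> ennreal (2 powr b) * Ws_lborel s p b f"
proof -
  have "Wt_lborel s p b f \<le> (\<integral>\<^sup>+x. (\<integral>\<^sup>+y. ennreal (2 powr b) * Ws_kernel s p b f x y \<partial>lborel) \<partial>lborel)"
    unfolding Wt_lborel_def
  proof (intro nn_integral_mono)
    fix x y :: "real ^ 'n"
    show "Wt_kernel s p b f x y
     \<le> ennreal (2 powr b) * Ws_kernel s p b f x y"
    proof (cases "x \<in> \<Omega> \<and> norm (x - y) < d x / 2")
      case True
      then have y: "y \<in> \<Omega>" using mem_\<Omega>[of x y] d_pos[of x] by auto
      have "d x \<le> 2 * bdist2 \<Omega> x y"
        using d_comparable[of x y] d_nonneg[of x] True by (auto simp: bdist2_def)
      then have "d x powr b \<le> (2 * bdist2 \<Omega> x y) powr b"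
        using b d_nonneg by (intro powr_mono2) auto
      also have "\<dots> = 2 powr b * bdist2 \<Omega> x y powr b"
        by (simp add: powr_mult)
      finally have "\<bar>f x - f y\<bar> powr p / norm (x - y) powr (real CARD('n) + s * p) * d x powr b
        \<le> \<bar>f x - f y\<bar> powr p / norm (x - y) powr (real CARD('n) + s * p) * (2 powr b * bdist2 \<Omega> x y powr b)"
        by (intro mult_left_mono) auto
      then show ?thesis using True y by (simp add: Wt_kernel_def Ws_kernel_def ennreal_mult'[symmetric] ennreal_leI mult_ac)
    qed (auto simp: Wt_kernel_def)
  qed
  also have "\<dots> = ennreal (2 powr b) * Ws_lborel s p b f"
    unfolding Ws_lborel_def by (rule nn_integral_cmult2[OF kernel_measurable(3)[OF assms(1)]])
  finally show ?thesis .
qed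

text \<open>Pairs that are close relative to one of the two distances appear in the ball seminorm, up to an
  exchange of \<open>x\<close> and \<open>y\<close>. For the remaining pairs \<open>f(x)\<close> and \<open>f(y)\<close> are estimated separately: the kernel is integrable
  over \<open>|x-y| \<ge> d(x)/2\<close>, with integral of order \<open>d(x)^(-sp)\<close>.\<close>

lemma Ws_le_Wt:
  assumes [measurable]: "f \<in> borel_measurable borel" and p: "1 \<le> p" and s: "0 < s" and a: "0 \<le> a" and b: "b = a + s * p"
  shows "Ws_lborel s p b f \<le> 2 * Wt_lborel s p b f
    + ennreal (2 * 2 powr (p + s * p) * ((real CARD('n) + s * p) * unit_ball_vol (real CARD('n)) / (s * p))) * wLp_integral p \<Omega> a f"
proof -
  define V where "V = (real CARD('n) + s * p) * unit_ball_vol (real CARD('n)) / (s * p)"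
  have sp: "s * p > 0" using s p by simp
  have V: "V \<ge> 0" using sp by (auto simp: V_def intro!: divide_nonneg_pos mult_nonneg_nonneg)
  have b0: "b \<ge> 0" using a b sp by simp
  \<comment> \<open>\<open>A\<close> is for near pairs; \<open>B\<close> is for far pairs and involves \<open>f\<close> at one point only\<close>
  define A where "A = Wt_kernel s p b f"
  define B where "B = (\<lambda>x y. if x \<in> \<Omega> \<and> d x / 2 \<le> norm (x - y)
     then ennreal (2 powr p * \<bar>f x\<bar> powr p * d x powr b * norm (x - y) powr (- (real CARD('n) + s * p))) else 0)"
  have [measurable]: "(\<lambda>(x, y). A x y) \<in> borel_measurable (borel \<Otimes>\<^sub>M borel)" "(\<lambda>(x, y). B x y) \<in> borel_measurable (borel \<Otimes>\<^sub>M borel)"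
    "(\<lambda>(x, y). A y x) \<in> borel_measurable (borel \<Otimes>\<^sub>M borel)" "(\<lambda>(x, y). B y x) \<in> borel_measurable (borel \<Otimes>\<^sub>M borel)"
    unfolding A_def B_def Wt_kernel_def by measurable
  have split: "Ws_kernel s p b f x y
     \<le> (A x y + A y x) + (B x y + B y x)" for x y
  proof (cases "x \<in> \<Omega> \<and> y \<in> \<Omega>")
    case True
    have bd: "bdist2 \<Omega> x y powr b \<le> d x powr b" "bdist2 \<Omega> x y powr b \<le> d y powr b"
      using b0 d_nonneg by (auto simp: bdist2_def intro!: powr_mono2)
    define X where "X = \<bar>f x - f y\<bar> powr p / norm (x - y) powr (real CARD('n) + s * p)"
    have X: "X \<ge> 0" by (simp add: X_def)
    have X': "X = \<bar>f y - f x\<bar> powr p / norm (y - x) powr (real CARD('n) + s * p)"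
      by (simp add: X_def norm_minus_commute abs_minus_commute)
    consider "norm (x - y) < d x / 2" | "norm (y - x) < d y / 2" | "d x / 2 \<le> norm (x - y)" "d y / 2 \<le> norm (y - x)"
      by linarith
    then show ?thesis
    proof cases
      case 1
      then have "ennreal (X * bdist2 \<Omega> x y powr b) \<le> A x y"
        using True X bd(1) by (auto simp: A_def Wt_kernel_def X_def[symmetric] intro!: ennreal_leI mult_left_mono)
      then show ?thesis using True by (auto simp: Ws_kernel_def X_def intro: order_trans add_increasing2)
    next
      case 2
      then have "ennreal (X * bdist2 \<Omega> x y powr b) \<le> A y x"
        using True X bd(2) by (auto simp: A_def Wt_kernel_def X'[symmetric] intro!: ennreal_leI mult_left_mono)
      then show ?thesis using True by (auto simp: Ws_kernel_def X_def intro: order_trans add_increasing2 add_increasing)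
    next
      case 3
      define k where "k = norm (x - y) powr (- (real CARD('n) + s * p))"
      have k: "k \<ge> 0" by (simp add: k_def)
      have "X = \<bar>f x - f y\<bar> powr p * k" 
        unfolding X_def k_def by (simp only: powr_minus divide_inverse)
      also have "\<dots> \<le> 2 powr p * (\<bar>f x\<bar> powr p + \<bar>f y\<bar> powr p) * k"
        using p k by (intro mult_right_mono abs_diff_powr_le) auto
      finally have "X * bdist2 \<Omega> x y powr b \<le> (2 powr p * (\<bar>f x\<bar> powr p + \<bar>f y\<bar> powr p) * k) * bdist2 \<Omega> x y powr b"
        by (rule mult_right_mono) simp
      also have "\<dots> = (2 powr p * \<bar>f x\<bar> powr p * k) * bdist2 \<Omega> x y powr b + (2 powr p * \<bar>f y\<bar> powr p * k) * bdist2 \<Omega> x y powr b"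
        by (simp add: algebra_simps)
      also have "\<dots> \<le> (2 powr p * \<bar>f x\<bar> powr p * k) * d x powr b + (2 powr p * \<bar>f y\<bar> powr p * k) * d y powr b"
        using bd k by (intro add_mono mult_left_mono) auto
      finally have "ennreal (X * bdist2 \<Omega> x y powr b) \<le> ennreal ((2 powr p * \<bar>f x\<bar> powr p * k) * d x powr b + (2 powr p * \<bar>f y\<bar> powr p * k) * d y powr b)"
        by (rule ennreal_leI)
      also have "\<dots> = B x y + B y x"
        using True 3 k by (simp add: B_def k_def norm_minus_commute[of y x] mult_ac)
      finally show ?thesis using True by (auto simp: Ws_kernel_def X_def intro: order_trans add_increasing)
    qed
  qed (auto simp: Ws_kernel_def)
  have intB: "(\<integral>\<^sup>+y. B x y \<partial>lborel) \<le> ennreal (2 powr (p + s * p) * V) * (indicator \<Omega> x * ennreal (norm (f x) powr p * d x powr a))" for x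
  proof (cases "x \<in> \<Omega>")
    case True
    note dx = d_pos[OF True]
    define c where "c = 2 powr p * \<bar>f x\<bar> powr p * d x powr b"
    have c: "c \<ge> 0" by (simp add: c_def)
    have "(\<integral>\<^sup>+y. B x y \<partial>lborel) = (\<integral>\<^sup>+y. ennreal c * (ennreal (norm (x - y) powr (- (real CARD('n) + s * p))) * indicator {y. d x / 2 \<le> norm (x - y)} y) \<partial>lborel)"
      using True c by (intro nn_integral_cong) (auto simp: B_def c_def[symmetric] ennreal_mult)
    also have "\<dots> = ennreal c * (\<integral>\<^sup>+y. ennreal (norm (x - y) powr (- (real CARD('n) + s * p))) * indicator {y. d x / 2 \<le> norm (x - y)} y \<partial>lborel)"
      by (rule nn_integral_cmult) (simp add: indicator_def of_bool_def)
    also have "\<dots> \<le> ennreal c * ennreal (V * (d x / 2) powr (- (s * p)))"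
      using nn_integral_norm_powr_tail[OF sp, of "d x / 2" x] dx by (intro mult_left_mono) (auto simp: V_def)
    also have "\<dots> = ennreal (2 powr (p + s * p) * V * (\<bar>f x\<bar> powr p * d x powr a))"
    proof -
      have "(d x / 2) powr (- (s * p)) = d x powr (- (s * p)) * 2 powr (s * p)"
        using dx by (simp add: powr_divide powr_minus field_simps)
      moreover have "d x powr b * d x powr (- (s * p)) = d x powr a" by (simp add: powr_add[symmetric] b)
      ultimately have eq: "c * (V * (d x / 2) powr (- (s * p))) = 2 powr (p + s * p) * V * (\<bar>f x\<bar> powr p * d x powr a)"
        by (simp add: c_def powr_add mult_ac)
      have "ennreal c * ennreal (V * (d x / 2) powr (- (s * p))) = ennreal (c * (V * (d x / 2) powr (- (s * p))))"
        using c by (rule ennreal_mult'[symmetric])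
      then show ?thesis by (simp only: eq)
    qed
    also have "\<dots> = ennreal (2 powr (p + s * p) * V) * (indicator \<Omega> x * ennreal (norm (f x) powr p * d x powr a))"
      using True V by (simp add: ennreal_mult)
    finally show ?thesis .
  qed (simp add: B_def)
  have IA: "(\<integral>\<^sup>+x. (\<integral>\<^sup>+y. A x y \<partial>lborel) \<partial>lborel) = Wt_lborel s p b f"
    by (simp add: Wt_lborel_def A_def)
  have IB: "(\<integral>\<^sup>+x. (\<integral>\<^sup>+y. B x y \<partial>lborel) \<partial>lborel) \<le> ennreal (2 powr (p + s * p) * V) * wLp_integral p \<Omega> a f"
  proof -
    have "(\<integral>\<^sup>+x. (\<integral>\<^sup>+y. B x y \<partial>lborel) \<partial>lborel) \<le> (\<integral>\<^sup>+x. ennreal (2 powr (p + s * p) * V) * (indicator \<Omega> x * ennreal (norm (f x) powr p * d x powr a)) \<partial>lborel)"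
      by (intro nn_integral_mono intB)
    also have "\<dots> = ennreal (2 powr (p + s * p) * V) * wLp_integral p \<Omega> a f"
      unfolding wLp_integral_def by (rule nn_integral_cmult) measurable
    finally show ?thesis .
  qed
  have swapA: "(\<integral>\<^sup>+x. (\<integral>\<^sup>+y. A y x \<partial>lborel) \<partial>lborel) = (\<integral>\<^sup>+x. (\<integral>\<^sup>+y. A x y \<partial>lborel) \<partial>lborel)"
    by (rule lborel_pair.Fubini') measurable
  have swapB: "(\<integral>\<^sup>+x. (\<integral>\<^sup>+y. B y x \<partial>lborel) \<partial>lborel) = (\<integral>\<^sup>+x. (\<integral>\<^sup>+y. B x y \<partial>lborel) \<partial>lborel)"
    by (rule lborel_pair.Fubini') measurable
  have "Ws_lborel s p b f \<le> (\<integral>\<^sup>+x. (\<integral>\<^sup>+y. (A x y + A y x) + (B x y + B y x) \<partial>lborel) \<partial>lborel)"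
    unfolding Ws_lborel_def by (intro nn_integral_mono split)
  also have "\<dots> = ((\<integral>\<^sup>+x. (\<integral>\<^sup>+y. A x y \<partial>lborel) \<partial>lborel) + (\<integral>\<^sup>+x. (\<integral>\<^sup>+y. A y x \<partial>lborel) \<partial>lborel))
     + ((\<integral>\<^sup>+x. (\<integral>\<^sup>+y. B x y \<partial>lborel) \<partial>lborel) + (\<integral>\<^sup>+x. (\<integral>\<^sup>+y. B y x \<partial>lborel) \<partial>lborel))"
    by (simp add: nn_integral_add)
  also have "\<dots> \<le> (Wt_lborel s p b f + Wt_lborel s p b f)
     + (ennreal (2 powr (p + s * p) * V) * wLp_integral p \<Omega> a f + ennreal (2 powr (p + s * p) * V) * wLp_integral p \<Omega> a f)"
    unfolding swapA swapB IA by (intro add_mono IB order_refl)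
  also have "\<dots> = 2 * Wt_lborel s p b f + ennreal (2 * 2 powr (p + s * p) * V) * wLp_integral p \<Omega> a f"
    using V by (simp add: mult_2[symmetric] ennreal_mult' mult.assoc)
  finally show ?thesis by (simp add: V_def)
qed

end

section \<open>Bounding the modulus of smoothness\<close>

context bounded_open
begin

lemma powr_comparable:
  fixes u v a m l :: real
  assumes "0 < u" "0 < v" "u \<le> 2 * v" "v \<le> 2 * u" "0 \<le> a" "0 \<le> m" "0 < l"
  shows "u powr a * (l * u) powr (- m) \<le> 2 powr (a + m) * (v powr a * (l * v) powr (- m))"
proof -
  have "u powr a \<le> (2 * v) powr a" using assms by (intro powr_mono2) auto
  moreover have "(l * u) powr (- m) \<le> (l * v / 2) powr (- m)"
    using assms by (intro powr_mono2') auto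
  ultimately have "u powr a * (l * u) powr (- m) \<le> (2 * v) powr a * (l * v / 2) powr (- m)"
    by (intro mult_mono) auto
  also have "\<dots> = 2 powr (a + m) * (v powr a * (l * v) powr (- m))"
    using assms by (simp add: powr_mult powr_divide powr_add powr_minus field_simps)
  finally show ?thesis .
qed

lemma modulus_sum_le:
  assumes p: "1 \<le> p" and l: "0 < l" and [measurable]: "f \<in> borel_measurable borel" "g \<in> borel_measurable borel" "h \<in> borel_measurable borel"
    and ae: "AE x in lborel. x \<in> \<Omega> \<longrightarrow> f x = g x + h x"
  shows "modulus p a f l \<le> ennreal (2 powr p) * (modulus p a g l + modulus p a h l)"
proof -
  note [measurable] = kernel_measurable(1)
  have "modulus p a f l \<le> (\<integral>\<^sup>+x. (\<integral>\<^sup>+y. ennreal (2 powr p) * (modulus_kernel p a g l x y + modulus_kernel p a h l x y) \<partial>lborel) \<partial>lborel)"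
    unfolding modulus_def
  proof (rule nn_integral_mono_AE)
    show "AE x in lborel. (\<integral>\<^sup>+y. modulus_kernel p a f l x y \<partial>lborel)
       \<le> (\<integral>\<^sup>+y. ennreal (2 powr p) * (modulus_kernel p a g l x y + modulus_kernel p a h l x y) \<partial>lborel)"
      using ae
    proof eventually_elim
      case x: (elim x)
      show ?case
      proof (rule nn_integral_mono_AE)
        show "AE y in lborel. modulus_kernel p a f l x y
          \<le> ennreal (2 powr p) * (modulus_kernel p a g l x y + modulus_kernel p a h l x y)"
          using ae
        proof eventually_elim
          case y: (elim y)
          show ?case
          proof (cases "x \<in> \<Omega> \<and> norm (x - y) < min l (1/2) * d x")
            case True
            have "min l (1/2) * d x \<le> 1 * d x" using d_nonneg[of x] by (intro mult_right_mono) auto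
            then have "y \<in> \<Omega>" using True mem_\<Omega>[of x y] by auto
            then have "\<bar>f x - f y\<bar> = \<bar>(g x - g y) - (- (h x - h y))\<bar>" using x y True by simp
            then have "\<bar>f x - f y\<bar> powr p \<le> 2 powr p * (\<bar>g x - g y\<bar> powr p + \<bar>- (h x - h y)\<bar> powr p)"
              using abs_diff_powr_le[of p "g x - g y" "- (h x - h y)"] p by simp
            then have "d x powr a * (l * d x) powr (- real CARD('n)) * \<bar>f x - f y\<bar> powr p
              \<le> d x powr a * (l * d x) powr (- real CARD('n)) * (2 powr p * (\<bar>g x - g y\<bar> powr p + \<bar>- (h x - h y)\<bar> powr p))"
              by (intro mult_left_mono) auto
            also have "\<dots> = 2 powr p * (d x powr a * (l * d x) powr (- real CARD('n)) * \<bar>g x - g y\<bar> powr p + d x powr a * (l * d x) powr (- real CARD('n)) * \<bar>h x - h y\<bar> powr p)"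
              by (simp add: algebra_simps abs_minus_commute)
            finally have "ennreal (d x powr a * (l * d x) powr (- real CARD('n)) * \<bar>f x - f y\<bar> powr p)
              \<le> ennreal (2 powr p * (d x powr a * (l * d x) powr (- real CARD('n)) * \<bar>g x - g y\<bar> powr p + d x powr a * (l * d x) powr (- real CARD('n)) * \<bar>h x - h y\<bar> powr p))"
              by (rule ennreal_leI)
            also have "\<dots> = ennreal (2 powr p) * (modulus_kernel p a g l x y + modulus_kernel p a h l x y)"
              using True by (simp add: modulus_kernel_def ennreal_mult)
            finally show ?thesis using True by (simp add: modulus_kernel_def)
          next
            case False
            then show ?thesis by (auto simp: modulus_kernel_def)
          qed
        qed
      qed
    qed
  qed
  also have "\<dots> = ennreal (2 powr p) * (\<integral>\<^sup>+x. (\<integral>\<^sup>+y. modulus_kernel p a g l x y + modulus_kernel p a h l x y \<partial>lborel) \<partial>lborel)"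
    by (rule nn_integral_cmult2) measurable
  also have "(\<integral>\<^sup>+x. (\<integral>\<^sup>+y. modulus_kernel p a g l x y + modulus_kernel p a h l x y \<partial>lborel) \<partial>lborel) = modulus p a g l + modulus p a h l"
    by (simp add: nn_integral_add modulus_def)
  finally show ?thesis .
qed

text \<open>The contribution of \<open>g(x)\<close> is integrated over the ball, whose volume cancels the normalisation. For
  \<open>g(y)\<close> the order of integration is exchanged; the admissible \<open>x\<close> lie in a ball around \<open>y\<close> of twice
  the relative radius, on which the weight at \<open>x\<close> is comparable to the weight at \<open>y\<close>.\<close>

lemma modulus_le_wLp_integral:
  assumes p: "1 \<le> p" and l: "0 < l" and a: "0 \<le> a" and [measurable]: "g \<in> borel_measurable borel"
  shows "modulus p a g l \<le> ennreal (2 powr p * (1 + 2 powr (a + 2 * real CARD('n))) * unit_ball_vol (real CARD('n))) * wLp_integral p \<Omega> a g"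
proof -
  define n where "n = real CARD('n)"
  define V where "V = unit_ball_vol n"
  have V: "V \<ge> 0" and n: "n \<ge> 0" by (auto simp: V_def n_def)
  define A where "A = (\<lambda>x y. if x \<in> \<Omega> \<and> norm (x - y) < min l (1/2) * d x
     then ennreal (2 powr p * (d x powr a * (l * d x) powr (- n)) * \<bar>g x\<bar> powr p) else 0)"
  define B where "B = (\<lambda>x y. if x \<in> \<Omega> \<and> norm (x - y) < min l (1/2) * d x
     then ennreal (2 powr p * (d x powr a * (l * d x) powr (- n)) * \<bar>g y\<bar> powr p) else 0)"
  have [measurable]: "(\<lambda>(x, y). A x y) \<in> borel_measurable (borel \<Otimes>\<^sub>M borel)" "(\<lambda>(x, y). B x y) \<in> borel_measurable (borel \<Otimes>\<^sub>M borel)"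
    unfolding A_def B_def by measurable
  define W where "W = (\<lambda>x. indicator \<Omega> x * ennreal (norm (g x) powr p * d x powr a))"
  have [measurable]: "W \<in> borel_measurable borel" unfolding W_def by measurable
  have vol: "(l * t) powr (- n) * (V * (c * l * t) powr n) = V * c powr n" if "t > 0" "c > 0" for t c
    using that l by (simp add: powr_mult powr_minus field_simps)
  have min_d: "min l (1/2) * d x \<le> l * d x" "min l (1/2) * d x \<le> d x / 2" for x
    using mult_right_mono[OF min.cobounded1[of l "1/2"] d_nonneg[of x]] mult_right_mono[OF min.cobounded2[of l "1/2"] d_nonneg[of x]] by auto
  have intA: "(\<integral>\<^sup>+y. A x y \<partial>lborel) \<le> ennreal (2 powr p * V) * W x" for x
  proof (cases "x \<in> \<Omega>")
    case True
    note dx = d_pos[OF True]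
    define c where "c = 2 powr p * (d x powr a * (l * d x) powr (- n)) * \<bar>g x\<bar> powr p"
    have c: "c \<ge> 0" by (simp add: c_def)
    have "(\<integral>\<^sup>+y. A x y \<partial>lborel) \<le> (\<integral>\<^sup>+y. ennreal c * indicator (ball x (l * d x)) y \<partial>lborel)"
      using min_d[of x] by (intro nn_integral_mono) (auto simp: A_def c_def dist_norm)
    also have "\<dots> = ennreal c * emeasure lborel (ball x (l * d x))"
      by (rule nn_integral_cmult_indicator) simp
    also have "\<dots> = ennreal (c * (V * (1 * l * d x) powr n))"
      using emeasure_ball_Rn[of "l * d x" x] dx l c by (simp add: V_def n_def ennreal_mult'[symmetric])
    also have "c * (V * (1 * l * d x) powr n) = 2 powr p * (d x powr a * \<bar>g x\<bar> powr p * ((l * d x) powr (- n) * (V * (1 * l * d x) powr n)))"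
      by (simp add: c_def mult_ac)
    also have "\<dots> = 2 powr p * V * (norm (g x) powr p * d x powr a)"
      by (subst vol) (use dx in \<open>simp_all add: mult_ac\<close>)
    also have "ennreal \<dots> = ennreal (2 powr p * V) * W x"
      using True V by (simp add: W_def ennreal_mult)
    finally show ?thesis .
  qed (simp add: A_def)
  have intB: "(\<integral>\<^sup>+x. B x y \<partial>lborel) \<le> ennreal (2 powr p * (2 powr (a + 2 * n) * V)) * W y" for y
  proof (cases "y \<in> \<Omega>")
    case True
    note dy = d_pos[OF True]
    define c where "c = 2 powr p * (2 powr (a + n) * (d y powr a * (l * d y) powr (- n))) * \<bar>g y\<bar> powr p"
    have c: "c \<ge> 0" by (simp add: c_def)
    have "(\<integral>\<^sup>+x. B x y \<partial>lborel) \<le> (\<integral>\<^sup>+x. ennreal c * indicator (ball y (2 * l * d y)) x \<partial>lborel)"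
    proof (rule nn_integral_mono)
      fix x
      show "B x y \<le> ennreal c * indicator (ball y (2 * l * d y)) x"
      proof (cases "x \<in> \<Omega> \<and> norm (x - y) < min l (1/2) * d x")
        case x: True
        then have less: "norm (x - y) < l * d x" "norm (x - y) < d x / 2" using min_d[of x] by linarith+
        note cmp = d_comparable[OF less(2)]
        have "l * d x \<le> l * (2 * d y)" using cmp l by (intro mult_left_mono) auto
        then have "x \<in> ball y (2 * l * d y)" using less by (simp add: dist_norm norm_minus_commute mult_ac)
        moreover have "d x powr a * (l * d x) powr (- n) \<le> 2 powr (a + n) * (d y powr a * (l * d y) powr (- n))"
          using cmp x d_pos dy a n l by (intro powr_comparable) auto
        then have "2 powr p * (d x powr a * (l * d x) powr (- n)) * \<bar>g y\<bar> powr p \<le> c"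
          unfolding c_def by (intro mult_right_mono mult_left_mono) auto
        ultimately show ?thesis using x by (simp add: B_def ennreal_leI)
      qed (auto simp: B_def)
    qed
    also have "\<dots> = ennreal c * emeasure lborel (ball y (2 * l * d y))"
      by (rule nn_integral_cmult_indicator) simp
    also have "\<dots> = ennreal (c * (V * (2 * l * d y) powr n))"
      using emeasure_ball_Rn[of "2 * l * d y" y] dy l c by (simp add: V_def n_def ennreal_mult'[symmetric])
    also have "c * (V * (2 * l * d y) powr n) = 2 powr p * 2 powr (a + n) * (d y powr a * \<bar>g y\<bar> powr p * ((l * d y) powr (- n) * (V * (2 * l * d y) powr n)))"
      by (simp add: c_def mult_ac)
    also have "\<dots> = 2 powr p * ((2 powr (a + n) * 2 powr n) * V) * (norm (g y) powr p * d y powr a)"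
      by (subst vol) (use dy in \<open>simp_all add: mult_ac\<close>)
    also have "2 powr (a + n) * 2 powr n = 2 powr (a + 2 * n)" by (simp add: powr_add[symmetric] add.commute)
    also have "ennreal (2 powr p * (2 powr (a + 2 * n) * V) * (norm (g y) powr p * d y powr a)) = ennreal (2 powr p * (2 powr (a + 2 * n) * V)) * W y"
      using True V by (simp add: W_def ennreal_mult)
    finally show ?thesis .
  next
    case False
    have "B x y = 0" for x
    proof (cases "x \<in> \<Omega> \<and> norm (x - y) < min l (1/2) * d x")
      case True
      then have "norm (x - y) < d x" using min_d(2)[of x] d_pos[of x] by linarith
      then show ?thesis using mem_\<Omega>[of x y] True False by auto
    qed (auto simp: B_def)
    then show ?thesis by simp
  qed
  have "modulus p a g l \<le> (\<integral>\<^sup>+x. (\<integral>\<^sup>+y. A x y + B x y \<partial>lborel) \<partial>lborel)"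
    unfolding modulus_def
  proof (intro nn_integral_mono)
    fix x y :: "real ^ 'n"
    have "d x powr a * (l * d x) powr (- n) * \<bar>g x - g y\<bar> powr p \<le> d x powr a * (l * d x) powr (- n) * (2 powr p * (\<bar>g x\<bar> powr p + \<bar>g y\<bar> powr p))"
      using p by (intro mult_left_mono abs_diff_powr_le) auto
    then have "ennreal (d x powr a * (l * d x) powr (- n) * \<bar>g x - g y\<bar> powr p)
      \<le> ennreal (2 powr p * (d x powr a * (l * d x) powr (- n)) * \<bar>g x\<bar> powr p + 2 powr p * (d x powr a * (l * d x) powr (- n)) * \<bar>g y\<bar> powr p)"
      by (intro ennreal_leI) (simp add: algebra_simps)
    then show "modulus_kernel p a g l x y \<le> A x y + B x y"
      by (simp add: A_def B_def n_def modulus_kernel_def)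
  qed
  also have "\<dots> = (\<integral>\<^sup>+x. (\<integral>\<^sup>+y. A x y \<partial>lborel) \<partial>lborel) + (\<integral>\<^sup>+x. (\<integral>\<^sup>+y. B x y \<partial>lborel) \<partial>lborel)"
    by (simp add: nn_integral_add)
  also have "(\<integral>\<^sup>+x. (\<integral>\<^sup>+y. B x y \<partial>lborel) \<partial>lborel) = (\<integral>\<^sup>+y. (\<integral>\<^sup>+x. B x y \<partial>lborel) \<partial>lborel)"
    by (rule lborel_pair.Fubini') measurable
  also have "(\<integral>\<^sup>+x. (\<integral>\<^sup>+y. A x y \<partial>lborel) \<partial>lborel) + (\<integral>\<^sup>+y. (\<integral>\<^sup>+x. B x y \<partial>lborel) \<partial>lborel)
    \<le> (\<integral>\<^sup>+x. ennreal (2 powr p * V) * W x \<partial>lborel) + (\<integral>\<^sup>+y. ennreal (2 powr p * (2 powr (a + 2 * n) * V)) * W y \<partial>lborel)"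
    by (intro add_mono nn_integral_mono intA intB)
  also have "\<dots> = ennreal (2 powr p * V) * wLp_integral p \<Omega> a g + ennreal (2 powr p * (2 powr (a + 2 * n) * V)) * wLp_integral p \<Omega> a g"
    by (simp add: nn_integral_cmult wLp_integral_def W_def)
  also have "\<dots> = ennreal (2 powr p * V + 2 powr p * (2 powr (a + 2 * n) * V)) * wLp_integral p \<Omega> a g"
    using V by (simp add: distrib_right)
  finally show ?thesis by (simp add: V_def n_def algebra_simps)
qed

text \<open>For \<open>|z| < d(x)/2\<close> the segment from \<open>x\<close> to \<open>x + z\<close> stays in \<open>\<Omega>\<close>. These \<open>x\<close> form an
  open set, to which the line formula applies; then Jensen's inequality on the unit interval.\<close>

lemma line_formula_powr:
  assumes p: "1 \<le> p" and wg: "borel_weak_gradient \<Omega> h G"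
  shows "AE x in lborel. x \<in> \<Omega> \<and> norm z < d x / 2 \<longrightarrow>
    ennreal (\<bar>h x - h (x + z)\<bar> powr p) \<le> (\<integral>\<^sup>+t. indicator {0..1} t * ennreal (norm z powr p * norm (G (x + t *\<^sub>R z)) powr p) \<partial>lborel)"
proof -
  note [measurable] = borel_weak_gradientD(1,2)[OF wg]
  define U where "U = {x \<in> \<Omega>. norm z < d x / 2}"
  have "open (\<Omega> \<inter> (\<lambda>x. norm z - d x / 2) -` {..<0})"
    by (intro open_Int open_\<Omega> open_vimage continuous_intros continuous_on_d) auto
  also have "\<Omega> \<inter> (\<lambda>x. norm z - d x / 2) -` {..<0} = U" by (auto simp: U_def)
  finally have U: "open U" .
  have seg: "x + t *\<^sub>R z \<in> \<Omega>" if "x \<in> U" "0 \<le> t" "t \<le> 1" for x t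
  proof -
    have "norm (t *\<^sub>R z) \<le> 1 * norm z" using that by (simp add: mult_left_le_one_le)
    then have "norm (x - (x + t *\<^sub>R z)) < d x" using that d_pos[of x] by (simp add: U_def)
    moreover have "x \<in> \<Omega>" using that by (simp add: U_def)
    ultimately show ?thesis by (intro mem_\<Omega>[of x "x + t *\<^sub>R z"])
  qed
  have "AE x in lborel. x \<in> U \<longrightarrow> h (x + z) - h x = (\<integral>t. indicator {0..1} t * (G (x + t *\<^sub>R z) \<bullet> z) \<partial>lborel)"
    by (rule weak_gradient_line_formula[OF wg U seg])
  then show ?thesis
  proof eventually_elim
    case (elim x)
    show ?case
    proof
      assume x: "x \<in> \<Omega> \<and> norm z < d x / 2"
      have "\<bar>h x - h (x + z)\<bar> = \<bar>\<integral>t. indicator {0..1} t * (G (x + t *\<^sub>R z) \<bullet> z) \<partial>lborel\<bar>"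
        using elim x by (simp add: U_def abs_minus_commute)
      also have "\<dots> \<le> (\<integral>t. indicator {0..1} t * \<bar>G (x + t *\<^sub>R z) \<bullet> z\<bar> \<partial>lborel)"
        using integral_norm_bound[of lborel "\<lambda>t. indicator {0..1} t * (G (x + t *\<^sub>R z) \<bullet> z)"] by (simp add: abs_mult)
      finally have "\<bar>h x - h (x + z)\<bar> powr p \<le> (\<integral>t. indicator {0..1} t * \<bar>G (x + t *\<^sub>R z) \<bullet> z\<bar> \<partial>lborel) powr p"
        using p by (intro powr_mono2) auto
      then have "ennreal (\<bar>h x - h (x + z)\<bar> powr p) \<le> ennreal ((\<integral>t. indicator {0..1} t * \<bar>G (x + t *\<^sub>R z) \<bullet> z\<bar> \<partial>lborel) powr p)"
        by (rule ennreal_leI)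
      also have "\<dots> \<le> ennreal (measure lborel {0..1::real} powr (p - 1)) * (\<integral>\<^sup>+t. indicator {0..1} t * ennreal (\<bar>G (x + t *\<^sub>R z) \<bullet> z\<bar> powr p) \<partial>lborel)"
        by (rule Jensen_powr[OF p]) auto
      also have "\<dots> = (\<integral>\<^sup>+t. indicator {0..1} t * ennreal (\<bar>G (x + t *\<^sub>R z) \<bullet> z\<bar> powr p) \<partial>lborel)" by simp
      also have "\<dots> \<le> (\<integral>\<^sup>+t. indicator {0..1} t * ennreal (norm z powr p * norm (G (x + t *\<^sub>R z)) powr p) \<partial>lborel)"
      proof (intro nn_integral_mono mult_left_mono ennreal_leI)
        fix t
        have "\<bar>G (x + t *\<^sub>R z) \<bullet> z\<bar> powr p \<le> (norm (G (x + t *\<^sub>R z)) * norm z) powr p"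
          using p by (intro powr_mono2 Cauchy_Schwarz_ineq2) auto
        then show "\<bar>G (x + t *\<^sub>R z) \<bullet> z\<bar> powr p \<le> norm z powr p * norm (G (x + t *\<^sub>R z)) powr p"
          by (simp add: powr_mult mult.commute)
      qed simp
      finally show "ennreal (\<bar>h x - h (x + z)\<bar> powr p) \<le> (\<integral>\<^sup>+t. indicator {0..1} t * ennreal (norm z powr p * norm (G (x + t *\<^sub>R z)) powr p) \<partial>lborel)" .
    qed
  qed
qed

text \<open>Put \<open>y = x + z\<close>, use the line formula, and substitute \<open>w = x + t z\<close> for \<open>x\<close>. Since \<open>d(w)\<close> and
  \<open>d(x)\<close> are comparable, the weight may be taken at \<open>w\<close>, after which \<open>t\<close> has disappeared. Integrating
  \<open>|z|^p\<close> over \<open>|z| < 2 l d(w)\<close> yields \<open>l^p d(w)^p\<close> times the volume that cancels the normalisation.\<close>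

lemma modulus_le_gradient:
  assumes p: "1 \<le> p" and l: "0 < l" and a: "0 \<le> a" and wg: "borel_weak_gradient \<Omega> h G"
  shows "modulus p a h l \<le> ennreal (2 powr (a + 2 * real CARD('n) + p) * unit_ball_vol (real CARD('n)) * l powr p) * wLp_integral p \<Omega> (a + p) G"
proof -
  note [measurable] = borel_weak_gradientD(1,2)[OF wg]
  define n where "n = real CARD('n)"
  define V where "V = unit_ball_vol n"
  have V: "V \<ge> 0" and n: "n \<ge> 0" by (auto simp: V_def n_def)
  have min_d: "min l (1/2) * d x \<le> l * d x" "min l (1/2) * d x \<le> d x / 2" for x
    using mult_right_mono[OF min.cobounded1[of l "1/2"] d_nonneg[of x]] mult_right_mono[OF min.cobounded2[of l "1/2"] d_nonneg[of x]] by auto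
  \<comment> \<open>the integrand after moving the weight to the point \<open>w\<close> on the segment; this costs \<open>2 powr (a + n)\<close>\<close>
  define \<Phi> where "\<Phi> = (\<lambda>(z :: real ^ 'n) w. if w \<in> \<Omega> \<and> norm z < 2 * l * d w then ennreal (2 powr (a + n) * (d w powr a * (l * d w) powr (- n)) * (norm z powr p * norm (G w) powr p)) else 0)"
  have \<Phi>_meas [measurable]: "(\<lambda>(z, w). \<Phi> z w) \<in> borel_measurable (borel \<Otimes>\<^sub>M borel)" unfolding \<Phi>_def by measurable
  have \<Phi>_meas2 [measurable]: "\<Phi> z \<in> borel_measurable borel" for z unfolding \<Phi>_def by measurable
  define M where "M = (\<lambda>x z. if x \<in> \<Omega> \<and> norm z < min l (1/2) * d x
     then ennreal (d x powr a * (l * d x) powr (- n) * \<bar>h x - h (x + z)\<bar> powr p) else 0)"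
  have [measurable]: "(\<lambda>(x, z). M x z) \<in> borel_measurable (borel \<Otimes>\<^sub>M borel)" unfolding M_def by measurable
  have "modulus p a h l = (\<integral>\<^sup>+x. (\<integral>\<^sup>+z. M x z \<partial>lborel) \<partial>lborel)"
    unfolding modulus_def
  proof (rule nn_integral_cong)
    fix x :: "real ^ 'n"
    have "(\<integral>\<^sup>+y. modulus_kernel p a h l x y \<partial>lborel) = (\<integral>\<^sup>+z. modulus_kernel p a h l x (x + z) \<partial>lborel)"
      unfolding modulus_kernel_def by (rule nn_integral_lborel_translate[symmetric]) measurable
    then show "(\<integral>\<^sup>+y. modulus_kernel p a h l x y \<partial>lborel) = (\<integral>\<^sup>+z. M x z \<partial>lborel)"
      unfolding M_def n_def modulus_kernel_def by simp
  qed
  also have "\<dots> = (\<integral>\<^sup>+z. (\<integral>\<^sup>+x. M x z \<partial>lborel) \<partial>lborel)"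
    by (rule lborel_pair.Fubini'[symmetric]) measurable
  also have "\<dots> \<le> (\<integral>\<^sup>+z. (\<integral>\<^sup>+w. \<Phi> z w \<partial>lborel) \<partial>lborel)"
  proof (rule nn_integral_mono)
    fix z :: "real ^ 'n"
    have "(\<integral>\<^sup>+x. M x z \<partial>lborel) \<le> (\<integral>\<^sup>+x. (\<integral>\<^sup>+t. indicator {0..1} t * \<Phi> z (x + t *\<^sub>R z) \<partial>lborel) \<partial>lborel)"
    proof (rule nn_integral_mono_AE)
      show "AE x in lborel. M x z \<le> (\<integral>\<^sup>+t. indicator {0..1} t * \<Phi> z (x + t *\<^sub>R z) \<partial>lborel)"
        using line_formula_powr[OF p wg, of z]
      proof eventually_elim
        case (elim x)
        show ?case
        proof (cases "x \<in> \<Omega> \<and> norm z < min l (1/2) * d x")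
          case True
          then have z: "norm z < l * d x" "norm z < d x / 2" using min_d[of x] by linarith+
          define c where "c = d x powr a * (l * d x) powr (- n)"
          have c: "c \<ge> 0" by (simp add: c_def)
          have "M x z = ennreal c * ennreal (\<bar>h x - h (x + z)\<bar> powr p)"
            using True by (simp add: M_def c_def ennreal_mult)
          also have "\<dots> \<le> ennreal c * (\<integral>\<^sup>+t. indicator {0..1} t * ennreal (norm z powr p * norm (G (x + t *\<^sub>R z)) powr p) \<partial>lborel)"
            using elim True z by (intro mult_left_mono) auto
          also have "\<dots> = (\<integral>\<^sup>+t. ennreal c * (indicator {0..1} t * ennreal (norm z powr p * norm (G (x + t *\<^sub>R z)) powr p)) \<partial>lborel)"
            by (rule nn_integral_cmult[symmetric]) measurable
          also have "\<dots> \<le> (\<integral>\<^sup>+t. indicator {0..1} t * \<Phi> z (x + t *\<^sub>R z) \<partial>lborel)"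
          proof (rule nn_integral_mono)
            fix t :: real
            show "ennreal c * (indicator {0..1} t * ennreal (norm z powr p * norm (G (x + t *\<^sub>R z)) powr p)) \<le> indicator {0..1} t * \<Phi> z (x + t *\<^sub>R z)"
            proof (cases "t \<in> {0..1}")
              case t: True
              have "norm (t *\<^sub>R z) \<le> 1 * norm z" using t by (simp add: mult_left_le_one_le)
              then have nt: "norm (x - (x + t *\<^sub>R z)) < d x / 2" using z by simp
              note cmp = d_comparable[OF nt]
              have w: "x + t *\<^sub>R z \<in> \<Omega>" using mem_\<Omega>[of x "x + t *\<^sub>R z"] nt True d_pos[of x] by auto
              have "l * d x \<le> l * (2 * d (x + t *\<^sub>R z))" using cmp l by (intro mult_left_mono) auto
              then have "norm z < 2 * l * d (x + t *\<^sub>R z)" using z by (simp add: mult_ac)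
              moreover have "c \<le> 2 powr (a + n) * (d (x + t *\<^sub>R z) powr a * (l * d (x + t *\<^sub>R z)) powr (- n))"
                unfolding c_def using cmp True w d_pos a n l by (intro powr_comparable) auto
              then have "c * (norm z powr p * norm (G (x + t *\<^sub>R z)) powr p)
                \<le> 2 powr (a + n) * (d (x + t *\<^sub>R z) powr a * (l * d (x + t *\<^sub>R z)) powr (- n)) * (norm z powr p * norm (G (x + t *\<^sub>R z)) powr p)"
                by (intro mult_right_mono) auto
              ultimately show ?thesis using t w c by (simp add: \<Phi>_def ennreal_mult'[symmetric] ennreal_leI)
            qed simp
          qed
          finally show ?thesis .
        qed (auto simp: M_def)
      qed
    qed
    also have "\<dots> = (\<integral>\<^sup>+t. (\<integral>\<^sup>+x. indicator {0..1} t * \<Phi> z (x + t *\<^sub>R z) \<partial>lborel) \<partial>lborel)"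
      by (rule lborel_pair.Fubini'[symmetric]) measurable
    also have "\<dots> = (\<integral>\<^sup>+t. (\<integral>\<^sup>+w. \<Phi> z w \<partial>lborel) * indicator {0..1::real} t \<partial>lborel)"
    proof (rule nn_integral_cong)
      fix t :: real
      have "(\<integral>\<^sup>+x. indicator {0..1} t * \<Phi> z (x + t *\<^sub>R z) \<partial>lborel) = indicator {0..1} t * (\<integral>\<^sup>+x. \<Phi> z (t *\<^sub>R z + x) \<partial>lborel)"
        by (subst nn_integral_cmult) (auto simp: add.commute)
      also have "(\<integral>\<^sup>+x. \<Phi> z (t *\<^sub>R z + x) \<partial>lborel) = (\<integral>\<^sup>+w. \<Phi> z w \<partial>lborel)"
        by (rule nn_integral_lborel_translate) simp
      finally show "(\<integral>\<^sup>+x. indicator {0..1} t * \<Phi> z (x + t *\<^sub>R z) \<partial>lborel) = (\<integral>\<^sup>+w. \<Phi> z w \<partial>lborel) * indicator {0..1} t"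
        by (simp add: mult.commute)
    qed
    also have "\<dots> = (\<integral>\<^sup>+w. \<Phi> z w \<partial>lborel)"
      by (subst nn_integral_cmult_indicator) auto
    finally show "(\<integral>\<^sup>+x. M x z \<partial>lborel) \<le> (\<integral>\<^sup>+w. \<Phi> z w \<partial>lborel)" .
  qed
  also have "\<dots> = (\<integral>\<^sup>+w. (\<integral>\<^sup>+z. \<Phi> z w \<partial>lborel) \<partial>lborel)"
    by (rule lborel_pair.Fubini'[symmetric]) measurable
  also have "\<dots> \<le> (\<integral>\<^sup>+w. ennreal (2 powr (a + 2 * n + p) * V * l powr p) * (indicator \<Omega> w * ennreal (norm (G w) powr p * d w powr (a + p))) \<partial>lborel)"
  proof (rule nn_integral_mono)
    fix w
    show "(\<integral>\<^sup>+z. \<Phi> z w \<partial>lborel) \<le> ennreal (2 powr (a + 2 * n + p) * V * l powr p) * (indicator \<Omega> w * ennreal (norm (G w) powr p * d w powr (a + p)))"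
    proof (cases "w \<in> \<Omega>")
      case True
      note dw = d_pos[OF True]
      define c where "c = 2 powr (a + n) * (d w powr a * (l * d w) powr (- n)) * ((2 * l * d w) powr p * norm (G w) powr p)"
      have c: "c \<ge> 0" by (simp add: c_def)
      have "(\<integral>\<^sup>+z. \<Phi> z w \<partial>lborel) \<le> (\<integral>\<^sup>+z. ennreal c * indicator (ball (0 :: real ^ 'n) (2 * l * d w)) z \<partial>lborel)"
      proof (rule nn_integral_mono)
        fix z :: "real ^ 'n"
        show "\<Phi> z w \<le> ennreal c * indicator (ball (0 :: real ^ 'n) (2 * l * d w)) z"
        proof (cases "norm z < 2 * l * d w")
          case z: True
          then have "norm z powr p \<le> (2 * l * d w) powr p" using p by (intro powr_mono2) auto
          then have "2 powr (a + n) * (d w powr a * (l * d w) powr (- n)) * (norm z powr p * norm (G w) powr p) \<le> c"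
            unfolding c_def by (intro mult_left_mono mult_right_mono) auto
          then show ?thesis using z True by (simp add: \<Phi>_def ennreal_leI)
        qed (auto simp: \<Phi>_def)
      qed
      also have "\<dots> = ennreal c * emeasure lborel (ball (0 :: real ^ 'n) (2 * l * d w))"
        by (rule nn_integral_cmult_indicator) simp
      also have "\<dots> = ennreal (c * (V * (2 * l * d w) powr n))"
        using emeasure_ball_Rn[of "2 * l * d w" "0 :: real ^ 'n"] dw l c by (simp add: V_def n_def ennreal_mult'[symmetric])
      also have "c * (V * (2 * l * d w) powr n) = 2 powr (a + 2 * n + p) * V * l powr p * (norm (G w) powr p * d w powr (a + p))"
        using dw l unfolding c_def by (simp add: powr_mult powr_add powr_minus field_simps flip: powr_add)
      also have "ennreal \<dots> = ennreal (2 powr (a + 2 * n + p) * V * l powr p) * (indicator \<Omega> w * ennreal (norm (G w) powr p * d w powr (a + p)))"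
        using True V by (simp add: ennreal_mult)
      finally show ?thesis .
    qed (simp add: \<Phi>_def)
  qed
  also have "\<dots> = ennreal (2 powr (a + 2 * n + p) * V * l powr p) * wLp_integral p \<Omega> (a + p) G"
    unfolding wLp_integral_def by (rule nn_integral_cmult) measurable
  finally show ?thesis by (simp add: V_def n_def)
qed

end

section \<open>The K-functional from below\<close>

context bounded_open
begin

lemma norms_nonneg: "0 \<le> wLp_norm p \<Omega> a g" "0 \<le> W1p_norm p \<Omega> a b h"
  by (auto simp: wLp_norm_def Lp_norm_def W1p_norm_def)

lemma borel_weak_gradient_zero: "borel_weak_gradient \<Omega> (\<lambda>x. 0) (\<lambda>x. 0)"
  by (simp add: borel_weak_gradient_def)

lemma zero_in_W1p:
  assumes p: "1 \<le> p"
  shows "(\<lambda>x. 0) \<in> W1p p \<Omega> a b" "W1p_norm p \<Omega> a b (\<lambda>x. 0) = 0"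
proof -
  have z: "wLp_integral p \<Omega> c (\<lambda>x. 0 :: 'b::real_normed_vector) = 0" for c
    using p by (simp add: wLp_integral_def)
  show "(\<lambda>x. 0) \<in> W1p p \<Omega> a b" "W1p_norm p \<Omega> a b (\<lambda>x. 0) = 0"
    using W1p_intro[OF p borel_weak_gradient_zero, of a b] p by (simp_all add: z)
qed

lemma K_set_bdd_below:
  assumes "0 \<le> l"
  shows "bdd_below {wLp_norm p \<Omega> a g + l * W1p_norm p \<Omega> a b h | g h.
            g \<in> wLp p \<Omega> a \<and> h \<in> W1p p \<Omega> a b \<and> (AE x in lebesgue_on \<Omega>. f x = g x + h x)}"
  using assms by (intro bdd_belowI[of _ 0]) (auto intro!: add_nonneg_nonneg mult_nonneg_nonneg norms_nonneg)

lemma K_set_nonempty: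
  assumes "1 \<le> p" "f \<in> wLp p \<Omega> a"
  shows "wLp_norm p \<Omega> a f \<in> {wLp_norm p \<Omega> a g + l * W1p_norm p \<Omega> a b h | g h.
            g \<in> wLp p \<Omega> a \<and> h \<in> W1p p \<Omega> a b \<and> (AE x in lebesgue_on \<Omega>. f x = g x + h x)}"
  unfolding mem_Collect_eq using assms zero_in_W1p[OF assms(1), of a b] 
  by (intro exI[of _ f] exI[of _ "\<lambda>x. 0"]) auto

lemma K_le:
  assumes "0 \<le> l" "g \<in> wLp p \<Omega> a" "h \<in> W1p p \<Omega> a b" "AE x in lebesgue_on \<Omega>. f x = g x + h x"
  shows "K_functional p \<Omega> a b l f \<le> wLp_norm p \<Omega> a g + l * W1p_norm p \<Omega> a b h"
  unfolding K_functional_def using assms by (intro cInf_lower K_set_bdd_below) auto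

lemma K_le_norm:
  assumes "1 \<le> p" "0 \<le> l" "f \<in> wLp p \<Omega> a"
  shows "K_functional p \<Omega> a b l f \<le> wLp_norm p \<Omega> a f"
  unfolding K_functional_def using assms by (intro cInf_lower K_set_bdd_below K_set_nonempty) auto

lemma K_nonneg:
  assumes "1 \<le> p" "0 \<le> l" "f \<in> wLp p \<Omega> a"
  shows "0 \<le> K_functional p \<Omega> a b l f"
  unfolding K_functional_def
proof (rule cInf_greatest)
  show "{wLp_norm p \<Omega> a g + l * W1p_norm p \<Omega> a b h | g h.
            g \<in> wLp p \<Omega> a \<and> h \<in> W1p p \<Omega> a b \<and> (AE x in lebesgue_on \<Omega>. f x = g x + h x)} \<noteq> {}"
    using K_set_nonempty[OF assms(1,3), of l b] by blast
qed (use assms(2) in \<open>auto intro!: add_nonneg_nonneg mult_nonneg_nonneg norms_nonneg\<close>)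

lemma K_mono:
  assumes "1 \<le> p" "0 \<le> l" "l \<le> l'" "f \<in> wLp p \<Omega> a"
  shows "K_functional p \<Omega> a b l f \<le> K_functional p \<Omega> a b l' f"
  unfolding K_functional_def[of _ _ _ _ l']
proof (rule cInf_greatest)
  show "{wLp_norm p \<Omega> a g + l' * W1p_norm p \<Omega> a b h | g h.
            g \<in> wLp p \<Omega> a \<and> h \<in> W1p p \<Omega> a b \<and> (AE x in lebesgue_on \<Omega>. f x = g x + h x)} \<noteq> {}"
    using K_set_nonempty[OF assms(1,4), of l' b] by blast
  fix X assume "X \<in> {wLp_norm p \<Omega> a g + l' * W1p_norm p \<Omega> a b h | g h.
            g \<in> wLp p \<Omega> a \<and> h \<in> W1p p \<Omega> a b \<and> (AE x in lebesgue_on \<Omega>. f x = g x + h x)}"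
  then obtain g h where X: "X = wLp_norm p \<Omega> a g + l' * W1p_norm p \<Omega> a b h" and gh: "g \<in> wLp p \<Omega> a" "h \<in> W1p p \<Omega> a b" "AE x in lebesgue_on \<Omega>. f x = g x + h x"
    by blast
  have "K_functional p \<Omega> a b l f \<le> wLp_norm p \<Omega> a g + l * W1p_norm p \<Omega> a b h"
    by (rule K_le[OF assms(2) gh])
  also have "\<dots> \<le> X" unfolding X using assms(3) by (intro add_left_mono mult_right_mono norms_nonneg)
  finally show "K_functional p \<Omega> a b l f \<le> X" .
qed

text \<open>The infimum that defines the K-functional need not be attained; near-optimal decompositions are used
  with error \<open>1/(k+1)\<close>, and the power function is continuous.\<close>

lemma le_K_powrI:
  assumes p: "1 \<le> p" and l: "0 \<le> l" and f: "f \<in> wLp p \<Omega> a"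
    and le: "\<And>g h. g \<in> wLp p \<Omega> a \<Longrightarrow> h \<in> W1p p \<Omega> a b \<Longrightarrow> AE x in lebesgue_on \<Omega>. f x = g x + h x \<Longrightarrow>
      Q \<le> ennreal C * ennreal ((wLp_norm p \<Omega> a g + l * W1p_norm p \<Omega> a b h) powr p)"
  shows "Q \<le> ennreal C * ennreal (K_functional p \<Omega> a b l f powr p)"
proof -
  define K where "K = K_functional p \<Omega> a b l f"
  have K0: "K \<ge> 0" unfolding K_def by (rule K_nonneg[OF p l f])
  define S where "S = {wLp_norm p \<Omega> a g + l * W1p_norm p \<Omega> a b h | g h.
            g \<in> wLp p \<Omega> a \<and> h \<in> W1p p \<Omega> a b \<and> (AE x in lebesgue_on \<Omega>. f x = g x + h x)}"
  have S: "K = Inf S" "S \<noteq> {}"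
    using K_set_nonempty[OF p f, of l b] unfolding S_def by (simp add: K_def K_functional_def, blast)
  have step: "Q \<le> ennreal C * ennreal ((K + inverse (real (Suc k))) powr p)" for k
  proof -
    have "Inf S < K + inverse (real (Suc k))" by (simp add: S)
    then obtain X where X: "X \<in> S" "X < K + inverse (real (Suc k))"
      using cInf_lessD[OF S(2)] by blast
    from X(1) obtain g h where gh: "X = wLp_norm p \<Omega> a g + l * W1p_norm p \<Omega> a b h" "g \<in> wLp p \<Omega> a" "h \<in> W1p p \<Omega> a b" "AE x in lebesgue_on \<Omega>. f x = g x + h x"
      unfolding S_def by blast
    have "Q \<le> ennreal C * ennreal (X powr p)" using le[OF gh(2-4)] gh(1) by simp
    also have "X powr p \<le> (K + inverse (real (Suc k))) powr p"
      using X gh(1) p l by (intro powr_mono2) (auto intro!: add_nonneg_nonneg mult_nonneg_nonneg norms_nonneg)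
    then have "ennreal C * ennreal (X powr p) \<le> ennreal C * ennreal ((K + inverse (real (Suc k))) powr p)"
      by (intro mult_left_mono ennreal_leI) auto
    finally show ?thesis .
  qed
  have "(\<lambda>k. (K + inverse (real (Suc k))) powr p) \<longlonglongrightarrow> (K + 0) powr p"
    using p K0 by (intro tendsto_powr' tendsto_add tendsto_const LIMSEQ_inverse_real_of_nat) (auto intro!: always_eventually)
  then have "(\<lambda>k. ennreal C * ennreal ((K + inverse (real (Suc k))) powr p)) \<longlonglongrightarrow> ennreal C * ennreal (K powr p)"
    by (intro ennreal_tendsto_cmult tendsto_ennrealI) auto
  then show ?thesis unfolding K_def[symmetric]
    by (rule LIMSEQ_le_const) (use step in auto)
qed

lemma wLp_integral_norm_powr:
  assumes p: "1 \<le> p" and fin: "w < \<infinity>"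
  shows "ennreal ((enn2real w powr (1 / p)) powr p) = w"
  using p fin by (simp add: powr_powr)

text \<open>Each of the three norms that occur in the cost of a decomposition is bounded by the whole cost.\<close>

lemma decomposition_bounds:
  assumes p: "1 \<le> p" and l: "0 \<le> l" and f0: "f0 \<in> borel_measurable borel" "AE x in lborel. x \<in> \<Omega> \<longrightarrow> f x = f0 x"
    and gh: "g \<in> wLp p \<Omega> a" "h \<in> W1p p \<Omega> a b" "AE x in lebesgue_on \<Omega>. f x = g x + h x"
  obtains g0 h0 G0 where "g0 \<in> borel_measurable borel" "borel_weak_gradient \<Omega> h0 G0" "AE x in lborel. x \<in> \<Omega> \<longrightarrow> f0 x = g0 x + h0 x"
    "wLp_integral p \<Omega> a g0 \<le> ennreal ((wLp_norm p \<Omega> a g + l * W1p_norm p \<Omega> a b h) powr p)"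
    "ennreal (l powr p) * wLp_integral p \<Omega> a h0 \<le> ennreal ((wLp_norm p \<Omega> a g + l * W1p_norm p \<Omega> a b h) powr p)"
    "ennreal (l powr p) * wLp_integral p \<Omega> b G0 \<le> ennreal ((wLp_norm p \<Omega> a g + l * W1p_norm p \<Omega> a b h) powr p)"
proof -
  define X where "X = wLp_norm p \<Omega> a g + l * W1p_norm p \<Omega> a b h"
  have "g \<in> borel_measurable (lebesgue_on \<Omega>)" using gh(1) by (simp add: wLp_def)
  then obtain g0 where g0: "g0 \<in> borel_measurable borel" "AE x in lborel. x \<in> \<Omega> \<longrightarrow> g x = g0 x"
    by (rule borel_representative[OF \<Omega>_measurable])
  obtain h0 G0 where h0: "borel_weak_gradient \<Omega> h0 G0" "AE x in lborel. x \<in> \<Omega> \<longrightarrow> h x = h0 x"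
    "wLp_integral p \<Omega> a h0 < \<infinity>" "wLp_integral p \<Omega> b G0 < \<infinity>"
    "W1p_norm p \<Omega> a b h = enn2real (wLp_integral p \<Omega> a h0) powr (1 / p) + enn2real (wLp_integral p \<Omega> b G0) powr (1 / p)"
    by (rule W1p_elim[OF p gh(2)])
  have gfin: "wLp_integral p \<Omega> a g0 < \<infinity>" and gn: "wLp_norm p \<Omega> a g = enn2real (wLp_integral p \<Omega> a g0) powr (1 / p)"
    using wLp_iff[OF p g0, of a] gh(1) by auto
  have pw: "wLp_integral p \<Omega> a g0 \<le> ennreal (X powr p)"
  proof -
    have "wLp_integral p \<Omega> a g0 = ennreal ((enn2real (wLp_integral p \<Omega> a g0) powr (1 / p)) powr p)"
      using wLp_integral_norm_powr[OF p gfin] by simp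
    also have "\<dots> \<le> ennreal (X powr p)"
      unfolding X_def gn using p l norms_nonneg(2)[of p a b h] by (intro ennreal_leI powr_mono2) auto
    finally show ?thesis .
  qed
  have pw2: "ennreal (l powr p) * w \<le> ennreal (X powr p)" if w: "w < \<infinity>" "enn2real w powr (1 / p) \<le> W1p_norm p \<Omega> a b h" for w
  proof -
    have "ennreal (l powr p) * w = ennreal (l powr p) * ennreal ((enn2real w powr (1 / p)) powr p)"
      using wLp_integral_norm_powr[OF p w(1)] by simp
    also have "\<dots> = ennreal ((l * enn2real w powr (1 / p)) powr p)"
      using l by (simp add: powr_mult ennreal_mult'[symmetric])
    also have "\<dots> \<le> ennreal (X powr p)"
    proof (intro ennreal_leI powr_mono2)
      have "l * enn2real w powr (1 / p) \<le> l * W1p_norm p \<Omega> a b h" using w(2) l by (rule mult_left_mono)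
      then show "l * enn2real w powr (1 / p) \<le> X" unfolding X_def using norms_nonneg(1)[of p a g] by linarith
    qed (use p l in auto)
    finally show ?thesis .
  qed
  show thesis
  proof (rule that[OF g0(1) h0(1)])
    show "AE x in lborel. x \<in> \<Omega> \<longrightarrow> f0 x = g0 x + h0 x"
      using gh(3)[unfolded AE_lebesgue_on_iff[OF \<Omega>_measurable]] f0(2) g0(2) h0(2) by eventually_elim auto
    show "wLp_integral p \<Omega> a g0 \<le> ennreal ((wLp_norm p \<Omega> a g + l * W1p_norm p \<Omega> a b h) powr p)"
      using pw by (simp add: X_def)
    show "ennreal (l powr p) * wLp_integral p \<Omega> a h0 \<le> ennreal ((wLp_norm p \<Omega> a g + l * W1p_norm p \<Omega> a b h) powr p)"
      using pw2[OF h0(3)] h0(5) by (simp add: X_def)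
    show "ennreal (l powr p) * wLp_integral p \<Omega> b G0 \<le> ennreal ((wLp_norm p \<Omega> a g + l * W1p_norm p \<Omega> a b h) powr p)"
      using pw2[OF h0(4)] h0(5) by (simp add: X_def)
  qed
qed

text \<open>The constants for \<open>g\<close> and for \<open>h\<close> added up; the outer factor comes from splitting \<open>f = g + h\<close>.\<close>

definition modulus_K_const :: "real \<Rightarrow> real \<Rightarrow> real" where
  "modulus_K_const p a = 2 powr p * (2 powr p * (1 + 2 powr (a + 2 * real CARD('n))) * unit_ball_vol (real CARD('n))
    + 2 powr (a + 2 * real CARD('n) + p) * unit_ball_vol (real CARD('n)))"

lemma modulus_le_K:
  assumes p: "1 \<le> p" and l: "0 < l" and a: "0 \<le> a" and f: "f \<in> wLp p \<Omega> a" 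
    and f0: "f0 \<in> borel_measurable borel" "AE x in lborel. x \<in> \<Omega> \<longrightarrow> f x = f0 x"
  shows "modulus p a f0 l \<le> ennreal (modulus_K_const p a) * ennreal (K_functional p \<Omega> a (a + p) l f powr p)"
proof (rule le_K_powrI[OF p _ f])
  show "0 \<le> l" using l by simp
  fix g h assume gh: "g \<in> wLp p \<Omega> a" "h \<in> W1p p \<Omega> a (a + p)" "AE x in lebesgue_on \<Omega>. f x = g x + h x"
  define X where "X = wLp_norm p \<Omega> a g + l * W1p_norm p \<Omega> a (a + p) h"
  obtain g0 h0 G0 where d: "g0 \<in> borel_measurable borel" "borel_weak_gradient \<Omega> h0 G0" "AE x in lborel. x \<in> \<Omega> \<longrightarrow> f0 x = g0 x + h0 x"
    "wLp_integral p \<Omega> a g0 \<le> ennreal ((wLp_norm p \<Omega> a g + l * W1p_norm p \<Omega> a (a + p) h) powr p)"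
    "ennreal (l powr p) * wLp_integral p \<Omega> a h0 \<le> ennreal ((wLp_norm p \<Omega> a g + l * W1p_norm p \<Omega> a (a + p) h) powr p)"
    "ennreal (l powr p) * wLp_integral p \<Omega> (a + p) G0 \<le> ennreal ((wLp_norm p \<Omega> a g + l * W1p_norm p \<Omega> a (a + p) h) powr p)"
    by (rule decomposition_bounds[OF p \<open>0 \<le> l\<close> f0 gh])
  note d = d[folded X_def]
  define C1 where "C1 = 2 powr p * (1 + 2 powr (a + 2 * real CARD('n))) * unit_ball_vol (real CARD('n))"
  define C2 where "C2 = 2 powr (a + 2 * real CARD('n) + p) * unit_ball_vol (real CARD('n))"
  have C: "C1 \<ge> 0" "C2 \<ge> 0" by (auto simp: C1_def C2_def)
  have "modulus p a f0 l \<le> ennreal (2 powr p) * (modulus p a g0 l + modulus p a h0 l)"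
    by (rule modulus_sum_le[OF p l f0(1) d(1) borel_weak_gradientD(1)[OF d(2)] d(3)])
  also have "\<dots> \<le> ennreal (2 powr p) * (ennreal C1 * ennreal (X powr p) + ennreal C2 * ennreal (X powr p))"
  proof (intro mult_left_mono add_mono)
    have "modulus p a g0 l \<le> ennreal C1 * wLp_integral p \<Omega> a g0"
      unfolding C1_def by (rule modulus_le_wLp_integral[OF p l a d(1)])
    also have "\<dots> \<le> ennreal C1 * ennreal (X powr p)" using d(4) by (rule mult_left_mono) simp
    finally show "modulus p a g0 l \<le> ennreal C1 * ennreal (X powr p)" .
    have "modulus p a h0 l \<le> ennreal (C2 * l powr p) * wLp_integral p \<Omega> (a + p) G0"
      unfolding C2_def by (rule modulus_le_gradient[OF p l a d(2)])
    also have "\<dots> = ennreal C2 * (ennreal (l powr p) * wLp_integral p \<Omega> (a + p) G0)"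
      using C by (simp add: ennreal_mult mult.assoc)
    also have "\<dots> \<le> ennreal C2 * ennreal (X powr p)" using d(6) by (rule mult_left_mono) simp
    finally show "modulus p a h0 l \<le> ennreal C2 * ennreal (X powr p)" .
  qed simp
  also have "\<dots> = ennreal (modulus_K_const p a) * ennreal (X powr p)"
    using C unfolding modulus_K_const_def C1_def[symmetric] C2_def[symmetric]
    by (simp add: ennreal_mult'[symmetric] ennreal_plus[symmetric] distrib_left distrib_right mult.assoc del: ennreal_plus)
  finally show "modulus p a f0 l \<le> ennreal (modulus_K_const p a) * ennreal ((wLp_norm p \<Omega> a g + l * W1p_norm p \<Omega> a (a + p) h) powr p)"
    by (simp add: X_def)
qed

lemma wLp_integral_add_le:
  assumes p: "1 \<le> p" and [measurable]: "g \<in> borel_measurable borel" "h \<in> borel_measurable borel"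
    and ae: "AE x in lborel. x \<in> \<Omega> \<longrightarrow> f x = g x + h x"
  shows "wLp_integral p \<Omega> a (f :: real ^ 'n \<Rightarrow> real) \<le> ennreal (2 powr p) * (wLp_integral p \<Omega> a g + wLp_integral p \<Omega> a h)"
proof -
  have "wLp_integral p \<Omega> a f \<le> (\<integral>\<^sup>+x. ennreal (2 powr p) * (indicator \<Omega> x * ennreal (norm (g x) powr p * d x powr a) + indicator \<Omega> x * ennreal (norm (h x) powr p * d x powr a)) \<partial>lborel)"
    unfolding wLp_integral_def
  proof (rule nn_integral_mono_AE)
    show "AE x in lborel. indicator \<Omega> x * ennreal (norm (f x) powr p * d x powr a)
      \<le> ennreal (2 powr p) * (indicator \<Omega> x * ennreal (norm (g x) powr p * d x powr a) + indicator \<Omega> x * ennreal (norm (h x) powr p * d x powr a))"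
      using ae
    proof eventually_elim
      case (elim x)
      show ?case
      proof (cases "x \<in> \<Omega>")
        case True
        have "\<bar>f x\<bar> powr p \<le> 2 powr p * (\<bar>g x\<bar> powr p + \<bar>h x\<bar> powr p)"
          using abs_diff_powr_le[of p "g x" "- h x"] elim True p by simp
        then have "\<bar>f x\<bar> powr p * d x powr a \<le> 2 powr p * (\<bar>g x\<bar> powr p + \<bar>h x\<bar> powr p) * d x powr a"
          by (rule mult_right_mono) simp
        then have "ennreal (\<bar>f x\<bar> powr p * d x powr a) \<le> ennreal (2 powr p * (\<bar>g x\<bar> powr p * d x powr a + \<bar>h x\<bar> powr p * d x powr a))"
          by (intro ennreal_leI) (simp add: algebra_simps)
        also have "\<dots> = ennreal (2 powr p) * (ennreal (\<bar>g x\<bar> powr p * d x powr a) + ennreal (\<bar>h x\<bar> powr p * d x powr a))"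
          by (simp add: ennreal_mult)
        finally show ?thesis using True by simp
      qed simp
    qed
  qed
  also have "\<dots> = ennreal (2 powr p) * (wLp_integral p \<Omega> a g + wLp_integral p \<Omega> a h)"
    unfolding wLp_integral_def by (subst nn_integral_cmult) (simp_all add: nn_integral_add)
  finally show ?thesis .
qed

text \<open>For \<open>l \<ge> 1\<close> the cost of a decomposition \<open>f = g + h\<close> is at least the sum of the norms of \<open>g\<close>
  and \<open>h\<close>.\<close>

lemma wLp_integral_le_K:
  assumes p: "1 \<le> p" and l: "1 \<le> l" and f: "f \<in> wLp p \<Omega> a" 
    and f0: "f0 \<in> borel_measurable borel" "AE x in lborel. x \<in> \<Omega> \<longrightarrow> f x = f0 x"
  shows "wLp_integral p \<Omega> a f0 \<le> ennreal (2 powr p * 2) * ennreal (K_functional p \<Omega> a b l f powr p)"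
proof (rule le_K_powrI[OF p _ f])
  show "0 \<le> l" using l by simp
  fix g h assume gh: "g \<in> wLp p \<Omega> a" "h \<in> W1p p \<Omega> a b" "AE x in lebesgue_on \<Omega>. f x = g x + h x"
  define X where "X = wLp_norm p \<Omega> a g + l * W1p_norm p \<Omega> a b h"
  obtain g0 h0 G0 where d: "g0 \<in> borel_measurable borel" "borel_weak_gradient \<Omega> h0 G0" "AE x in lborel. x \<in> \<Omega> \<longrightarrow> f0 x = g0 x + h0 x"
    "wLp_integral p \<Omega> a g0 \<le> ennreal ((wLp_norm p \<Omega> a g + l * W1p_norm p \<Omega> a b h) powr p)"
    "ennreal (l powr p) * wLp_integral p \<Omega> a h0 \<le> ennreal ((wLp_norm p \<Omega> a g + l * W1p_norm p \<Omega> a b h) powr p)"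
    "ennreal (l powr p) * wLp_integral p \<Omega> b G0 \<le> ennreal ((wLp_norm p \<Omega> a g + l * W1p_norm p \<Omega> a b h) powr p)"
    by (rule decomposition_bounds[OF p \<open>0 \<le> l\<close> f0 gh])
  note d = d[folded X_def]
  have "1 * wLp_integral p \<Omega> a h0 \<le> ennreal (l powr p) * wLp_integral p \<Omega> a h0"
    using l p by (intro mult_right_mono) (simp_all add: ge_one_powr_ge_zero)
  then have h: "wLp_integral p \<Omega> a h0 \<le> ennreal (X powr p)" using d(5) by simp
  have "wLp_integral p \<Omega> a f0 \<le> ennreal (2 powr p) * (wLp_integral p \<Omega> a g0 + wLp_integral p \<Omega> a h0)"
    by (rule wLp_integral_add_le[OF p d(1) borel_weak_gradientD(1)[OF d(2)] d(3)])
  also have "\<dots> \<le> ennreal (2 powr p) * (ennreal (X powr p) + ennreal (X powr p))"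
    by (intro mult_left_mono add_mono d(4) h) simp
  also have "\<dots> = ennreal (2 powr p * 2) * ennreal (X powr p)"
    by (simp add: ennreal_mult'[symmetric] ennreal_plus[symmetric] mult.assoc del: ennreal_plus)
  finally show "wLp_integral p \<Omega> a f0 \<le> ennreal (2 powr p * 2) * ennreal ((wLp_norm p \<Omega> a g + l * W1p_norm p \<Omega> a b h) powr p)"
    by (simp add: X_def)
qed

end

section \<open>Averages at the scale of the distance\<close>

text \<open>The bound on the gradient on a ball makes the difference quotients bounded by \<open>B\<close>, by the mean value
  theorem, so that the limit can be taken under the integral.\<close>

lemma has_derivative_integral_lborel:
  fixes k :: "'a::euclidean_space \<Rightarrow> 'b::euclidean_space \<Rightarrow> real" and g :: "'a \<Rightarrow> 'b \<Rightarrow> 'a"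
  assumes r: "0 < r" 
    and der: "\<And>x y. x \<in> ball x0 r \<Longrightarrow> ((\<lambda>x. k x y) has_derivative (\<lambda>v. g x y \<bullet> v)) (at x)"
    and bnd: "\<And>x y. x \<in> ball x0 r \<Longrightarrow> norm (g x y) \<le> B y"
    and B: "integrable lborel B"
    and k: "\<And>x. x \<in> ball x0 r \<Longrightarrow> integrable lborel (k x)"
    and g: "g x0 \<in> borel_measurable borel"
  shows "((\<lambda>x. \<integral>y. k x y \<partial>lborel) has_derivative (\<lambda>v. (\<integral>y. g x0 y \<partial>lborel) \<bullet> v)) (at x0)"
proof -
  have x0: "x0 \<in> ball x0 r" using r by simp
  have ig: "integrable lborel (g x0)"
    by (rule Bochner_Integration.integrable_bound[OF B])
       (use g order_trans[OF bnd[OF x0] abs_ge_self] in \<open>auto intro!: AE_I2\<close>)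
  have lip: "\<bar>k x y - k x0 y\<bar> \<le> B y * norm (x - x0)" if x: "x \<in> ball x0 r" for x y
  proof -
    have "norm (k x y - k x0 y) \<le> B y * norm (x - x0)"
    proof (rule differentiable_bound[of "ball x0 r" "\<lambda>x. k x y" "\<lambda>x v. g x y \<bullet> v"])
      show "convex (ball x0 r)" by simp
      fix z assume z: "z \<in> ball x0 r"
      show "((\<lambda>x. k x y) has_derivative (\<lambda>v. g z y \<bullet> v)) (at z within ball x0 r)"
        by (rule has_derivative_at_withinI[OF der[OF z]])
      show "onorm (\<lambda>v. g z y \<bullet> v) \<le> B y"
      proof (rule onorm_le)
        fix v
        have "norm (g z y \<bullet> v) \<le> norm (g z y) * norm v" using Cauchy_Schwarz_ineq2[of "g z y" v] by simp
        also have "\<dots> \<le> B y * norm v" using bnd[OF z] by (intro mult_right_mono) auto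
        finally show "norm (g z y \<bullet> v) \<le> B y * norm v" .
      qed
    qed (use x x0 in auto)
    then show ?thesis by simp
  qed
  define q where "q = (\<lambda>x y. (k x y - k x0 y - g x0 y \<bullet> (x - x0)) / norm (x - x0))"
  have q_int: "integrable lborel (q x)" "(\<integral>y. q x y \<partial>lborel) = ((\<integral>y. k x y \<partial>lborel) - (\<integral>y. k x0 y \<partial>lborel) - (\<integral>y. g x0 y \<partial>lborel) \<bullet> (x - x0)) / norm (x - x0)"
    if x: "x \<in> ball x0 r" for x
    using k[OF x] k[OF x0] ig by (auto simp: q_def)
  have q_lim: "((\<lambda>x. q x y) \<longlongrightarrow> 0) (at x0)" for y
  proof -
    have "(\<lambda>x. (1 / norm (x - x0)) *\<^sub>R (k x y - (k x0 y + g x0 y \<bullet> (x - x0)))) = (\<lambda>x. q x y)"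
      by (simp add: q_def fun_eq_iff diff_diff_eq)
    then show ?thesis using der[OF x0, of y] unfolding has_derivative_at2 by simp
  qed
  have q_bnd: "\<bar>q x y\<bar> \<le> 2 * B y" if x: "x \<in> ball x0 r" for x y
  proof (cases "x = x0")
    case True
    have "0 \<le> B y" using bnd[OF x0, of y] norm_ge_zero[of "g x0 y"] by linarith
    then show ?thesis using True by (simp add: q_def)
  next
    case False
    have "\<bar>g x0 y \<bullet> (x - x0)\<bar> \<le> norm (g x0 y) * norm (x - x0)" by (rule Cauchy_Schwarz_ineq2)
    also have "\<dots> \<le> B y * norm (x - x0)" using bnd[OF x0] by (intro mult_right_mono) auto
    finally have "\<bar>k x y - k x0 y - g x0 y \<bullet> (x - x0)\<bar> \<le> 2 * B y * norm (x - x0)"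
      using lip[OF x, of y] by linarith
    then show ?thesis using False by (simp add: q_def field_simps)
  qed
  have "((\<lambda>x. ((\<integral>y. k x y \<partial>lborel) - (\<integral>y. k x0 y \<partial>lborel) - (\<integral>y. g x0 y \<partial>lborel) \<bullet> (x - x0)) / norm (x - x0)) \<longlongrightarrow> 0) (at x0)"
    unfolding tendsto_at_iff_sequentially o_def
  proof (intro allI impI)
    fix X assume X: "\<forall>i. X i \<in> UNIV - {x0}" "X \<longlonglongrightarrow> x0"
    \<comment> \<open>change the terms outside of the ball, finitely many, so that the whole sequence lies in the ball where the bounds hold\<close>
    define Y where "Y = (\<lambda>i. if X i \<in> ball x0 r then X i else x0)"
    have Y: "Y i \<in> ball x0 r" for i using x0 by (simp add: Y_def)
    have ev: "\<forall>\<^sub>F i in sequentially. Y i = X i"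
    proof -
      have "\<forall>\<^sub>F i in sequentially. X i \<in> ball x0 r"
        by (rule topological_tendstoD[OF X(2) open_ball x0])
      then show ?thesis by eventually_elim (simp add: Y_def)
    qed
    have "(\<lambda>i. \<integral>y. q (Y i) y \<partial>lborel) \<longlonglongrightarrow> (\<integral>y. 0 \<partial>(lborel :: 'b measure))"
    proof (rule integral_dominated_convergence[where w="\<lambda>y. 2 * B y"])
      show "integrable lborel (\<lambda>y. 2 * B y)" using B by simp
      show "AE y in lborel. (\<lambda>i. q (Y i) y) \<longlonglongrightarrow> 0"
      proof (rule AE_I2)
        fix y
        have "(\<lambda>i. q (X i) y) \<longlonglongrightarrow> 0"
          using q_lim[of y] X unfolding tendsto_at_iff_sequentially o_def by blast
        then show "(\<lambda>i. q (Y i) y) \<longlonglongrightarrow> 0"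
          by (rule Lim_transform_eventually) (use ev in \<open>auto elim!: eventually_mono\<close>)
      qed
      show "AE y in lborel. norm (q (Y i) y) \<le> 2 * B y" for i using q_bnd[OF Y] by simp
      show "q (Y i) \<in> borel_measurable lborel" for i using q_int(1)[OF Y] by auto
    qed auto
    then have "(\<lambda>i. \<integral>y. q (Y i) y \<partial>lborel) \<longlonglongrightarrow> 0" by simp
    moreover have "\<forall>\<^sub>F i in sequentially. (\<integral>y. q (Y i) y \<partial>lborel)
      = ((\<integral>y. k (X i) y \<partial>lborel) - (\<integral>y. k x0 y \<partial>lborel) - (\<integral>y. g x0 y \<partial>lborel) \<bullet> (X i - x0)) / norm (X i - x0)"
      using ev
    proof eventually_elim
      case (elim i)
      then show ?case using q_int(2)[OF Y[of i]] by simp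
    qed
    ultimately show "(\<lambda>i. ((\<integral>y. k (X i) y \<partial>lborel) - (\<integral>y. k x0 y \<partial>lborel) - (\<integral>y. g x0 y \<partial>lborel) \<bullet> (X i - x0)) / norm (X i - x0)) \<longlonglongrightarrow> 0"
      by (rule Lim_transform_eventually)
  qed
  moreover have "(\<lambda>x. ((\<integral>y. k x y \<partial>lborel) - (\<integral>y. k x0 y \<partial>lborel) - (\<integral>y. g x0 y \<partial>lborel) \<bullet> (x - x0)) / norm (x - x0))
    = (\<lambda>x. (1 / norm (x - x0)) *\<^sub>R ((\<integral>y. k x y \<partial>lborel) - ((\<integral>y. k x0 y \<partial>lborel) + (\<integral>y. g x0 y \<partial>lborel) \<bullet> (x - x0))))"
    by (simp add: fun_eq_iff diff_diff_eq)
  ultimately show ?thesis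
    unfolding has_derivative_at2 using bounded_linear_inner_right by simp
qed

lemma has_real_derivative_pos_part_square: "((\<lambda>u::real. (max 0 u)\<^sup>2) has_real_derivative 2 * max 0 u) (at u)"
proof -
  consider "u > 0" | "u < 0" | "u = 0" by linarith
  then show ?thesis
  proof cases
    case 1
    have "((\<lambda>u. u\<^sup>2) has_real_derivative 2 * max 0 u) (at u)" using 1 by (auto intro!: derivative_eq_intros)
    then show ?thesis by (rule has_field_derivative_transform_within_open[where S="{0<..}"]) (use 1 in auto)
  next
    case 2
    have "((\<lambda>u. 0) has_real_derivative 2 * max 0 u) (at u)" using 2 by simp
    then show ?thesis by (rule has_field_derivative_transform_within_open[where S="{..<0}"]) (use 2 in auto)
  next
    case 3
    have "((\<lambda>h. (max 0 h)\<^sup>2 / h) \<longlongrightarrow> (0::real)) (at 0)"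
    proof (rule Lim_null_comparison)
      show "\<forall>\<^sub>F h in at 0. norm ((max 0 h)\<^sup>2 / h) \<le> \<bar>h::real\<bar>"
        by (intro always_eventually) (auto simp: max_def power2_eq_square)
      show "((\<lambda>h. \<bar>h::real\<bar>) \<longlongrightarrow> 0) (at 0)" by (rule tendsto_rabs_zero[OF tendsto_ident_at])
    qed
    then show ?thesis using 3 by (simp add: DERIV_def)
  qed
qed

lemma norm_integral_le_integral:
  fixes f :: "'a \<Rightarrow> 'b::{banach, second_countable_topology}"
  assumes "integrable M g" "\<And>x. norm (f x) \<le> g x"
  shows "norm (\<integral>x. f x \<partial>M) \<le> (\<integral>x. g x \<partial>M)"
proof (cases "integrable M f")
  case True
  have "norm (\<integral>x. f x \<partial>M) \<le> (\<integral>x. norm (f x) \<partial>M)" by (rule integral_norm_bound)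
  also have "\<dots> \<le> (\<integral>x. g x \<partial>M)" using True assms by (intro integral_mono) auto
  finally show ?thesis .
next
  case False
  then show ?thesis using assms order_trans[OF norm_ge_zero assms(2)] by (simp add: not_integrable_integral_eq integral_nonneg_AE)
qed

context bounded_open
begin

text \<open>The profile \<open>(1 - |z|^2)\<^sub>+^2\<close> is continuously differentiable and has compact support, so that averages with it
  are differentiable. The scale \<open>\<tau> d(y)\<close> depends on the integration variable, so that
  derivatives with respect to \<open>x\<close> never meet the merely Lipschitz function \<open>d\<close>.\<close>

definition bump :: "real \<Rightarrow> real ^ 'n \<Rightarrow> real ^ 'n \<Rightarrow> real" where
  "bump \<tau> x y = (if y \<in> \<Omega> then (max 0 (1 - ((x - y) \<bullet> (x - y)) / (\<tau> * d y)\<^sup>2))\<^sup>2 else 0)"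

definition bump_grad :: "real \<Rightarrow> real ^ 'n \<Rightarrow> real ^ 'n \<Rightarrow> real ^ 'n" where
  "bump_grad \<tau> x y = (if y \<in> \<Omega> then (- 4 * max 0 (1 - ((x - y) \<bullet> (x - y)) / (\<tau> * d y)\<^sup>2) / (\<tau> * d y)\<^sup>2) *\<^sub>R (x - y) else 0)"

lemma bump_measurable [measurable]:
  "(\<lambda>(x, y). bump \<tau> x y) \<in> borel_measurable (borel \<Otimes>\<^sub>M borel)"
  "(\<lambda>(x, y). bump_grad \<tau> x y) \<in> borel_measurable (borel \<Otimes>\<^sub>M borel)"
  "bump \<tau> x \<in> borel_measurable borel"
  "bump_grad \<tau> x \<in> borel_measurable borel"
  unfolding bump_def[abs_def] bump_grad_def[abs_def] by measurable

lemma bump_has_derivative: "((\<lambda>x. bump \<tau> x y) has_derivative (\<lambda>v. bump_grad \<tau> x y \<bullet> v)) (at x)"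
proof (cases "y \<in> \<Omega>")
  case True
  define c where "c = (\<tau> * d y)\<^sup>2"
  define u where "u = 1 - ((x - y) \<bullet> (x - y)) / c"
  have "((\<lambda>x. 1 - ((x - y) \<bullet> (x - y)) / c) has_derivative (\<lambda>v. - (2 * ((x - y) \<bullet> v)) / c)) (at x)"
    by (auto intro!: derivative_eq_intros simp: inner_commute divide_inverse)
  from has_derivative_compose[OF this has_real_derivative_pos_part_square[unfolded has_field_derivative_def]]
  have "((\<lambda>x. (max 0 (1 - ((x - y) \<bullet> (x - y)) / c))\<^sup>2) has_derivative (\<lambda>v. 2 * max 0 u * (- (2 * ((x - y) \<bullet> v)) / c))) (at x)"
    by (simp add: u_def)
  then show ?thesis using True unfolding bump_def bump_grad_def c_def[symmetric] u_def[symmetric]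
    by (simp add: algebra_simps diff_divide_distrib)
qed (simp add: bump_def bump_grad_def)

lemma bump_bounds: "0 \<le> bump \<tau> x y" "bump \<tau> x y \<le> 1"
proof -
  show "0 \<le> bump \<tau> x y" by (simp add: bump_def)
  have "(max 0 (1 - ((x - y) \<bullet> (x - y)) / (\<tau> * d y)\<^sup>2))\<^sup>2 \<le> (1::real)"
    by (rule power_le_one) auto
  then show "bump \<tau> x y \<le> 1" by (simp add: bump_def)
qed

lemma bump_support:
  assumes \<tau>: "0 < \<tau>" and nz: "bump \<tau> x y \<noteq> 0 \<or> bump_grad \<tau> x y \<noteq> 0"
  shows "y \<in> \<Omega>" "norm (x - y) < \<tau> * d y"
proof -
  show y: "y \<in> \<Omega>" using nz by (auto simp: bump_def bump_grad_def split: if_splits)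
  define A where "A = ((x - y) \<bullet> (x - y)) / (\<tau> * d y)\<^sup>2"
  have "bump \<tau> x y = 0 \<and> bump_grad \<tau> x y = 0" if "1 \<le> A"
    using that unfolding bump_def bump_grad_def A_def[symmetric] by simp
  then have "A < 1" using nz by linarith
  then have "((x - y) \<bullet> (x - y)) / (\<tau> * d y)\<^sup>2 < 1" by (simp add: A_def)
  then have "(norm (x - y))\<^sup>2 < (\<tau> * d y)\<^sup>2"
    using \<tau> d_pos[OF y] by (simp add: dot_square_norm divide_less_eq)
  then show "norm (x - y) < \<tau> * d y" using \<tau> d_nonneg by (simp add: power2_less_imp_less)
qed

text \<open>The bump at \<open>y\<close> has a radius proportional to \<open>d(y)\<close>; seen from \<open>x\<close>, this is a ball of radius
  proportional to \<open>d(x)\<close>.\<close>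

lemma bump_support_comparable:
  assumes \<tau>: "0 < \<tau>" "\<tau> \<le> 1/4" and nz: "bump \<tau> x y \<noteq> 0 \<or> bump_grad \<tau> x y \<noteq> 0"
  shows "y \<in> \<Omega>" "d x \<le> 2 * d y" "norm (x - y) < 2 * \<tau> * d x"
proof -
  show y: "y \<in> \<Omega>" by (rule bump_support(1)[OF \<tau>(1) nz])
  have n: "norm (x - y) < \<tau> * d y" by (rule bump_support(2)[OF \<tau>(1) nz])
  have t: "\<tau> * d y \<le> 1/4 * d y" using \<tau> d_nonneg by (intro mult_right_mono) auto
  show "d x \<le> 2 * d y" using n t d_lipschitz[of x y] d_nonneg[of y] by linarith
  have "d y \<le> 2 * d x" using n t d_lipschitz[of x y] d_nonneg[of x] d_pos[OF y] by linarith
  then have "\<tau> * d y \<le> \<tau> * (2 * d x)" using \<tau> by (intro mult_left_mono) auto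
  then show "norm (x - y) < 2 * \<tau> * d x" using n by (simp add: mult_ac)
qed

lemma bump_grad_bound:
  assumes \<tau>: "0 < \<tau>"
  shows "norm (bump_grad \<tau> x y) \<le> 4 / (\<tau> * d y)"
proof (cases "bump_grad \<tau> x y = 0")
  case False
  then have y: "y \<in> \<Omega>" and n: "norm (x - y) < \<tau> * d y" using bump_support[OF \<tau>] by auto
  define R where "R = \<tau> * d y"
  have R: "R > 0" using \<tau> d_pos[OF y] by (simp add: R_def)
  define m where "m = max 0 (1 - ((x - y) \<bullet> (x - y)) / R\<^sup>2)"
  have m: "0 \<le> m" "m \<le> 1" by (auto simp: m_def)
  have "norm (bump_grad \<tau> x y) = 4 * m / R\<^sup>2 * norm (x - y)"
    using y m R by (simp add: bump_grad_def R_def[symmetric] m_def[symmetric])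
  also have "\<dots> \<le> 4 * 1 / R\<^sup>2 * R"
    using n m R by (intro mult_mono divide_right_mono) (auto simp: R_def)
  also have "\<dots> = 4 / R" using R by (simp add: power2_eq_square)
  finally show ?thesis by (simp add: R_def)
qed (use \<tau> d_nonneg in simp)

text \<open>The denominators of the averages are bounded below because every \<open>y\<close> within half the radius
  contributes a fixed amount.\<close>

lemma bump_lower_bound:
  assumes \<tau>: "0 < \<tau>" "\<tau> \<le> 1/4" and x: "x \<in> \<Omega>" and n: "norm (x - y) < \<tau> * d x / 2"
  shows "1/4 \<le> bump \<tau> x y"
proof -
  note dx = d_pos[OF x]
  have t: "\<tau> * d x \<le> 1/4 * d x" using \<tau> d_nonneg by (intro mult_right_mono) auto
  have y: "y \<in> \<Omega>" using n t dx by (intro mem_\<Omega>[OF x]) linarith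
  \<comment> \<open>\<open>|x - y| < d x / 8\<close>; hence \<open>|x - y|\<close> is at most \<open>(1/2) / (7/8) = 4/7\<close> of the radius, and \<open>1 - (4/7)\<^sup>2 \<ge> 1/2\<close>\<close>
  have dy: "7/8 * d x \<le> d y" using n t dx d_lipschitz[of x y] by linarith
  have "norm (x - y) \<le> 4/7 * (\<tau> * d y)"
  proof -
    have "\<tau> * (7/8 * d x) \<le> \<tau> * d y" using dy \<tau> by (intro mult_left_mono) auto
    then show ?thesis using n by linarith
  qed
  then have "(norm (x - y))\<^sup>2 \<le> (4/7 * (\<tau> * d y))\<^sup>2" by (intro power_mono) auto
  then have "((x - y) \<bullet> (x - y)) / (\<tau> * d y)\<^sup>2 \<le> 16/49"
    using \<tau> d_pos[OF y] by (simp add: dot_square_norm power_mult_distrib divide_simps)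
  then have "1/2 \<le> max 0 (1 - ((x - y) \<bullet> (x - y)) / (\<tau> * d y)\<^sup>2)"
    by (intro order_trans[OF _ max.cobounded2]) linarith
  then have "(1/2)\<^sup>2 \<le> (max 0 (1 - ((x - y) \<bullet> (x - y)) / (\<tau> * d y)\<^sup>2))\<^sup>2" by (rule power_mono) simp
  then show ?thesis using y by (simp add: bump_def power2_eq_square)
qed

definition bump_integral :: "real \<Rightarrow> (real ^ 'n \<Rightarrow> real) \<Rightarrow> real ^ 'n \<Rightarrow> real" where
  "bump_integral \<tau> F x = (\<integral>y. bump \<tau> x y * F y \<partial>lborel)"

definition bump_grad_integral :: "real \<Rightarrow> (real ^ 'n \<Rightarrow> real) \<Rightarrow> real ^ 'n \<Rightarrow> real ^ 'n" where
  "bump_grad_integral \<tau> F x = (\<integral>y. F y *\<^sub>R bump_grad \<tau> x y \<partial>lborel)"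

definition inner_region :: "real \<Rightarrow> (real ^ 'n) set" where
  "inner_region c = {y \<in> \<Omega>. c \<le> d y}"

text \<open>Integrability at positive distance from the boundary. The weight degenerates only at the boundary,
  so this holds for the functions under consideration, and it suffices because the bumps that are seen
  from \<open>x\<close> stay at distance \<open>d(x)/2\<close>.\<close>

definition inner_integrable :: "(real ^ 'n \<Rightarrow> real) \<Rightarrow> bool" where
  "inner_integrable F \<longleftrightarrow> F \<in> borel_measurable borel \<and> (\<forall>c>0. integrable lborel (\<lambda>y. indicator (inner_region c) y * F y))"

lemma inner_region_measurable [measurable]: "inner_region c \<in> sets borel"
  unfolding inner_region_def by measurable

lemma emeasure_inner_region: "emeasure lborel (inner_region c) < \<infinity>"
  by (rule emeasure_bounded_finite) (rule bounded_subset[OF bounded_\<Omega>], auto simp: inner_region_def)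

lemma inner_integrable_const: "inner_integrable (\<lambda>x. c)"
  unfolding inner_integrable_def using emeasure_inner_region by auto

lemma inner_integrable_diff:
  "inner_integrable F \<Longrightarrow> inner_integrable G \<Longrightarrow> inner_integrable (\<lambda>x. F x - G x)"
  unfolding inner_integrable_def by (auto simp: right_diff_distrib)

text \<open>On the inner region \<open>|f| \<le> 1 + |f|^p\<close> and \<open>d^a \<ge> c^a\<close>.\<close>

lemma inner_integrable_if_wLp:
  assumes p: "1 \<le> p" and a: "0 \<le> a" and [measurable]: "f \<in> borel_measurable borel" and fin: "wLp_integral p \<Omega> a f < \<infinity>"
  shows "inner_integrable f"
  unfolding inner_integrable_def
proof (intro conjI allI impI)
  fix c :: real assume c: "c > 0"
  have "(\<integral>\<^sup>+y. ennreal (norm (indicator (inner_region c) y * f y)) \<partial>lborel)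
    \<le> (\<integral>\<^sup>+y. indicator (inner_region c) y + ennreal (c powr (- a)) * (indicator \<Omega> y * ennreal (norm (f y) powr p * d y powr a)) \<partial>lborel)"
  proof (rule nn_integral_mono)
    fix y
    show "ennreal (norm (indicator (inner_region c) y * f y)) \<le> indicator (inner_region c) y + ennreal (c powr (- a)) * (indicator \<Omega> y * ennreal (norm (f y) powr p * d y powr a))"
    proof (cases "y \<in> inner_region c")
      case True
      then have y: "y \<in> \<Omega>" "c \<le> d y" by (auto simp: inner_region_def)
      have le1: "\<bar>f y\<bar> \<le> 1 + \<bar>f y\<bar> powr p"
      proof (cases "\<bar>f y\<bar> \<le> 1")
        case False
        then have "\<bar>f y\<bar> powr 1 \<le> \<bar>f y\<bar> powr p" using p by (intro powr_mono) auto
        then show ?thesis using False by simp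
      qed (simp add: add_increasing2)
      have le2: "\<bar>f y\<bar> powr p \<le> c powr (- a) * (\<bar>f y\<bar> powr p * d y powr a)"
      proof -
        have "c powr a \<le> d y powr a" using c y a by (intro powr_mono2) auto
        then have "1 \<le> c powr (- a) * d y powr a" using c by (simp add: powr_minus field_simps)
        then have "\<bar>f y\<bar> powr p * 1 \<le> \<bar>f y\<bar> powr p * (c powr (- a) * d y powr a)" by (rule mult_left_mono) simp
        then show ?thesis by (simp add: mult_ac)
      qed
      have "\<bar>f y\<bar> \<le> 1 + c powr (- a) * (\<bar>f y\<bar> powr p * d y powr a)" using le1 le2 by linarith
      then have "ennreal \<bar>f y\<bar> \<le> ennreal (1 + c powr (- a) * (\<bar>f y\<bar> powr p * d y powr a))" by (rule ennreal_leI)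
      also have "\<dots> = 1 + ennreal (c powr (- a)) * ennreal (\<bar>f y\<bar> powr p * d y powr a)"
        by (simp add: ennreal_mult)
      finally show ?thesis using True y by simp
    qed simp
  qed
  also have "\<dots> = emeasure lborel (inner_region c) + ennreal (c powr (- a)) * wLp_integral p \<Omega> a f"
    by (simp add: nn_integral_add nn_integral_cmult wLp_integral_def)
  also have "\<dots> < \<infinity>" using fin emeasure_inner_region[of c] by (simp add: ennreal_mult_less_top)
  finally show "integrable lborel (\<lambda>y. indicator (inner_region c) y * f y)"
    by (intro integrableI_bounded) auto
qed simp

lemma bump_inner_region:
  assumes \<tau>: "0 < \<tau>" "\<tau> \<le> 1/4" and nz: "bump \<tau> x y \<noteq> 0 \<or> bump_grad \<tau> x y \<noteq> 0" and x: "2 * c \<le> d x"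
  shows "y \<in> inner_region c"
  using bump_support_comparable[OF \<tau> nz] x by (auto simp: inner_region_def)

lemma bump_F_bounds:
  assumes \<tau>: "0 < \<tau>" "\<tau> \<le> 1/4" and c: "0 < c" and x: "2 * c \<le> d x"
  shows "\<bar>bump \<tau> x y * F y\<bar> \<le> \<bar>indicator (inner_region c) y * F y\<bar>"
    and "norm (F y *\<^sub>R bump_grad \<tau> x y) \<le> 4 / (\<tau> * c) * \<bar>indicator (inner_region c) y * F y\<bar>"
proof -
  show "\<bar>bump \<tau> x y * F y\<bar> \<le> \<bar>indicator (inner_region c) y * F y\<bar>"
    using bump_inner_region[OF \<tau> _ x, of y] bump_bounds[of \<tau> x y]
    by (cases "bump \<tau> x y = 0") (auto simp: abs_mult intro!: mult_left_le_one_le)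
  show "norm (F y *\<^sub>R bump_grad \<tau> x y) \<le> 4 / (\<tau> * c) * \<bar>indicator (inner_region c) y * F y\<bar>"
  proof (cases "bump_grad \<tau> x y = 0")
    case False
    then have y: "y \<in> inner_region c" using bump_inner_region[OF \<tau> _ x, of y] by simp
    have "norm (bump_grad \<tau> x y) \<le> 4 / (\<tau> * d y)" by (rule bump_grad_bound[OF \<tau>(1)])
    also have "\<dots> \<le> 4 / (\<tau> * c)"
      using \<tau> c y by (intro divide_left_mono mult_left_mono mult_pos_pos) (auto simp: inner_region_def)
    finally have "\<bar>F y\<bar> * norm (bump_grad \<tau> x y) \<le> \<bar>F y\<bar> * (4 / (\<tau> * c))" by (rule mult_left_mono) simp
    then show ?thesis using y by (simp add: mult_ac)
  qed (use \<tau> c in simp)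
qed

lemma bump_F_integrable:
  assumes \<tau>: "0 < \<tau>" "\<tau> \<le> 1/4" and F: "inner_integrable F" and x: "x \<in> \<Omega>"
  shows "integrable lborel (\<lambda>y. bump \<tau> x y * F y)" "integrable lborel (\<lambda>y. F y *\<^sub>R bump_grad \<tau> x y)"
proof -
  define c where "c = d x / 2"
  have c: "0 < c" "2 * c \<le> d x" using d_pos[OF x] by (auto simp: c_def)
  have [measurable]: "F \<in> borel_measurable borel" using F by (simp add: inner_integrable_def)
  have iF: "integrable lborel (\<lambda>y. indicator (inner_region c) y * F y)" using F c by (simp add: inner_integrable_def)
  show "integrable lborel (\<lambda>y. bump \<tau> x y * F y)"
    by (rule Bochner_Integration.integrable_bound[OF iF]) (use bump_F_bounds(1)[OF \<tau> c, of _ F] in auto)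
  have "integrable lborel (\<lambda>y. 4 / (\<tau> * c) * \<bar>indicator (inner_region c) y * F y\<bar>)" using iF by (intro integrable_mult_right integrable_abs)
  then show "integrable lborel (\<lambda>y. F y *\<^sub>R bump_grad \<tau> x y)"
    by (rule Bochner_Integration.integrable_bound) (use order_trans[OF bump_F_bounds(2)[OF \<tau> c, of F] abs_ge_self] in \<open>auto intro!: AE_I2\<close>)
qed

lemma bump_integral_has_derivative:
  assumes \<tau>: "0 < \<tau>" "\<tau> \<le> 1/4" and F: "inner_integrable F" and x0: "x0 \<in> \<Omega>"
  shows "(bump_integral \<tau> F has_derivative (\<lambda>v. bump_grad_integral \<tau> F x0 \<bullet> v)) (at x0)"
  unfolding bump_integral_def[abs_def] bump_grad_integral_def
proof (rule has_derivative_integral_lborel[where r="d x0 / 2"])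
  define c where "c = d x0 / 4"
  have c: "0 < c" using d_pos[OF x0] by (auto simp: c_def)
  have [measurable]: "F \<in> borel_measurable borel" using F by (simp add: inner_integrable_def)
  show "0 < d x0 / 2" using d_pos[OF x0] by simp
  have near: "x \<in> \<Omega>" "2 * c \<le> d x" if "x \<in> ball x0 (d x0 / 2)" for x
  proof -
    have n: "norm (x0 - x) < d x0 / 2" using that by (simp add: dist_norm)
    then show "x \<in> \<Omega>" using mem_\<Omega>[OF x0, of x] d_pos[OF x0] by simp
    show "2 * c \<le> d x" using n d_lipschitz[of x0 x] by (simp add: c_def)
  qed
  show "((\<lambda>x. bump \<tau> x y * F y) has_derivative (\<lambda>v. (F y *\<^sub>R bump_grad \<tau> x y) \<bullet> v)) (at x)" for x y
    using has_derivative_mult_left[OF bump_has_derivative[of \<tau> y x], of "F y"] by (simp add: mult.commute)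
  show "norm (F y *\<^sub>R bump_grad \<tau> x y) \<le> 4 / (\<tau> * c) * \<bar>indicator (inner_region c) y * F y\<bar>" if "x \<in> ball x0 (d x0 / 2)" for x y
    using near[OF that] by (intro bump_F_bounds(2)[OF \<tau> c])
  have "integrable lborel (\<lambda>y. indicator (inner_region c) y * F y)" using F c by (simp add: inner_integrable_def)
  then show "integrable lborel (\<lambda>y. 4 / (\<tau> * c) * \<bar>indicator (inner_region c) y * F y\<bar>)" by (intro integrable_mult_right integrable_abs)
  show "integrable lborel (\<lambda>y. bump \<tau> x y * F y)" if "x \<in> ball x0 (d x0 / 2)" for x
    by (rule bump_F_integrable(1)[OF \<tau> F near(1)[OF that]])
  show "(\<lambda>y. F y *\<^sub>R bump_grad \<tau> x0 y) \<in> borel_measurable borel" by measurable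
qed

lemma bump_integral_bounds:
  assumes \<tau>: "0 < \<tau>" "\<tau> \<le> 1/4" and F: "inner_integrable F" and c: "0 < c" and x: "2 * c \<le> d x"
  shows "\<bar>bump_integral \<tau> F x\<bar> \<le> (\<integral>y. \<bar>indicator (inner_region c) y * F y\<bar> \<partial>lborel)"
    and "norm (bump_grad_integral \<tau> F x) \<le> 4 / (\<tau> * c) * (\<integral>y. \<bar>indicator (inner_region c) y * F y\<bar> \<partial>lborel)"
proof -
  have iF: "integrable lborel (\<lambda>y. \<bar>indicator (inner_region c) y * F y\<bar>)" using F c by (simp add: inner_integrable_def)
  have "norm (bump_integral \<tau> F x) \<le> (\<integral>y. \<bar>indicator (inner_region c) y * F y\<bar> \<partial>lborel)"
    unfolding bump_integral_def by (rule norm_integral_le_integral[OF iF]) (use bump_F_bounds(1)[OF \<tau> c x] in simp)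
  then show "\<bar>bump_integral \<tau> F x\<bar> \<le> (\<integral>y. \<bar>indicator (inner_region c) y * F y\<bar> \<partial>lborel)" by simp
  have "norm (bump_grad_integral \<tau> F x) \<le> (\<integral>y. 4 / (\<tau> * c) * \<bar>indicator (inner_region c) y * F y\<bar> \<partial>lborel)"
    unfolding bump_grad_integral_def 
    by (rule norm_integral_le_integral) (use iF bump_F_bounds(2)[OF \<tau> c x] in \<open>auto intro: integrable_mult_right\<close>)
  then show "norm (bump_grad_integral \<tau> F x) \<le> 4 / (\<tau> * c) * (\<integral>y. \<bar>indicator (inner_region c) y * F y\<bar> \<partial>lborel)" by simp
qed

end

section \<open>Quotients of averages and their gradients\<close>

lemma add3_powr_le:
  fixes u v w p :: real
  assumes "0 \<le> p" "0 \<le> u" "0 \<le> v" "0 \<le> w"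
  shows "(u + v + w) powr p \<le> 3 powr p * (u powr p + v powr p + w powr p)"
proof -
  define m where "m = max u (max v w)"
  have "(u + v + w) powr p \<le> (3 * m) powr p"
    using assms by (intro powr_mono2) (auto simp: m_def)
  also have "\<dots> = 3 powr p * m powr p" by (simp add: powr_mult)
  also have "m powr p \<le> u powr p + v powr p + w powr p"
    by (simp add: m_def max_def)
  finally show ?thesis by simp
qed

context bounded_open
begin

text \<open>Dividing by the average of the constant \<open>1\<close> compensates for the variable scale: constants are
  reproduced exactly. The gradient below is the one given by the quotient rule.\<close>

definition smoothing :: "real \<Rightarrow> (real ^ 'n \<Rightarrow> real) \<Rightarrow> real ^ 'n \<Rightarrow> real" where
  "smoothing \<tau> f x = (if x \<in> \<Omega> then bump_integral \<tau> f x / bump_integral \<tau> (\<lambda>_. 1) x else 0)"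

definition smoothing_grad :: "real \<Rightarrow> (real ^ 'n \<Rightarrow> real) \<Rightarrow> real ^ 'n \<Rightarrow> real ^ 'n" where
  "smoothing_grad \<tau> f x = (if x \<in> \<Omega> then
     (1 / (bump_integral \<tau> (\<lambda>_. 1) x)\<^sup>2) *\<^sub>R (bump_integral \<tau> (\<lambda>_. 1) x *\<^sub>R bump_grad_integral \<tau> f x - bump_integral \<tau> f x *\<^sub>R bump_grad_integral \<tau> (\<lambda>_. 1) x) else 0)"

lemma bump_integral_measurable:
  assumes [measurable]: "f \<in> borel_measurable borel"
  shows "bump_integral \<tau> f \<in> borel_measurable borel" "bump_grad_integral \<tau> f \<in> borel_measurable borel"
  unfolding bump_integral_def[abs_def] bump_grad_integral_def[abs_def] by measurable

lemma bump_integral_1_lower: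
  assumes \<tau>: "0 < \<tau>" "\<tau> \<le> 1/4" and x: "x \<in> \<Omega>"
  shows "unit_ball_vol (real CARD('n)) * (\<tau> * d x / 2) powr real CARD('n) / 4 \<le> bump_integral \<tau> (\<lambda>_. 1) x"
proof -
  have r: "0 \<le> \<tau> * d x / 2" using \<tau> d_nonneg by simp
  let ?B = "ball x (\<tau> * d x / 2)"
  have fin: "emeasure lborel ?B < \<infinity>" by (rule emeasure_bounded_finite) simp
  have "measure lborel ?B = unit_ball_vol (real CARD('n)) * (\<tau> * d x / 2) powr real CARD('n)"
    using emeasure_ball_Rn[OF r, of x] by (simp add: measure_def)
  then have "unit_ball_vol (real CARD('n)) * (\<tau> * d x / 2) powr real CARD('n) / 4 = (\<integral>y. indicator ?B y * (1/4) \<partial>lborel)"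
    by simp
  also have "\<dots> \<le> (\<integral>y. bump \<tau> x y * 1 \<partial>lborel)"
  proof (rule integral_mono)
    show "integrable lborel (\<lambda>y. indicator ?B y * (1/4 :: real))" using fin by simp
    show "integrable lborel (\<lambda>y. bump \<tau> x y * 1)" by (rule bump_F_integrable(1)[OF \<tau> inner_integrable_const x])
    show "indicator ?B y * (1/4) \<le> bump \<tau> x y * 1" for y
      using bump_lower_bound[OF \<tau> x, of y] bump_bounds(1)[of \<tau> x y] by (auto simp: indicator_def dist_norm)
  qed
  finally show ?thesis by (simp add: bump_integral_def)
qed

lemma bump_integral_1_pos:
  assumes \<tau>: "0 < \<tau>" "\<tau> \<le> 1/4" and x: "x \<in> \<Omega>"
  shows "0 < bump_integral \<tau> (\<lambda>_. 1) x"
proof -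
  have "0 < unit_ball_vol (real CARD('n)) * (\<tau> * d x / 2) powr real CARD('n) / 4"
    using \<tau> d_pos[OF x] by (intro divide_pos_pos mult_pos_pos) auto
  then show ?thesis using bump_integral_1_lower[OF assms] by linarith
qed

text \<open>The quotient is classically differentiable in \<open>\<Omega>\<close>, and on compact subsets \<open>d\<close> is bounded below, which
  bounds the gradient.\<close>

lemma smoothing_borel_weak_gradient:
  assumes \<tau>: "0 < \<tau>" "\<tau> \<le> 1/4" and f: "inner_integrable f"
  shows "borel_weak_gradient \<Omega> (smoothing \<tau> f) (smoothing_grad \<tau> f)"
proof (rule borel_weak_gradient_classical[OF open_\<Omega>])
  have fm: "f \<in> borel_measurable borel" using f by (simp add: inner_integrable_def)
  note [measurable] = bump_integral_measurable[OF fm] bump_integral_measurable[of "\<lambda>_. 1"]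
  show "smoothing \<tau> f \<in> borel_measurable borel" unfolding smoothing_def[abs_def] by measurable
  show "smoothing_grad \<tau> f \<in> borel_measurable borel" unfolding smoothing_grad_def[abs_def] by measurable
  show "(smoothing \<tau> f has_derivative (\<lambda>v. smoothing_grad \<tau> f x \<bullet> v)) (at x)" if x: "x \<in> \<Omega>" for x
  proof (rule has_derivative_transform_within_open[OF _ open_\<Omega> x])
    let ?N = "bump_integral \<tau> f" and ?W = "bump_integral \<tau> (\<lambda>_. 1)"
    have W: "?W x \<noteq> 0" using bump_integral_1_pos[OF \<tau> x] by simp
    have "((\<lambda>x. ?N x / ?W x) has_derivative (\<lambda>v. - ?N x * (inverse (?W x) * (bump_grad_integral \<tau> (\<lambda>_. 1) x \<bullet> v) * inverse (?W x)) + (bump_grad_integral \<tau> f x \<bullet> v) / ?W x)) (at x)"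
      by (rule has_derivative_divide[OF bump_integral_has_derivative[OF \<tau> f x] bump_integral_has_derivative[OF \<tau> inner_integrable_const x] W])
    also have "(\<lambda>v. - ?N x * (inverse (?W x) * (bump_grad_integral \<tau> (\<lambda>_. 1) x \<bullet> v) * inverse (?W x)) + (bump_grad_integral \<tau> f x \<bullet> v) / ?W x) = (\<lambda>v. smoothing_grad \<tau> f x \<bullet> v)"
      using W x by (simp add: smoothing_grad_def fun_eq_iff inner_diff_left field_simps power2_eq_square)
    finally show "((\<lambda>x. ?N x / ?W x) has_derivative (\<lambda>v. smoothing_grad \<tau> f x \<bullet> v)) (at x)" .
    show "?N y / ?W y = smoothing \<tau> f y" if "y \<in> \<Omega>" for y using that by (simp add: smoothing_def)
  qed
  show "\<exists>B. \<forall>x\<in>K. norm (smoothing_grad \<tau> f x) \<le> B" if K: "compact K" "K \<subseteq> \<Omega>" for K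
  proof (cases "K = {}")
    case False
    obtain x1 where x1: "x1 \<in> K" "\<And>x. x \<in> K \<Longrightarrow> d x1 \<le> d x"
      using continuous_attains_inf[OF K(1) False continuous_on_d] by blast
    define c where "c = d x1 / 2"
    have c: "0 < c" "\<And>x. x \<in> K \<Longrightarrow> 2 * c \<le> d x" using x1 K d_pos[of x1] by (auto simp: c_def)
    define w where "w = unit_ball_vol (real CARD('n)) * (\<tau> * c) powr real CARD('n) / 4"
    have w: "w > 0" using \<tau> c by (simp add: w_def)
    define J :: "(real ^ 'n \<Rightarrow> real) \<Rightarrow> real" where "J = (\<lambda>F. \<integral>y. \<bar>indicator (inner_region c) y * F y\<bar> \<partial>(lborel :: (real ^ 'n) measure))"
    have J: "0 \<le> J F" for F by (simp add: J_def)
    have "norm (smoothing_grad \<tau> f x) \<le> 1 / w\<^sup>2 * (J (\<lambda>_. 1) * (4 / (\<tau> * c) * J f) + J f * (4 / (\<tau> * c) * J (\<lambda>_. 1)))" if x: "x \<in> K" for x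
    proof -
      let ?N = "bump_integral \<tau> f x" and ?W = "bump_integral \<tau> (\<lambda>_. 1) x"
      have x\<Omega>: "x \<in> \<Omega>" using x K by auto
      have "(\<tau> * c) powr real CARD('n) \<le> (\<tau> * d x / 2) powr real CARD('n)"
      proof (rule powr_mono2)
        have "\<tau> * (2 * c) \<le> \<tau> * d x" using c(2)[OF x] \<tau> by (intro mult_left_mono) auto
        then show "\<tau> * c \<le> \<tau> * d x / 2" by simp
      qed (use \<tau> c in auto)
      then have "w \<le> unit_ball_vol (real CARD('n)) * (\<tau> * d x / 2) powr real CARD('n) / 4"
        unfolding w_def by (intro divide_right_mono mult_left_mono) auto
      then have W: "w \<le> ?W" using bump_integral_1_lower[OF \<tau> x\<Omega>] by linarith
      have bf: "\<bar>?N\<bar> \<le> J f" "norm (bump_grad_integral \<tau> f x) \<le> 4 / (\<tau> * c) * J f"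
        unfolding J_def by (rule bump_integral_bounds[OF \<tau> f c(1) c(2)[OF x]])+
      have b1: "\<bar>?W\<bar> \<le> J (\<lambda>_. 1)" "norm (bump_grad_integral \<tau> (\<lambda>_. 1) x) \<le> 4 / (\<tau> * c) * J (\<lambda>_. 1)"
        unfolding J_def by (rule bump_integral_bounds[OF \<tau> inner_integrable_const c(1) c(2)[OF x]])+
      have "norm (?W *\<^sub>R bump_grad_integral \<tau> f x - ?N *\<^sub>R bump_grad_integral \<tau> (\<lambda>_. 1) x) \<le> \<bar>?W\<bar> * norm (bump_grad_integral \<tau> f x) + \<bar>?N\<bar> * norm (bump_grad_integral \<tau> (\<lambda>_. 1) x)"
        using norm_triangle_ineq4[of "?W *\<^sub>R bump_grad_integral \<tau> f x" "?N *\<^sub>R bump_grad_integral \<tau> (\<lambda>_. 1) x"] by simp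
      also have "\<dots> \<le> J (\<lambda>_. 1) * (4 / (\<tau> * c) * J f) + J f * (4 / (\<tau> * c) * J (\<lambda>_. 1))"
        using J \<tau> c by (intro add_mono mult_mono bf b1) auto
      finally have num: "norm (?W *\<^sub>R bump_grad_integral \<tau> f x - ?N *\<^sub>R bump_grad_integral \<tau> (\<lambda>_. 1) x) \<le> J (\<lambda>_. 1) * (4 / (\<tau> * c) * J f) + J f * (4 / (\<tau> * c) * J (\<lambda>_. 1))" .
      have "norm (smoothing_grad \<tau> f x) = 1 / ?W\<^sup>2 * norm (?W *\<^sub>R bump_grad_integral \<tau> f x - ?N *\<^sub>R bump_grad_integral \<tau> (\<lambda>_. 1) x)"
        using x\<Omega> by (simp add: smoothing_grad_def)
      also have "\<dots> \<le> 1 / w\<^sup>2 * (J (\<lambda>_. 1) * (4 / (\<tau> * c) * J f) + J f * (4 / (\<tau> * c) * J (\<lambda>_. 1)))"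
        using w W by (intro mult_mono num divide_left_mono power_mono) auto
      finally show ?thesis .
    qed
    then show ?thesis by blast
  qed simp
qed

text \<open>The denominator of the average exceeds \<open>V (t/2)^n / 4\<close> with \<open>t = \<tau> d(x)\<close>, which gives the factor
  \<open>4 2^n / V\<close>; the gradient of the bump is at most \<open>8/t\<close>; and \<open>1 + 4 4^n\<close> accounts for the two terms of
  the quotient rule.\<close>

definition smoothing_const :: real where
  "smoothing_const = 32 * 2 powr real CARD('n) * (1 + 4 * 4 powr real CARD('n)) / unit_ball_vol (real CARD('n))"

definition oscillation :: "(real ^ 'n \<Rightarrow> real) \<Rightarrow> real ^ 'n \<Rightarrow> real \<Rightarrow> real" where
  "oscillation f x r = (\<integral>y. indicator (ball x r) y * \<bar>f y - f x\<bar> \<partial>lborel)"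

text \<open>Replacing \<open>f\<close> by \<open>f - f(x)\<close>, for the fixed point \<open>x\<close>, turns numerators into integrals of
  \<open>f(y) - f(x)\<close> over a ball of radius \<open>2 t\<close>. For the gradient this uses that the average reproduces
  constants: without the subtraction only the size of \<open>f\<close> would appear.\<close>

lemma smoothing_pointwise:
  assumes \<tau>: "0 < \<tau>" "\<tau> \<le> 1/4" and f: "inner_integrable f" and x: "x \<in> \<Omega>"
  defines "t \<equiv> \<tau> * d x"
  shows "\<bar>f x - smoothing \<tau> f x\<bar> \<le> smoothing_const * t powr (- real CARD('n)) * oscillation f x (2 * t)"
    and "t * norm (smoothing_grad \<tau> f x) \<le> smoothing_const * t powr (- real CARD('n)) * oscillation f x (2 * t)"
proof -
  define V where "V = unit_ball_vol (real CARD('n))"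
  define S where "S = oscillation f x (2 * t)"
  define C where "C = smoothing_const"
  define n where "n = real CARD('n)"
  have V: "V > 0" by (simp add: V_def)
  have t: "t > 0" using \<tau> d_pos[OF x] by (simp add: t_def)
  have [measurable]: "f \<in> borel_measurable borel" using f by (simp add: inner_integrable_def)
  let ?N = "bump_integral \<tau> f x" and ?W = "bump_integral \<tau> (\<lambda>_. 1) x" and ?N' = "bump_grad_integral \<tau> f x" and ?W' = "bump_grad_integral \<tau> (\<lambda>_. 1) x"
  define F where "F = (\<lambda>y. f y - f x)"
  have F: "inner_integrable F" unfolding F_def by (intro inner_integrable_diff f inner_integrable_const)
  have [measurable]: "F \<in> borel_measurable borel" using F by (simp add: inner_integrable_def)
  have W0: "0 < ?W" by (rule bump_integral_1_pos[OF \<tau> x])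
  have w: "V * (t / 2) powr n / 4 \<le> ?W"
    using bump_integral_1_lower[OF \<tau> x] by (simp add: V_def t_def n_def)
  have supp: "y \<in> ball x (2 * t) \<and> y \<in> inner_region (d x / 2) \<and> t / 2 \<le> \<tau> * d y" if "bump \<tau> x y \<noteq> 0 \<or> bump_grad \<tau> x y \<noteq> 0" for y
  proof -
    have "\<tau> * d x \<le> \<tau> * (2 * d y)" using bump_support_comparable(2)[OF \<tau> that] \<tau> by (intro mult_left_mono) auto
    then show ?thesis using bump_support_comparable[OF \<tau> that] by (auto simp: t_def dist_norm inner_region_def mult_ac)
  qed
  have small: "ball x (2 * t) \<subseteq> inner_region (d x / 2)"
  proof
    fix y assume "y \<in> ball x (2 * t)"
    moreover have "\<tau> * d x \<le> 1/4 * d x" using \<tau> d_nonneg by (intro mult_right_mono) auto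
    ultimately have "norm (x - y) < d x / 2" by (simp add: t_def dist_norm)
    then show "y \<in> inner_region (d x / 2)"
      using mem_\<Omega>[OF x, of y] d_lipschitz[of x y] d_pos[OF x] by (auto simp: inner_region_def)
  qed
  have iB: "integrable lborel (\<lambda>y. indicator (ball x (2 * t)) y * \<bar>G y\<bar>)" if "inner_integrable G" for G
  proof -
    have [measurable]: "G \<in> borel_measurable borel" using that by (simp add: inner_integrable_def)
    have i: "integrable lborel (\<lambda>y. indicator (inner_region (d x / 2)) y * G y)"
      using that d_pos[OF x] by (simp add: inner_integrable_def)
    show ?thesis
      by (rule Bochner_Integration.integrable_bound[OF i]) (use subsetD[OF small] in \<open>auto intro!: AE_I2 simp: indicator_def\<close>)
  qed
  have int_le: "\<bar>bump_integral \<tau> G x\<bar> \<le> (\<integral>y. indicator (ball x (2 * t)) y * \<bar>G y\<bar> \<partial>lborel)" 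
    "norm (bump_grad_integral \<tau> G x) \<le> 8 / t * (\<integral>y. indicator (ball x (2 * t)) y * \<bar>G y\<bar> \<partial>lborel)" if G: "inner_integrable G" for G
  proof -
    have "norm (bump \<tau> x y * G y) \<le> indicator (ball x (2 * t)) y * \<bar>G y\<bar>" for y
      using supp[of y] bump_bounds[of \<tau> x y] by (cases "bump \<tau> x y = 0") (auto simp: abs_mult intro!: mult_left_le_one_le)
    from norm_integral_le_integral[OF iB[OF G] this]
    show "\<bar>bump_integral \<tau> G x\<bar> \<le> (\<integral>y. indicator (ball x (2 * t)) y * \<bar>G y\<bar> \<partial>lborel)"
      by (simp add: bump_integral_def)
    have "norm (G y *\<^sub>R bump_grad \<tau> x y) \<le> 8 / t * (indicator (ball x (2 * t)) y * \<bar>G y\<bar>)" for y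
    proof (cases "bump_grad \<tau> x y = 0")
      case False
      have "norm (bump_grad \<tau> x y) \<le> 4 / (\<tau> * d y)" by (rule bump_grad_bound[OF \<tau>(1)])
      also have "\<dots> \<le> 4 / (t / 2)" using supp[of y] False t by (intro divide_left_mono) auto
      finally have "\<bar>G y\<bar> * norm (bump_grad \<tau> x y) \<le> \<bar>G y\<bar> * (8 / t)" by (intro mult_left_mono) auto
      then show ?thesis using supp[of y] False by (simp add: mult.commute)
    qed (use t in auto)
    from norm_integral_le_integral[OF integrable_mult_right[OF iB[OF G]] this]
    show "norm (bump_grad_integral \<tau> G x) \<le> 8 / t * (\<integral>y. indicator (ball x (2 * t)) y * \<bar>G y\<bar> \<partial>lborel)"
      by (simp add: bump_grad_integral_def)
  qed
  have S_eq: "S = (\<integral>y. indicator (ball x (2 * t)) y * \<bar>F y\<bar> \<partial>lborel)" by (simp add: S_def oscillation_def F_def)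
  have S0: "S \<ge> 0" unfolding S_def oscillation_def by (intro integral_nonneg_AE) auto
  have FN: "bump_integral \<tau> F x = ?N - f x * ?W"
  proof -
    have "bump_integral \<tau> F x = (\<integral>y. bump \<tau> x y * f y - f x * (bump \<tau> x y * 1) \<partial>lborel)"
      by (simp add: bump_integral_def F_def algebra_simps)
    also have "\<dots> = ?N - f x * ?W"
      unfolding bump_integral_def using bump_F_integrable(1)[OF \<tau> f x] bump_F_integrable(1)[OF \<tau> inner_integrable_const x, of 1]
      by (subst Bochner_Integration.integral_diff) auto
    finally show ?thesis .
  qed
  have FN': "bump_grad_integral \<tau> F x = ?N' - f x *\<^sub>R ?W'"
  proof -
    have "bump_grad_integral \<tau> F x = (\<integral>y. f y *\<^sub>R bump_grad \<tau> x y - f x *\<^sub>R (1 *\<^sub>R bump_grad \<tau> x y) \<partial>lborel)"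
      by (simp add: bump_grad_integral_def F_def algebra_simps)
    also have "\<dots> = ?N' - f x *\<^sub>R ?W'"
      unfolding bump_grad_integral_def using bump_F_integrable(2)[OF \<tau> f x] bump_F_integrable(2)[OF \<tau> inner_integrable_const x, of 1]
      by (subst Bochner_Integration.integral_diff) auto
    finally show ?thesis .
  qed
  have b1: "\<bar>?N - f x * ?W\<bar> \<le> S" using int_le(1)[OF F] by (simp add: FN S_eq)
  have b2: "norm (?N' - f x *\<^sub>R ?W') \<le> 8 / t * S" using int_le(2)[OF F] by (simp add: FN' S_eq)
  have vol: "(\<integral>y. indicator (ball x (2 * t)) y * \<bar>1 :: real\<bar> \<partial>lborel) = V * (2 * t) powr n"
  proof -
    have "measure lborel (ball x (2 * t)) = V * (2 * t) powr n"
      using emeasure_ball_Rn[of "2 * t" x] t by (simp add: measure_def V_def n_def)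
    then show ?thesis by simp
  qed
  have b3: "norm ?W' \<le> 8 / t * (V * (2 * t) powr n)" using int_le(2)[OF inner_integrable_const, of 1] vol by simp
  define A where "A = 4 * 2 powr n / V * t powr (- n)"
  have A: "A > 0" using V t by (simp add: A_def)
  have inv: "1 / ?W \<le> A"
  proof -
    have "V * (t / 2) powr n / 4 = 1 / A"
      using t V by (simp add: A_def powr_divide powr_minus field_simps)
    then have "1 / A \<le> ?W" using w by simp
    then show ?thesis using A W0 by (simp add: field_simps)
  qed
  have Q: "A * (V * (2 * t) powr n) = 4 * 4 powr n"
  proof -
    have "A * (V * (2 * t) powr n) = 4 * (2 powr n * 2 powr n)"
      using V t by (simp add: A_def powr_mult powr_minus field_simps)
    then show ?thesis by (simp add: powr_mult[symmetric])
  qed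
  have C_eq: "C * t powr (- n) = 8 * (1 + 4 * 4 powr n) * A"
    by (simp add: C_def smoothing_const_def V_def A_def n_def)
  have C_ge: "A \<le> C * t powr (- n)"
  proof -
    have "1 * A \<le> 8 * (1 + 4 * 4 powr n) * A" using A by (intro mult_right_mono) auto
    then show ?thesis by (simp add: C_eq)
  qed
  have "\<bar>f x - smoothing \<tau> f x\<bar> = \<bar>?N - f x * ?W\<bar> * (1 / ?W)"
  proof -
    have "f x - smoothing \<tau> f x = - ((?N - f x * ?W) / ?W)" using x W0 by (simp add: smoothing_def field_simps)
    then show ?thesis using W0 by (simp add: abs_divide)
  qed
  also have "\<dots> \<le> S * A" using inv b1 S0 W0 by (intro mult_mono) auto
  also have "\<dots> \<le> S * (C * t powr (- n))" using C_ge S0 by (rule mult_left_mono)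
  finally show "\<bar>f x - smoothing \<tau> f x\<bar> \<le> smoothing_const * t powr (- real CARD('n)) * oscillation f x (2 * t)"
    by (simp add: n_def C_def S_def mult.commute)
  \<comment> \<open>the quotient rule, rearranged so that \<open>f\<close> enters only through \<open>f - f x\<close>\<close>
  have "smoothing_grad \<tau> f x = (1 / ?W) *\<^sub>R (?N' - f x *\<^sub>R ?W') - ((?N - f x * ?W) * (1 / ?W) * (1 / ?W)) *\<^sub>R ?W'"
    using x W0 by (simp add: smoothing_grad_def power2_eq_square scaleR_diff_right scaleR_diff_left left_diff_distrib diff_divide_distrib)
  then have "norm (smoothing_grad \<tau> f x) \<le> (1 / ?W) * norm (?N' - f x *\<^sub>R ?W') + (\<bar>?N - f x * ?W\<bar> * (1 / ?W) * (1 / ?W)) * norm ?W'"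
    using norm_triangle_ineq4[of "(1 / ?W) *\<^sub>R (?N' - f x *\<^sub>R ?W')" "((?N - f x * ?W) * (1 / ?W) * (1 / ?W)) *\<^sub>R ?W'"] W0
    by (simp add: abs_mult)
  also have "\<dots> \<le> A * (8 / t * S) + (S * A * A) * (8 / t * (V * (2 * t) powr n))"
    using inv b1 b2 b3 S0 W0 A by (intro add_mono mult_mono) auto
  also have "\<dots> = 8 / t * S * A * (1 + A * (V * (2 * t) powr n))" by (simp add: algebra_simps)
  also have "\<dots> = 8 / t * S * A * (1 + 4 * 4 powr n)" unfolding Q ..
  also have "\<dots> = (C * t powr (- n) * S) / t" unfolding C_eq by simp
  finally show "t * norm (smoothing_grad \<tau> f x) \<le> smoothing_const * t powr (- real CARD('n)) * oscillation f x (2 * t)"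
    using t by (simp add: n_def C_def S_def field_simps)
qed

end

section \<open>The K-functional from above\<close>

context bounded_open
begin

text \<open>Raising the pointwise estimate to the power \<open>p\<close> gives the first factor, Jensen's inequality on a ball
  of volume proportional to \<open>V\<close> the second, and passing from the radius \<open>l d(x)/2\<close> to \<open>l d(x)\<close> the
  third.\<close>

definition osc_const :: "real \<Rightarrow> real" where
  "osc_const p = smoothing_const powr p * unit_ball_vol (real CARD('n)) powr (p - 1) * 2 powr (real CARD('n) * p)"

lemma smoothing_const_pos: "0 < smoothing_const"
proof -
  have "(0::real) < 1 + 4 * 4 powr real CARD('n)" by (simp add: add_pos_nonneg)
  then show ?thesis unfolding smoothing_const_def by (intro divide_pos_pos mult_pos_pos) auto
qed

lemma osc_const_pos: "0 < osc_const p"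
  unfolding osc_const_def using smoothing_const_pos less_imp_neq[OF unit_ball_vol_pos[of "real CARD('n)"]]
  by (intro mult_pos_pos) (auto dest: sym)

text \<open>The mean oscillation of \<open>f\<close> over the ball of radius \<open>l d(x)\<close>, to the power \<open>p\<close>, is by Jensen at most
  the mean of \<open>|f(y) - f(x)|^p\<close>, the inner integral of the modulus. Stated for a general \<open>q\<close>, since it
  serves for the error of the smoothing and for its gradient.\<close>

lemma oscillation_integral_le:
  assumes p: "1 \<le> p" and l: "0 < l" "l \<le> 1/2" and [measurable]: "f \<in> borel_measurable borel"
    and q: "\<And>x. x \<in> \<Omega> \<Longrightarrow> 0 \<le> q x"
    "\<And>x. x \<in> \<Omega> \<Longrightarrow> q x \<le> smoothing_const * (l / 2 * d x) powr (- real CARD('n)) * oscillation f x (2 * (l / 2 * d x))"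
  shows "(\<integral>\<^sup>+x. indicator \<Omega> x * ennreal (q x powr p * d x powr a) \<partial>lborel) \<le> ennreal (osc_const p) * modulus p a f l"
proof -
  define n where "n = real CARD('n)"
  define V where "V = unit_ball_vol n"
  define C where "C = smoothing_const"
  have V: "V > 0" by (simp add: V_def n_def)
  have C: "C \<ge> 0" using smoothing_const_pos by (simp add: C_def)
  define M where "M = modulus_kernel p a f l"
  have [measurable]: "(\<lambda>(x, y). M x y) \<in> borel_measurable (borel \<Otimes>\<^sub>M borel)"
    unfolding M_def by (rule kernel_measurable(1)) simp
  have "(\<integral>\<^sup>+x. indicator \<Omega> x * ennreal (q x powr p * d x powr a) \<partial>lborel) \<le> (\<integral>\<^sup>+x. ennreal (osc_const p) * (\<integral>\<^sup>+y. M x y \<partial>lborel) \<partial>lborel)"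
  proof (rule nn_integral_mono)
    fix x
    show "indicator \<Omega> x * ennreal (q x powr p * d x powr a) \<le> ennreal (osc_const p) * (\<integral>\<^sup>+y. M x y \<partial>lborel)"
    proof (cases "x \<in> \<Omega>")
      case True
      note dx = d_pos[OF True]
      define r where "r = l * d x"
      have r: "r > 0" using l dx by (simp add: r_def)
      define B where "B = ball x r"
      define S where "S = (\<integral>y. indicator B y * \<bar>f y - f x\<bar> \<partial>lborel)"
      have S0: "S \<ge> 0" unfolding S_def by (intro integral_nonneg_AE) auto
      have mB: "measure lborel B = V * r powr n"
        using emeasure_ball_Rn[of r x] r V by (simp add: measure_def B_def V_def n_def)
      have qS: "q x \<le> C * (r / 2) powr (- n) * S"
        using q(2)[OF True] by (simp add: C_def n_def S_def B_def r_def oscillation_def)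
      have "q x powr p \<le> (C * (r / 2) powr (- n) * S) powr p"
        using q(1)[OF True] qS p by (intro powr_mono2) auto
      also have "\<dots> = C powr p * (r / 2) powr (- n * p) * S powr p"
        by (simp add: powr_mult powr_powr)
      finally have "q x powr p * d x powr a \<le> C powr p * (r / 2) powr (- n * p) * S powr p * d x powr a"
        by (rule mult_right_mono) simp
      then have "ennreal (q x powr p * d x powr a) \<le> ennreal (C powr p * (r / 2) powr (- n * p) * d x powr a * S powr p)"
        by (intro ennreal_leI) (simp add: mult_ac)
      also have "\<dots> = ennreal (C powr p * (r / 2) powr (- n * p) * d x powr a) * ennreal (S powr p)"
        by (simp add: ennreal_mult)
      also have "\<dots> \<le> ennreal (C powr p * (r / 2) powr (- n * p) * d x powr a) * (ennreal (measure lborel B powr (p - 1)) * (\<integral>\<^sup>+y. indicator B y * ennreal (\<bar>f y - f x\<bar> powr p) \<partial>lborel))"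
      proof (rule mult_left_mono)
        have "emeasure lborel B < \<infinity>" unfolding B_def by (rule emeasure_bounded_finite) simp
        moreover have "0 < measure lborel B" unfolding mB using r V by simp
        moreover have "B \<in> sets lborel" by (simp add: B_def)
        ultimately show "ennreal (S powr p) \<le> ennreal (measure lborel B powr (p - 1)) * (\<integral>\<^sup>+y. indicator B y * ennreal (\<bar>f y - f x\<bar> powr p) \<partial>lborel)"
          unfolding S_def by (intro Jensen_powr[OF p]) auto
      qed simp
      also have "\<dots> = ennreal (C powr p * (r / 2) powr (- n * p) * d x powr a * (V * r powr n) powr (p - 1)) * (\<integral>\<^sup>+y. indicator B y * ennreal (\<bar>f y - f x\<bar> powr p) \<partial>lborel)"
        unfolding mB by (simp add: ennreal_mult mult.assoc)
      also have "C powr p * (r / 2) powr (- n * p) * d x powr a * (V * r powr n) powr (p - 1)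
         = osc_const p * (d x powr a * r powr (- n))"
      proof -
        have "(r / 2) powr (- n * p) = 2 powr (n * p) * r powr (- n * p)"
          using r by (simp add: powr_divide powr_minus field_simps)
        moreover have "(V * r powr n) powr (p - 1) = V powr (p - 1) * r powr (n * (p - 1))"
          using r V by (simp add: powr_mult powr_powr)
        moreover have "r powr (- n * p) * r powr (n * (p - 1)) = r powr (- n)"
          by (simp add: powr_add[symmetric] algebra_simps)
        ultimately have "C powr p * (r / 2) powr (- n * p) * d x powr a * (V * r powr n) powr (p - 1)
          = (C powr p * V powr (p - 1) * 2 powr (n * p)) * (d x powr a * r powr (- n))"
          by (simp add: mult_ac)
        then show ?thesis by (simp add: osc_const_def C_def V_def n_def)
      qed
      also have "ennreal (osc_const p * (d x powr a * r powr (- n))) * (\<integral>\<^sup>+y. indicator B y * ennreal (\<bar>f y - f x\<bar> powr p) \<partial>lborel)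
        = ennreal (osc_const p) * (\<integral>\<^sup>+y. ennreal (d x powr a * r powr (- n)) * (indicator B y * ennreal (\<bar>f y - f x\<bar> powr p)) \<partial>lborel)"
      proof -
        have m: "(\<lambda>y. indicator B y * ennreal (\<bar>f y - f x\<bar> powr p)) \<in> borel_measurable lborel"
          unfolding B_def by (intro borel_measurable_times_ennreal borel_measurable_indicator) auto
        show ?thesis
          unfolding nn_integral_cmult[OF m] using osc_const_pos[of p]
          by (subst ennreal_mult'[of "osc_const p"]) (simp_all add: mult.assoc)
      qed
      also have "(\<integral>\<^sup>+y. ennreal (d x powr a * r powr (- n)) * (indicator B y * ennreal (\<bar>f y - f x\<bar> powr p)) \<partial>lborel) = (\<integral>\<^sup>+y. M x y \<partial>lborel)"
      proof (rule nn_integral_cong)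
        fix y
        have "min l (1/2) = l" using l by simp
        then show "ennreal (d x powr a * r powr (- n)) * (indicator B y * ennreal (\<bar>f y - f x\<bar> powr p)) = M x y"
          using True by (simp add: M_def modulus_kernel_def n_def B_def r_def indicator_def dist_norm ennreal_mult'[symmetric] abs_minus_commute)
      qed
      finally show ?thesis using True by simp
    qed simp
  qed
  also have "\<dots> = ennreal (osc_const p) * modulus p a f l"
  proof -
    have "modulus p a f l = (\<integral>\<^sup>+x. (\<integral>\<^sup>+y. M x y \<partial>lborel) \<partial>lborel)" unfolding modulus_def M_def ..
    then show ?thesis by (simp add: nn_integral_cmult)
  qed
  finally show ?thesis .
qed

text \<open>The cost has three terms, whence \<open>3^p\<close>; the norm of \<open>h = f - g\<close> is bounded by those of \<open>f\<close> and
  \<open>g\<close>.\<close>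

definition K_modulus_const :: "real \<Rightarrow> real" where
  "K_modulus_const p = 3 powr p * (osc_const p + 2 * (2 powr p * osc_const p) + 2 powr p)"

text \<open>The decomposition is \<open>f = (f - h) + h\<close> with \<open>h\<close> the smoothing of \<open>f\<close>. The lower-order part of the Sobolev
  norm of \<open>h\<close> is responsible for the term with \<open>l^p\<close>.\<close>

lemma K_le_modulus:
  assumes p: "1 \<le> p" and a: "0 \<le> a" and l: "0 < l" "l \<le> 1/2" and [measurable]: "f \<in> borel_measurable borel" 
    and fin: "wLp_integral p \<Omega> a f < \<infinity>"
  shows "ennreal (K_functional p \<Omega> a (a + p) l f powr p)
    \<le> ennreal (K_modulus_const p) * (modulus p a f l + ennreal (l powr p) * wLp_integral p \<Omega> a f)"
proof (cases "modulus p a f l = \<infinity>")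
  case True
  have "K_modulus_const p > 0" using osc_const_pos[of p] by (simp add: K_modulus_const_def add_pos_pos)
  then show ?thesis using True by (simp add: ennreal_mult_top)
next
  case False
  define Q where "Q = osc_const p"
  have Q: "Q > 0" unfolding Q_def by (rule osc_const_pos)
  define M where "M = modulus p a f l"
  have M: "M < \<infinity>" using False by (simp add: M_def less_top)
  \<comment> \<open>the bumps seen from \<open>x\<close> then lie in the ball of radius \<open>2 \<tau> d x = l d x\<close> of the modulus\<close>
  define \<tau> where "\<tau> = l / 2"
  have \<tau>: "0 < \<tau>" "\<tau> \<le> 1/4" using l by (auto simp: \<tau>_def)
  define h where "h = smoothing \<tau> f"
  define G where "G = smoothing_grad \<tau> f"
  define g where "g = (\<lambda>x. f x - h x)"
  have f: "inner_integrable f" by (rule inner_integrable_if_wLp[OF p a _ fin]) simp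
  have wg: "borel_weak_gradient \<Omega> h G" unfolding h_def G_def by (rule smoothing_borel_weak_gradient[OF \<tau> f])
  note [measurable] = borel_weak_gradientD(1,2)[OF wg]
  have [measurable]: "g \<in> borel_measurable borel" unfolding g_def by measurable
  have wg_g: "wLp_integral p \<Omega> a g \<le> ennreal Q * M"
    unfolding wLp_integral_def Q_def M_def
  proof (rule oscillation_integral_le[OF p l])
    show "norm (g x) \<le> smoothing_const * (l / 2 * d x) powr (- real CARD('n)) * oscillation f x (2 * (l / 2 * d x))" if "x \<in> \<Omega>" for x
      using smoothing_pointwise(1)[OF \<tau> f that] unfolding g_def h_def \<tau>_def by simp
  qed simp_all
  have wg_G: "ennreal (l powr p) * wLp_integral p \<Omega> (a + p) G \<le> ennreal (2 powr p * Q) * M"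
  proof -
    have "ennreal (l powr p) * wLp_integral p \<Omega> (a + p) G = (\<integral>\<^sup>+x. ennreal (l powr p) * (indicator \<Omega> x * ennreal (norm (G x) powr p * d x powr (a + p))) \<partial>lborel)"
      unfolding wLp_integral_def by (rule nn_integral_cmult[symmetric]) measurable
    also have "\<dots> = (\<integral>\<^sup>+x. ennreal (2 powr p) * (indicator \<Omega> x * ennreal ((l / 2 * d x * norm (G x)) powr p * d x powr a)) \<partial>lborel)"
    proof (rule nn_integral_cong)
      fix x
      have "l powr p * (norm (G x) powr p * d x powr (a + p)) = 2 powr p * ((l / 2 * d x * norm (G x)) powr p * d x powr a)" 
        by (simp add: powr_mult powr_divide powr_add)
      then show "ennreal (l powr p) * (indicator \<Omega> x * ennreal (norm (G x) powr p * d x powr (a + p))) = ennreal (2 powr p) * (indicator \<Omega> x * ennreal ((l / 2 * d x * norm (G x)) powr p * d x powr a))"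
        by (simp add: indicator_def ennreal_mult'[symmetric])
    qed
    also have "\<dots> = ennreal (2 powr p) * (\<integral>\<^sup>+x. indicator \<Omega> x * ennreal ((l / 2 * d x * norm (G x)) powr p * d x powr a) \<partial>lborel)"
      by (rule nn_integral_cmult) measurable
    also have "\<dots> \<le> ennreal (2 powr p) * (ennreal Q * M)"
      unfolding Q_def M_def
    proof (intro mult_left_mono oscillation_integral_le[OF p l])
      show "l / 2 * d x * norm (G x) \<le> smoothing_const * (l / 2 * d x) powr (- real CARD('n)) * oscillation f x (2 * (l / 2 * d x))" if "x \<in> \<Omega>" for x
        using smoothing_pointwise(2)[OF \<tau> f that] unfolding G_def \<tau>_def .
    qed (use l d_nonneg in simp_all)
    also have "\<dots> = ennreal (2 powr p * Q) * M" using Q by (simp add: ennreal_mult mult.assoc)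
    finally show ?thesis .
  qed
  have w_h: "wLp_integral p \<Omega> a h \<le> ennreal (2 powr p) * (wLp_integral p \<Omega> a f + wLp_integral p \<Omega> a g)"
  proof -
    have "wLp_integral p \<Omega> a h \<le> ennreal (2 powr p) * (wLp_integral p \<Omega> a f + wLp_integral p \<Omega> a (\<lambda>x. - g x))"
      by (rule wLp_integral_add_le[OF p]) (auto simp: g_def)
    then show ?thesis by (simp add: wLp_integral_def)
  qed
  have fin_g: "wLp_integral p \<Omega> a g < \<infinity>" using le_less_trans[OF wg_g] M by (simp add: ennreal_mult_less_top)
  have fin_h: "wLp_integral p \<Omega> a h < \<infinity>" using le_less_trans[OF w_h] fin fin_g by (simp add: ennreal_mult_less_top)
  have fin_G: "wLp_integral p \<Omega> (a + p) G < \<infinity>"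
  proof -
    have "ennreal (l powr p) * wLp_integral p \<Omega> (a + p) G < \<infinity>"
      by (rule le_less_trans[OF wg_G]) (use M in \<open>simp add: ennreal_mult_less_top\<close>)
    then show ?thesis using l by (auto simp: ennreal_mult_less_top)
  qed
  have h_mem: "h \<in> W1p p \<Omega> a (a + p)" 
    and h_norm: "W1p_norm p \<Omega> a (a + p) h = enn2real (wLp_integral p \<Omega> a h) powr (1 / p) + enn2real (wLp_integral p \<Omega> (a + p) G) powr (1 / p)"
    using W1p_intro[OF p wg fin_h fin_G] by auto
  have g_mem: "g \<in> wLp p \<Omega> a" and g_norm: "wLp_norm p \<Omega> a g = enn2real (wLp_integral p \<Omega> a g) powr (1 / p)"
    using wLp_iff[OF p \<open>g \<in> borel_measurable borel\<close>, of g a] fin_g by auto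
  have f_mem: "f \<in> wLp p \<Omega> a" using wLp_iff(1)[OF p \<open>f \<in> borel_measurable borel\<close>, of f a] fin by auto
  define x1 where "x1 = enn2real (wLp_integral p \<Omega> a g) powr (1 / p)"
  define x2 where "x2 = enn2real (wLp_integral p \<Omega> a h) powr (1 / p)"
  define x3 where "x3 = enn2real (wLp_integral p \<Omega> (a + p) G) powr (1 / p)"
  have x: "0 \<le> x1" "0 \<le> x2" "0 \<le> x3" by (auto simp: x1_def x2_def x3_def)
  have "K_functional p \<Omega> a (a + p) l f \<le> wLp_norm p \<Omega> a g + l * W1p_norm p \<Omega> a (a + p) h"
    using l by (intro K_le g_mem h_mem) (auto simp: g_def)
  also have "\<dots> = x1 + l * x2 + l * x3" unfolding g_norm h_norm x1_def x2_def x3_def by (simp add: algebra_simps)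
  finally have "K_functional p \<Omega> a (a + p) l f powr p \<le> (x1 + l * x2 + l * x3) powr p"
    using p K_nonneg[OF p _ f_mem, of l "a + p"] l by (intro powr_mono2) auto
  also have "\<dots> \<le> 3 powr p * (x1 powr p + (l * x2) powr p + (l * x3) powr p)"
    using p x l by (intro add3_powr_le) auto
  finally have "ennreal (K_functional p \<Omega> a (a + p) l f powr p) \<le> ennreal (3 powr p * (x1 powr p + (l * x2) powr p + (l * x3) powr p))"
    by (rule ennreal_leI)
  also have "\<dots> = ennreal (3 powr p) * (ennreal (x1 powr p) + ennreal (l powr p) * ennreal (x2 powr p) + ennreal (l powr p) * ennreal (x3 powr p))"
    by (simp add: ennreal_mult powr_mult)
  also have "\<dots> = ennreal (3 powr p) * (wLp_integral p \<Omega> a g + ennreal (l powr p) * wLp_integral p \<Omega> a h + ennreal (l powr p) * wLp_integral p \<Omega> (a + p) G)"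
    unfolding x1_def x2_def x3_def wLp_integral_norm_powr[OF p fin_g] wLp_integral_norm_powr[OF p fin_h] wLp_integral_norm_powr[OF p fin_G] ..
  also have "\<dots> \<le> ennreal (3 powr p) * (ennreal Q * M + (ennreal (2 powr p) * (ennreal (l powr p) * wLp_integral p \<Omega> a f) + ennreal (2 powr p * Q) * M) + ennreal (2 powr p * Q) * M)"
  proof (intro mult_left_mono add_mono wg_g wg_G)
    have "ennreal (l powr p) * wLp_integral p \<Omega> a h \<le> ennreal (l powr p) * (ennreal (2 powr p) * (wLp_integral p \<Omega> a f + wLp_integral p \<Omega> a g))"
      using w_h by (rule mult_left_mono) simp
    also have "\<dots> = ennreal (2 powr p) * (ennreal (l powr p) * wLp_integral p \<Omega> a f) + ennreal (2 powr p) * (ennreal (l powr p) * wLp_integral p \<Omega> a g)"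
      by (simp add: distrib_left mult_ac)
    also have "\<dots> \<le> ennreal (2 powr p) * (ennreal (l powr p) * wLp_integral p \<Omega> a f) + ennreal (2 powr p) * (1 * (ennreal Q * M))"
      using l p by (intro add_left_mono mult_left_mono mult_mono wg_g) (auto intro!: powr_le1)
    also have "\<dots> = ennreal (2 powr p) * (ennreal (l powr p) * wLp_integral p \<Omega> a f) + ennreal (2 powr p * Q) * M"
      using Q by (simp add: ennreal_mult mult.assoc)
    finally show "ennreal (l powr p) * wLp_integral p \<Omega> a h \<le> ennreal (2 powr p) * (ennreal (l powr p) * wLp_integral p \<Omega> a f) + ennreal (2 powr p * Q) * M" .
  qed simp
  also have "\<dots> = ennreal (3 powr p) * (ennreal (Q + 2 * (2 powr p * Q)) * M + ennreal (2 powr p) * (ennreal (l powr p) * wLp_integral p \<Omega> a f))"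
  proof -
    have "ennreal (Q + 2 * (2 powr p * Q)) = ennreal Q + (ennreal (2 powr p * Q) + ennreal (2 powr p * Q))"
      using Q unfolding mult_2 by (simp only: ennreal_plus add_nonneg_nonneg mult_nonneg_nonneg powr_ge_zero less_imp_le)
    then show ?thesis by (simp only: distrib_right add_ac)
  qed
  also have "\<dots> \<le> ennreal (3 powr p) * (ennreal (Q + 2 * (2 powr p * Q) + 2 powr p) * M + ennreal (Q + 2 * (2 powr p * Q) + 2 powr p) * (ennreal (l powr p) * wLp_integral p \<Omega> a f))"
  proof -
    have le1: "Q + 2 * (2 powr p * Q) \<le> Q + 2 * (2 powr p * Q) + 2 powr p" by simp
    have le2: "2 powr p \<le> Q + 2 * (2 powr p * Q) + 2 powr p" using Q by simp
    show ?thesis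
      by (intro mult_left_mono add_mono[OF mult_right_mono[OF ennreal_leI[OF le1]] mult_right_mono[OF ennreal_leI[OF le2]]]) auto
  qed
  also have "\<dots> = ennreal (K_modulus_const p) * (M + ennreal (l powr p) * wLp_integral p \<Omega> a f)"
    unfolding K_modulus_const_def Q_def[symmetric] ennreal_mult'[OF powr_ge_zero]
    by (simp only: distrib_left mult.assoc)
  finally show ?thesis by (simp add: M_def)
qed

end

section \<open>Equivalence of the norms\<close>

text \<open>Taking \<open>p\<close>-th roots, with \<open>q = 1/p\<close>, of an estimate between \<open>p\<close>-th powers of norms.\<close>

lemma root_sum_le:
  fixes X T w c q :: real
  assumes "0 \<le> q" "0 \<le> X" "0 \<le> T" "0 \<le> w" "0 \<le> c" "X \<le> c * (T + w)"
  shows "X powr q \<le> c powr q * 2 powr q * (w powr q + T powr q)"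
proof -
  have "X powr q \<le> (c * (T + w)) powr q" using assms by (intro powr_mono2) auto
  also have "\<dots> = c powr q * (w + T) powr q" by (simp add: powr_mult add.commute)
  also have "\<dots> \<le> c powr q * (2 powr q * (w powr q + T powr q))"
    using assms by (intro mult_left_mono add_powr_le) auto
  finally show ?thesis by (simp add: mult.assoc)
qed

lemma root_le:
  fixes X T c q :: real
  assumes "0 \<le> q" "0 \<le> X" "X \<le> c * T"
  shows "X powr q \<le> c powr q * T powr q"
proof -
  have "X powr q \<le> (c * T) powr q" using assms by (intro powr_mono2) auto
  then show ?thesis by (simp add: powr_mult)
qed

context bounded_open
begin

text \<open>The K-functional is monotone in \<open>l\<close> and therefore measurable.\<close>

lemma interp_integral_lborel:
  assumes p: "1 \<le> p" and f: "f \<in> wLp p \<Omega> a"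
  shows "interp_integral s p \<Omega> a b f
    = (\<integral>\<^sup>+l. (if 0 < l then ennreal (l powr (- s * p - 1) * K_functional p \<Omega> a b l f powr p) else 0) \<partial>lborel)"
    and "(\<lambda>l. if 0 < l then ennreal (l powr (- s * p - 1) * K_functional p \<Omega> a b l f powr p) else 0) \<in> borel_measurable borel"
proof -
  define K where "K = (\<lambda>l. if 0 < l then K_functional p \<Omega> a b l f else 0)"
  have "mono K"
    using K_mono[OF p _ _ f] K_nonneg[OF p _ f] by (intro monoI) (auto simp: K_def)
  then have [measurable]: "(\<lambda>l. if 0 < l then K_functional p \<Omega> a b l f else 0) \<in> borel_measurable borel"
    unfolding K_def by (rule borel_measurable_mono)
  have "(\<lambda>l. if 0 < l then ennreal (l powr (- s * p - 1) * K_functional p \<Omega> a b l f powr p) else 0)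
    = (\<lambda>l. if 0 < l then ennreal (l powr (- s * p - 1) * (if 0 < l then K_functional p \<Omega> a b l f else 0) powr p) else 0)" by auto
  also have "\<dots> \<in> borel_measurable borel" by measurable
  finally show "(\<lambda>l. if 0 < l then ennreal (l powr (- s * p - 1) * K_functional p \<Omega> a b l f powr p) else 0) \<in> borel_measurable borel" .
  have "interp_integral s p \<Omega> a b f = (\<integral>\<^sup>+l. indicator {0<..} l * ennreal (l powr (- s * p) * (if 0 < l then K_functional p \<Omega> a b l f else 0) powr p / l) \<partial>lborel)"
    unfolding interp_integral_def by (rule nn_integral_lebesgue_on_Borel) auto
  also have "\<dots> = (\<integral>\<^sup>+l. (if 0 < l then ennreal (l powr (- s * p - 1) * K_functional p \<Omega> a b l f powr p) else 0) \<partial>lborel)"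
  proof (rule nn_integral_cong)
    fix l :: real
    show "indicator {0<..} l * ennreal (l powr (- s * p) * (if 0 < l then K_functional p \<Omega> a b l f else 0) powr p / l)
      = (if 0 < l then ennreal (l powr (- s * p - 1) * K_functional p \<Omega> a b l f powr p) else 0)"
      by (simp add: powr_diff)
  qed
  finally show "interp_integral s p \<Omega> a b f
    = (\<integral>\<^sup>+l. (if 0 < l then ennreal (l powr (- s * p - 1) * K_functional p \<Omega> a b l f powr p) else 0) \<partial>lborel)" .
qed

lemma K_functional_cong_AE:
  assumes "AE x in lborel. x \<in> \<Omega> \<longrightarrow> f x = f0 x"
  shows "K_functional p \<Omega> a b l f = K_functional p \<Omega> a b l f0"
proof -
  have ae: "AE x in lebesgue_on \<Omega>. f x = f0 x" using assms by (simp add: AE_lebesgue_on_iff)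
  have "(AE x in lebesgue_on \<Omega>. f x = g x + h x) \<longleftrightarrow> (AE x in lebesgue_on \<Omega>. f0 x = g x + h x)" for g h
  proof
    assume "AE x in lebesgue_on \<Omega>. f x = g x + h x"
    with ae show "AE x in lebesgue_on \<Omega>. f0 x = g x + h x" by eventually_elim simp
  next
    assume "AE x in lebesgue_on \<Omega>. f0 x = g x + h x"
    with ae show "AE x in lebesgue_on \<Omega>. f x = g x + h x" by eventually_elim simp
  qed
  then show ?thesis by (simp add: K_functional_def)
qed

text \<open>Large scales alone recover the norm of \<open>f\<close>: integrate over \<open>l \<ge> 1\<close>.\<close>

lemma wLp_integral_le_interp:
  assumes p: "1 \<le> p" and s: "0 < s" and f: "f \<in> wLp p \<Omega> a" 
    and f0: "f0 \<in> borel_measurable borel" "AE x in lborel. x \<in> \<Omega> \<longrightarrow> f x = f0 x"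
  shows "wLp_integral p \<Omega> a f0 \<le> ennreal (s * p * (2 powr p * 2)) * interp_integral s p \<Omega> a b f"
proof -
  have sp: "0 < s * p" using s p by simp
  have "wLp_integral p \<Omega> a f0 * ennreal (1 / (s * p)) = (\<integral>\<^sup>+l. wLp_integral p \<Omega> a f0 * (ennreal (l powr (- (s * p) - 1)) * indicator {1..} l) \<partial>lborel)"
    using nn_integral_powr_tail[OF sp, of 1] by (subst nn_integral_cmult) auto
  also have "\<dots> \<le> (\<integral>\<^sup>+l. ennreal (2 powr p * 2) * (if 0 < l then ennreal (l powr (- s * p - 1) * K_functional p \<Omega> a b l f powr p) else 0) \<partial>lborel)"
  proof (rule nn_integral_mono)
    fix l :: real
    show "wLp_integral p \<Omega> a f0 * (ennreal (l powr (- (s * p) - 1)) * indicator {1..} l)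
      \<le> ennreal (2 powr p * 2) * (if 0 < l then ennreal (l powr (- s * p - 1) * K_functional p \<Omega> a b l f powr p) else 0)"
    proof (cases "1 \<le> l")
      case True
      have "wLp_integral p \<Omega> a f0 * ennreal (l powr (- (s * p) - 1)) \<le> (ennreal (2 powr p * 2) * ennreal (K_functional p \<Omega> a b l f powr p)) * ennreal (l powr (- (s * p) - 1))"
        by (intro mult_right_mono wLp_integral_le_K[OF p True f f0]) simp
      also have "\<dots> = ennreal (2 powr p * 2) * ennreal (l powr (- s * p - 1) * K_functional p \<Omega> a b l f powr p)"
        by (simp add: ennreal_mult mult_ac)
      finally show ?thesis using True by simp
    qed simp
  qed
  also have "\<dots> = ennreal (2 powr p * 2) * interp_integral s p \<Omega> a b f"
    unfolding interp_integral_lborel(1)[OF p f] using interp_integral_lborel(2)[OF p f] by (intro nn_integral_cmult) simp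
  finally have "ennreal (s * p) * (wLp_integral p \<Omega> a f0 * ennreal (1 / (s * p))) \<le> ennreal (s * p) * (ennreal (2 powr p * 2) * interp_integral s p \<Omega> a b f)"
    by (rule mult_left_mono) simp
  moreover have "ennreal (s * p) * (wLp_integral p \<Omega> a f0 * ennreal (1 / (s * p))) = wLp_integral p \<Omega> a f0"
  proof -
    have "ennreal (s * p) * (wLp_integral p \<Omega> a f0 * ennreal (1 / (s * p))) = (ennreal (s * p) * ennreal (1 / (s * p))) * wLp_integral p \<Omega> a f0"
      by (simp only: mult_ac)
    also have "ennreal (s * p) * ennreal (1 / (s * p)) = 1" using sp s p by (simp add: ennreal_mult'[symmetric])
    finally show ?thesis by simp
  qed
  moreover have "ennreal (s * p) * (ennreal (2 powr p * 2) * interp_integral s p \<Omega> a b f) = ennreal (s * p * (2 powr p * 2)) * interp_integral s p \<Omega> a b f"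
    using sp by (subst ennreal_mult'[of "s * p"]) (auto simp: mult.assoc)
  ultimately show ?thesis by simp
qed

lemma modulus_average_le_interp:
  assumes p: "1 \<le> p" and a: "0 \<le> a" and f: "f \<in> wLp p \<Omega> a" 
    and f0: "f0 \<in> borel_measurable borel" "AE x in lborel. x \<in> \<Omega> \<longrightarrow> f x = f0 x"
  shows "modulus_average s p a f0 \<le> ennreal (modulus_K_const p a) * interp_integral s p \<Omega> a (a + p) f"
proof -
  have "modulus_average s p a f0 \<le> (\<integral>\<^sup>+l. ennreal (modulus_K_const p a) * (if 0 < l then ennreal (l powr (- s * p - 1) * K_functional p \<Omega> a (a + p) l f powr p) else 0) \<partial>lborel)"
    unfolding modulus_average_def
  proof (rule nn_integral_mono)
    fix l :: real
    show "(if 0 < l \<and> l \<le> 1 then ennreal (l powr (- s * p - 1)) * modulus p a f0 l else 0)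
      \<le> ennreal (modulus_K_const p a) * (if 0 < l then ennreal (l powr (- s * p - 1) * K_functional p \<Omega> a (a + p) l f powr p) else 0)"
    proof (cases "0 < l")
      case True
      have "ennreal (l powr (- s * p - 1)) * modulus p a f0 l \<le> ennreal (l powr (- s * p - 1)) * (ennreal (modulus_K_const p a) * ennreal (K_functional p \<Omega> a (a + p) l f powr p))"
        by (intro mult_left_mono modulus_le_K[OF p True a f f0]) simp
      also have "\<dots> = ennreal (modulus_K_const p a) * ennreal (l powr (- s * p - 1) * K_functional p \<Omega> a (a + p) l f powr p)"
        by (simp add: ennreal_mult mult_ac)
      finally show ?thesis using True by simp
    qed simp
  qed
  also have "\<dots> = ennreal (modulus_K_const p a) * interp_integral s p \<Omega> a (a + p) f"
    unfolding interp_integral_lborel(1)[OF p f] using interp_integral_lborel(2)[OF p f] by (intro nn_integral_cmult) simp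
  finally show ?thesis .
qed

text \<open>Scales below \<open>1/2\<close> are controlled by the modulus, with a remainder \<open>l^p\<close> that is integrable against
  \<open>l^(-sp-1)\<close> at \<open>0\<close> because \<open>s < 1\<close>. For larger scales \<open>g = f\<close> is a good enough decomposition.\<close>

lemma interp_le_modulus_average:
  assumes p: "1 \<le> p" and s: "0 < s" "s < 1" and a: "0 \<le> a" and f: "f \<in> wLp p \<Omega> a" 
    and f0: "f0 \<in> borel_measurable borel" "AE x in lborel. x \<in> \<Omega> \<longrightarrow> f x = f0 x"
  shows "interp_integral s p \<Omega> a (a + p) f \<le> ennreal (K_modulus_const p) * modulus_average s p a f0
    + ennreal (K_modulus_const p / (p * (1 - s)) + 2 powr (s * p) / (s * p)) * wLp_integral p \<Omega> a f0"
proof -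
  have sp: "0 < s * p" and q: "0 < p * (1 - s)" using s p by auto
  define w where "w = wLp_integral p \<Omega> a f0"
  have w: "w < \<infinity>" using f wLp_iff(1)[OF p f0, of a] by (simp add: w_def)
  have f0m: "f0 \<in> wLp p \<Omega> a" using wLp_iff(1)[OF p f0(1), of f0 a] w by (simp add: w_def)
  define C where "C = K_modulus_const p"
  have C: "C > 0" using osc_const_pos[of p] by (simp add: C_def K_modulus_const_def add_pos_pos)
  have [measurable]: "f0 \<in> borel_measurable borel" by (rule f0(1))
  have modm [measurable]: "modulus p a f0 \<in> borel_measurable borel"
    unfolding modulus_def[abs_def] modulus_kernel_def by measurable
  have le: "(if 0 < l then ennreal (l powr (- s * p - 1) * K_functional p \<Omega> a (a + p) l f powr p) else 0)
    \<le> ennreal C * (if 0 < l \<and> l \<le> 1 then ennreal (l powr (- s * p - 1)) * modulus p a f0 l else 0)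
      + (ennreal C * w * (ennreal (l powr (p * (1 - s) - 1)) * indicator {0..1} l) + w * (ennreal (l powr (- (s * p) - 1)) * indicator {1/2..} l))" for l :: real
  proof (cases "0 < l")
    case l: True
    have split: "ennreal (l powr (- (s * p) - 1) * K_functional p \<Omega> a (a + p) l f powr p) = ennreal (l powr (- (s * p) - 1)) * ennreal (K_functional p \<Omega> a (a + p) l f powr p)"
      by (simp add: ennreal_mult)
    show ?thesis
    proof (cases "l \<le> 1/2")
      case True
      have "ennreal (K_functional p \<Omega> a (a + p) l f powr p) \<le> ennreal C * (modulus p a f0 l + ennreal (l powr p) * w)"
        using K_le_modulus[OF p a l True f0(1)] w K_functional_cong_AE[OF f0(2), of p a "a + p" l] by (simp add: C_def w_def)
      then have "ennreal (l powr (- (s * p) - 1)) * ennreal (K_functional p \<Omega> a (a + p) l f powr p) \<le> ennreal (l powr (- (s * p) - 1)) * (ennreal C * (modulus p a f0 l + ennreal (l powr p) * w))"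
        by (rule mult_left_mono) simp
      also have "\<dots> = ennreal C * (ennreal (l powr (- (s * p) - 1)) * modulus p a f0 l) + ennreal C * w * (ennreal (l powr (- (s * p) - 1)) * ennreal (l powr p))"
        by (simp add: distrib_left mult_ac)
      also have "ennreal (l powr (- (s * p) - 1)) * ennreal (l powr p) = ennreal (l powr (p * (1 - s) - 1))"
        by (simp add: ennreal_mult'[symmetric] powr_add[symmetric] algebra_simps)
      also have "ennreal C * (ennreal (l powr (- (s * p) - 1)) * modulus p a f0 l) + ennreal C * w * ennreal (l powr (p * (1 - s) - 1))
        \<le> ennreal C * (ennreal (l powr (- (s * p) - 1)) * modulus p a f0 l)
          + (ennreal C * w * ennreal (l powr (p * (1 - s) - 1)) + w * (ennreal (l powr (- (s * p) - 1)) * indicator {1/2..} l))"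
        by (intro add_left_mono add_increasing2) auto
      finally show ?thesis using l True by (simp add: split)
    next
      case False
      have "K_functional p \<Omega> a (a + p) l f powr p \<le> wLp_norm p \<Omega> a f powr p"
        using K_le_norm[OF p _ f, of l "a + p"] K_nonneg[OF p _ f, of l "a + p"] l p by (intro powr_mono2) auto
      then have "ennreal (K_functional p \<Omega> a (a + p) l f powr p) \<le> ennreal (wLp_norm p \<Omega> a f powr p)" by (rule ennreal_leI)
      also have "\<dots> = w" using wLp_integral_norm_powr[OF p w] wLp_iff(2)[OF p f0, of a] by (simp add: w_def)
      finally have "ennreal (l powr (- (s * p) - 1)) * ennreal (K_functional p \<Omega> a (a + p) l f powr p) \<le> ennreal (l powr (- (s * p) - 1)) * w"
        by (rule mult_left_mono) simp
      also have "\<dots> = w * (ennreal (l powr (- (s * p) - 1)) * indicator {1/2..} l)"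
        using l False by (simp add: mult.commute)
      also have "\<dots> \<le> ennreal C * (if 0 < l \<and> l \<le> 1 then ennreal (l powr (- s * p - 1)) * modulus p a f0 l else 0)
        + (ennreal C * w * (ennreal (l powr (p * (1 - s) - 1)) * indicator {0..1} l) + w * (ennreal (l powr (- (s * p) - 1)) * indicator {1/2..} l))"
        by (intro add_increasing) auto
      finally show ?thesis using l by (simp add: split)
    qed
  qed simp
  have "interp_integral s p \<Omega> a (a + p) f \<le> (\<integral>\<^sup>+l. ennreal C * (if 0 < l \<and> l \<le> 1 then ennreal (l powr (- s * p - 1)) * modulus p a f0 l else 0)
      + (ennreal C * w * (ennreal (l powr (p * (1 - s) - 1)) * indicator {0..1} l) + w * (ennreal (l powr (- (s * p) - 1)) * indicator {1/2..} l)) \<partial>lborel)"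
    unfolding interp_integral_lborel(1)[OF p f] by (intro nn_integral_mono le)
  also have "\<dots> = ennreal C * modulus_average s p a f0
    + (ennreal C * w * (\<integral>\<^sup>+l. ennreal (l powr (p * (1 - s) - 1)) * indicator {0..1} l \<partial>lborel) + w * (\<integral>\<^sup>+l. ennreal (l powr (- (s * p) - 1)) * indicator {1/2..} l \<partial>lborel))"
    unfolding modulus_average_def by (simp add: nn_integral_add nn_integral_cmult)
  also have "\<dots> = ennreal C * modulus_average s p a f0 + (ennreal C * w * ennreal (1 / (p * (1 - s))) + w * ennreal ((1/2) powr (- (s * p)) / (s * p)))"
    using nn_integral_powr_from_0[OF q, of 1] nn_integral_powr_tail[OF sp, of "1/2"] by simp
  also have "ennreal C * w * ennreal (1 / (p * (1 - s))) + w * ennreal ((1/2) powr (- (s * p)) / (s * p)) = ennreal (C / (p * (1 - s)) + 2 powr (s * p) / (s * p)) * w"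
  proof -
    have "(1/2) powr (- (s * p)) = 2 powr (s * p)" by (simp add: powr_minus powr_divide)
    moreover have "ennreal C * w * ennreal (1 / (p * (1 - s))) = ennreal (C / (p * (1 - s))) * w"
    proof -
      have "ennreal C * w * ennreal (1 / (p * (1 - s))) = (ennreal C * ennreal (1 / (p * (1 - s)))) * w" by (simp only: mult_ac)
      then show ?thesis using C by (simp add: ennreal_mult'[symmetric])
    qed
    ultimately show ?thesis
      using C sp q by (subst ennreal_plus) (auto simp: distrib_left mult.commute)
  qed
  finally show ?thesis by (simp add: C_def w_def)
qed

text \<open>All comparisons between \<open>p\<close>-th powers of the norms, with a common constant. They hold for extended
  real values, so that finiteness of one side transfers to the other and the spaces coincide.\<close>

lemma equivalence_estimates:
  assumes p: "1 \<le> p" and s: "0 < s" "s < 1" and a: "0 \<le> a"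
  shows "\<exists>c>0. \<forall>f\<in>wLp p \<Omega> a. Lp_integral p \<Omega> (weighted p \<Omega> a f) \<le> ennreal c * interp_integral s p \<Omega> a (a + p) f \<and>
    Wt_integral s p \<Omega> (a + s * p) f \<le> ennreal c * interp_integral s p \<Omega> a (a + p) f \<and>
    interp_integral s p \<Omega> a (a + p) f \<le> ennreal c * (Wt_integral s p \<Omega> (a + s * p) f + Lp_integral p \<Omega> (weighted p \<Omega> a f)) \<and>
    Wt_integral s p \<Omega> (a + s * p) f \<le> ennreal c * Ws_integral s p \<Omega> (a + s * p) f \<and>
    Ws_integral s p \<Omega> (a + s * p) f \<le> ennreal c * (Wt_integral s p \<Omega> (a + s * p) f + Lp_integral p \<Omega> (weighted p \<Omega> a f))"
proof -
  have sp: "0 < s * p" using s p by simp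
  define c1 where "c1 = s * p * (2 powr p * 2)"
  define c2 where "c2 = 2 powr (s * p + real CARD('n) + 1) * modulus_K_const p a"
  define c3 where "c3 = K_modulus_const p + (K_modulus_const p / (p * (1 - s)) + 2 powr (s * p) / (s * p))"
  define c4 where "c4 = 2 powr (a + s * p)"
  define c5 where "c5 = 2 + 2 * 2 powr (p + s * p) * ((real CARD('n) + s * p) * unit_ball_vol (real CARD('n)) / (s * p))"
  have sc: "K_modulus_const p > 0" using osc_const_pos[of p] by (simp add: K_modulus_const_def add_pos_pos)
  have e: "0 \<le> K_modulus_const p / (p * (1 - s)) + 2 powr (s * p) / (s * p)"
    using sc s p sp by (intro add_nonneg_nonneg divide_nonneg_pos) auto
  have v: "0 \<le> 2 * 2 powr (p + s * p) * ((real CARD('n) + s * p) * unit_ball_vol (real CARD('n)) / (s * p))"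
    using sp by (intro mult_nonneg_nonneg divide_nonneg_pos) auto
  have c: "c1 > 0" "c2 \<ge> 0" "c3 > 0" "c4 > 0" "c5 > 0"
    using sp sc e v s p by (auto simp: c1_def c2_def c3_def c4_def c5_def modulus_K_const_def add_pos_nonneg)
  define c where "c = c1 + c2 + c3 + c4 + c5"
  have cc: "c1 \<le> c" "c2 \<le> c" "c3 \<le> c" "c4 \<le> c" "c5 \<le> c" "0 < c" using c by (auto simp: c_def)
  have up: "X \<le> ennreal c' * Y \<Longrightarrow> c' \<le> c \<Longrightarrow> X \<le> ennreal c * Y" for X Y c'
    by (erule order_trans) (intro mult_right_mono ennreal_leI, auto)
  have est: "Lp_integral p \<Omega> (weighted p \<Omega> a f) \<le> ennreal c * interp_integral s p \<Omega> a (a + p) f \<and>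
    Wt_integral s p \<Omega> (a + s * p) f \<le> ennreal c * interp_integral s p \<Omega> a (a + p) f \<and>
    interp_integral s p \<Omega> a (a + p) f \<le> ennreal c * (Wt_integral s p \<Omega> (a + s * p) f + Lp_integral p \<Omega> (weighted p \<Omega> a f)) \<and>
    Wt_integral s p \<Omega> (a + s * p) f \<le> ennreal c * Ws_integral s p \<Omega> (a + s * p) f \<and>
    Ws_integral s p \<Omega> (a + s * p) f \<le> ennreal c * (Wt_integral s p \<Omega> (a + s * p) f + Lp_integral p \<Omega> (weighted p \<Omega> a f))"
    if f: "f \<in> wLp p \<Omega> a" for f
  proof -
    have "f \<in> borel_measurable (lebesgue_on \<Omega>)" using f by (simp add: wLp_def)
    then obtain f0 where f0: "f0 \<in> borel_measurable borel" "AE x in lborel. x \<in> \<Omega> \<longrightarrow> f x = f0 x"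
      by (rule borel_representative[OF \<Omega>_measurable])
    note eqs = Lp_integral_weighted[OF p f0, of a] Wt_integral_lborel[OF f0] Ws_integral_lborel[OF f0]
    define T where "T = Wt_lborel s p (a + s * p) f0"
    define S where "S = Ws_lborel s p (a + s * p) f0"
    define w where "w = wLp_integral p \<Omega> a f0"
    define I where "I = interp_integral s p \<Omega> a (a + p) f"
    define A where "A = modulus_average s p a f0"
    note MA = modulus_average_equiv_Wt[OF p s(1) f0(1) refl, of a, folded T_def A_def]
    have 1: "w \<le> ennreal c1 * I" unfolding w_def I_def c1_def by (rule wLp_integral_le_interp[OF p s(1) f f0])
    have 2: "T \<le> ennreal c2 * I"
    proof -
      have "T \<le> ennreal (2 powr (s * p + real CARD('n) + 1)) * A" by (rule MA(2))
      also have "\<dots> \<le> ennreal (2 powr (s * p + real CARD('n) + 1)) * (ennreal (modulus_K_const p a) * I)"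
        unfolding A_def I_def by (intro mult_left_mono modulus_average_le_interp[OF p a f f0]) simp
      also have "\<dots> = ennreal c2 * I" unfolding c2_def by (subst ennreal_mult') (auto simp: mult.assoc)
      finally show ?thesis .
    qed
    have 3: "I \<le> ennreal c3 * (T + w)"
    proof -
      have "I \<le> ennreal (K_modulus_const p) * A + ennreal (K_modulus_const p / (p * (1 - s)) + 2 powr (s * p) / (s * p)) * w"
        unfolding I_def A_def w_def by (rule interp_le_modulus_average[OF p s a f f0])
      also have "\<dots> \<le> ennreal c3 * T + ennreal c3 * w"
        using sc e by (intro add_mono mult_mono MA(1) ennreal_leI) (auto simp: c3_def)
      finally show ?thesis by (simp add: distrib_left)
    qed
    have 4: "T \<le> ennreal c4 * S" unfolding T_def S_def c4_def using a sp by (intro Wt_le_Ws f0(1)) simp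
    have 5: "S \<le> ennreal c5 * (T + w)"
    proof -
      have "S \<le> 2 * T + ennreal (2 * 2 powr (p + s * p) * ((real CARD('n) + s * p) * unit_ball_vol (real CARD('n)) / (s * p))) * w"
        unfolding S_def T_def w_def by (rule Ws_le_Wt[OF f0(1) p s(1) a refl])
      also have "\<dots> \<le> ennreal c5 * T + ennreal c5 * w"
      proof (intro add_mono mult_right_mono)
        have "ennreal 2 \<le> ennreal c5" using v by (intro ennreal_leI) (simp add: c5_def)
        then show "2 \<le> ennreal c5" by simp
        show "ennreal (2 * 2 powr (p + s * p) * ((real CARD('n) + s * p) * unit_ball_vol (real CARD('n)) / (s * p))) \<le> ennreal c5"
          by (intro ennreal_leI) (simp add: c5_def)
      qed auto
      finally show ?thesis by (simp add: distrib_left)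
    qed
    show ?thesis unfolding eqs T_def[symmetric] S_def[symmetric] w_def[symmetric] I_def[symmetric]
      using up[OF 1 cc(1)] up[OF 2 cc(2)] up[OF 3 cc(3)] up[OF 4 cc(4)] up[OF 5 cc(5)] by blast
  qed
  show ?thesis using cc(6) est by (intro exI[of _ c] conjI ballI) auto
qed

end

lemma enn2real_le_mult:
  assumes "X \<le> ennreal c * Y" "Y < \<infinity>" "0 \<le> c"
  shows "enn2real X \<le> c * enn2real Y" "X < \<infinity>"
proof -
  have fin: "ennreal c * Y < \<infinity>" using assms(2) by (simp add: ennreal_mult_less_top)
  then show "X < \<infinity>" using assms(1) by (rule le_less_trans[rotated])
  have "enn2real X \<le> enn2real (ennreal c * Y)" using assms(1) fin by (intro enn2real_mono) auto
  then show "enn2real X \<le> c * enn2real Y" using assms(3) by (simp add: enn2real_mult)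
qed

theorem theorem1p1:
  fixes \<Omega> :: "(real ^ 'n) set" and p s \<alpha> :: real
  assumes "open \<Omega>" and "connected \<Omega>" and "\<Omega> \<noteq> {}" and "bounded \<Omega>"
    and "1 \<le> p" and "0 < s" and "s < 1" and "0 \<le> \<alpha>"
  shows "eq_with_equivalent_norms
           (interp_space s p \<Omega> (\<alpha> * p) ((\<alpha> + 1) * p)) (interp_norm s p \<Omega> (\<alpha> * p) ((\<alpha> + 1) * p))
           (Wt s p \<Omega> (\<alpha> * p) ((\<alpha> + s) * p)) (Wt_norm s p \<Omega> (\<alpha> * p) ((\<alpha> + s) * p))
       \<and> eq_with_equivalent_norms
           (Wt s p \<Omega> (\<alpha> * p) ((\<alpha> + s) * p)) (Wt_norm s p \<Omega> (\<alpha> * p) ((\<alpha> + s) * p))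
           (Ws s p \<Omega> (\<alpha> * p) ((\<alpha> + s) * p)) (Ws_norm s p \<Omega> (\<alpha> * p) ((\<alpha> + s) * p))"
proof -
  interpret bounded_open \<Omega> by unfold_locales (use assms in auto)
  define a where "a = \<alpha> * p"
  have a: "0 \<le> a" using assms by (simp add: a_def)
  have exps: "(\<alpha> + 1) * p = a + p" "(\<alpha> + s) * p = a + s * p" by (simp_all add: a_def algebra_simps)
  define w where "w = (\<lambda>f :: real ^ 'n \<Rightarrow> real. Lp_integral p \<Omega> (weighted p \<Omega> a f))"
  define I where "I = (\<lambda>f. interp_integral s p \<Omega> a (a + p) f)"
  define T where "T = (\<lambda>f. Wt_integral s p \<Omega> (a + s * p) f)"
  define S where "S = (\<lambda>f. Ws_integral s p \<Omega> (a + s * p) f)"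
  define L :: "(real ^ 'n \<Rightarrow> real) set" where "L = wLp p \<Omega> a"
  obtain c where c: "0 < c" and est: "\<forall>f\<in>L. w f \<le> ennreal c * I f \<and> T f \<le> ennreal c * I f \<and>
    I f \<le> ennreal c * (T f + w f) \<and> T f \<le> ennreal c * S f \<and> S f \<le> ennreal c * (T f + w f)"
    using equivalence_estimates[OF assms(5-7) a] unfolding w_def I_def T_def S_def L_def by blast
  have wI: "w f \<le> ennreal c * I f" and TI: "T f \<le> ennreal c * I f" and IT: "I f \<le> ennreal c * (T f + w f)"
    and TS: "T f \<le> ennreal c * S f" and ST: "S f \<le> ennreal c * (T f + w f)" if "f \<in> L" for f
    using est that by blast+
  have wfin: "w f < \<infinity>" if "f \<in> L" for f using that by (simp add: L_def w_def wLp_def)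
  define q where "q = 1 / p"
  have q: "0 \<le> q" using assms by (simp add: q_def)
  have c0: "0 \<le> c" using c by simp
  \<comment> \<open>one constant for the four inequalities between norms\<close>
  define C where "C = 1 + 2 * c powr q + c powr q * 2 powr q"
  have C: "C > 0" "c powr q * 2 powr q \<le> C" "2 * c powr q \<le> C" "1 + c powr q * 2 powr q \<le> C" "1 + c powr q \<le> C"
    by (auto simp: C_def add_pos_nonneg)
  have sum_fin: "T f + w f < \<infinity>" if "f \<in> L" "T f < \<infinity>" for f using that wfin by simp
  have real_sum: "enn2real (T f + w f) = enn2real (T f) + enn2real (w f)" if "f \<in> L" "T f < \<infinity>" for f
    using that wfin[OF that(1)] by (intro enn2real_plus) auto
  have finite_iff: "I f < \<infinity> \<longleftrightarrow> T f < \<infinity>" "T f < \<infinity> \<longleftrightarrow> S f < \<infinity>" if f: "f \<in> L" for f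
    using enn2real_le_mult(2)[OF TI[OF f] _ c0] enn2real_le_mult(2)[OF IT[OF f] sum_fin[OF f] c0]
      enn2real_le_mult(2)[OF TS[OF f] _ c0] enn2real_le_mult(2)[OF ST[OF f] sum_fin[OF f] c0] by blast+
  define NI where "NI = (\<lambda>f. enn2real (I f) powr q)"
  define NT where "NT = (\<lambda>f. enn2real (w f) powr q + enn2real (T f) powr q)"
  define NS where "NS = (\<lambda>f. enn2real (w f) powr q + enn2real (S f) powr q)"
  have "NI f \<le> C * NT f \<and> NT f \<le> C * NI f" if f: "f \<in> L" "I f < \<infinity>" for f
  proof
    have T: "T f < \<infinity>" using f finite_iff by blast
    have "enn2real (I f) \<le> c * (enn2real (T f) + enn2real (w f))"
      using enn2real_le_mult(1)[OF IT[OF f(1)] sum_fin[OF f(1) T] c0] real_sum[OF f(1) T] by simp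
    then have "NI f \<le> c powr q * 2 powr q * NT f"
      unfolding NI_def NT_def using q c0 by (intro root_sum_le) auto
    also have "\<dots> \<le> C * NT f" using C by (intro mult_right_mono) (auto simp: NT_def)
    finally show "NI f \<le> C * NT f" .
    have "enn2real (w f) powr q \<le> c powr q * NI f" "enn2real (T f) powr q \<le> c powr q * NI f"
      unfolding NI_def using enn2real_le_mult(1)[OF wI[OF f(1)] f(2) c0] enn2real_le_mult(1)[OF TI[OF f(1)] f(2) c0] q by (auto intro: root_le)
    then have "NT f \<le> 2 * c powr q * NI f" unfolding NT_def by linarith
    also have "\<dots> \<le> C * NI f" using C by (intro mult_right_mono) (auto simp: NI_def)
    finally show "NT f \<le> C * NI f" .
  qed
  moreover have "NT f \<le> C * NS f \<and> NS f \<le> C * NT f" if f: "f \<in> L" "T f < \<infinity>" for f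
  proof
    have S: "S f < \<infinity>" using f finite_iff by blast
    have "enn2real (T f) powr q \<le> c powr q * enn2real (S f) powr q"
      using enn2real_le_mult(1)[OF TS[OF f(1)] S c0] q by (auto intro: root_le)
    then have "NT f \<le> enn2real (w f) powr q + c powr q * enn2real (S f) powr q" unfolding NT_def by linarith
    also have "\<dots> \<le> (1 + c powr q) * NS f" unfolding NS_def by (simp add: algebra_simps)
    also have "\<dots> \<le> C * NS f" using C by (intro mult_right_mono) (auto simp: NS_def)
    finally show "NT f \<le> C * NS f" .
    have "enn2real (S f) \<le> c * (enn2real (T f) + enn2real (w f))"
      using enn2real_le_mult(1)[OF ST[OF f(1)] sum_fin[OF f] c0] real_sum[OF f] by simp
    then have "enn2real (S f) powr q \<le> c powr q * 2 powr q * NT f"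
      unfolding NT_def using q c0 by (intro root_sum_le) auto
    moreover have "enn2real (w f) powr q \<le> NT f" by (simp add: NT_def)
    ultimately have "NS f \<le> (1 + c powr q * 2 powr q) * NT f" unfolding NS_def by (simp add: distrib_right)
    also have "\<dots> \<le> C * NT f" using C by (intro mult_right_mono) (auto simp: NT_def)
    finally show "NS f \<le> C * NT f" .
  qed
  moreover have "interp_space s p \<Omega> a (a + p) = {f \<in> L. I f < \<infinity>}" "Wt s p \<Omega> a (a + s * p) = {f \<in> L. T f < \<infinity>}" "Ws s p \<Omega> a (a + s * p) = {f \<in> L. S f < \<infinity>}"
    by (simp_all add: interp_space_def Wt_def Ws_def L_def I_def T_def S_def)
  moreover have "interp_norm s p \<Omega> a (a + p) = NI" "Wt_norm s p \<Omega> a (a + s * p) = NT" "Ws_norm s p \<Omega> a (a + s * p) = NS"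
    by (simp_all add: fun_eq_iff interp_norm_def Wt_norm_def Ws_norm_def wLp_norm_def Lp_norm_def NI_def NT_def NS_def I_def T_def S_def w_def q_def)
  ultimately show ?thesis
    unfolding exps a_def[symmetric] eq_with_equivalent_norms_def
    using C(1) finite_iff by (intro conjI exI[of _ C]) auto
qed

end
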